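(* Let $\Gamma$ be a metric graph, let $D$ be a divisor on $\Gamma$, and let $\Sigma \subseteq R(D)$ be a tropical linear series. Then $|\Sigma|$ has pure dimension equal to $r_{\mathrm{BN}}(\Sigma)$ (i.e. $|\Sigma|$ has local dimension $r_{\mathrm{BN}}(\Sigma)$ at every one of its points).
   Context: A metric graph is a compact connected length metric space in which every point $p$ has a neighborhood isometric, with $p$ going to the center, to a star with $n_p\ge 1$ legs (equivalently, the metric space of a finite connected graph, possibly with loops and multiple edges, with positive real edge lengths); $n_p$ is the valence of $p$. A tangent direction at $p$ is a germ of isometric embeddings $\alpha\colon[0,\epsilon]\to\Gamma$ with $\alpha(0)=p$. A divisor on $\Gamma$ is a finite formal sum $D=\sum a_ip_i$ with $a_i\in\mathbb Z$, $p_i\in\Gamma$; $\deg D=\sum a_i$; $D\ge 0$ (effective) if all $a_i\ge0$. $\mathrm{PL}(\Gamma)$ is the set of continuous piecewise-linear functions $\Gamma\to\mathbb R$ with integer slopes; $s_\zeta(\varphi)$ is the outgoing slope of $\varphi$ along a tangent direction $\zeta$, and $\mathrm{div}(\varphi)=\sum_p\big(-\sum_{\zeta \text{ at } p}s_\zeta(\varphi)\big)p$. $R(D)=\{\varphi\in\mathrm{PL}(\Gamma): D+\mathrm{div}(\varphi)\ge0\}$. A tropical submodule of $\mathrm{PL}(\Gamma)$ or $R(D)$ is a subset closed under pointwise minimum and addition of real constants (a zero element $\infty$ is tacitly adjoined); it is finitely generated if it is the set of all finite tropical linear combinations $\min_i\{\varphi_i+a_i\}$ of a finite set of elements. For a tropical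 submodule $\Sigma\subseteq R(D)$: the Baker–Norine rank $r_{\mathrm{BN}}(\Sigma)$ is the largest integer $r$ such that for every effective divisor $D'$ of degree $r$ there is $\varphi\in\Sigma$ with $D-D'+\mathrm{div}(\varphi)\ge0$. A finite set $\{\varphi_0,\dots,\varphi_s\}\subseteq \mathrm{PL}(\Gamma)$ is tropically dependent if there are reals $a_0,\dots,a_s$ such that at every point of $\Gamma$ the minimum $\min_i\{\varphi_i+a_i\}$ is achieved by at least two indices, and tropically independent otherwise. The independence rank $r_{\mathrm{ind}}(\Sigma)$ is the size of the largest tropically independent subset of $\Sigma$. A tropical linear series is a finitely generated submodule $\Sigma\subseteq R(D)$ with $r_{\mathrm{ind}}(\Sigma)=r_{\mathrm{BN}}(\Sigma)+1$. $|\Sigma|=\{D+\mathrm{div}(\varphi):\varphi\in\Sigma\}\subseteq \mathrm{Sym}^d(\Gamma)=\Gamma^d/S_d$, $d=\deg D$. $\mathrm{Sym}^d(\Gamma)$ is a polyhedral space: after choosing a simple graph model of $\Gamma$ with oriented edges, the relative interior of a face consists of the effective divisors with prescribed multiplicities at the vertices and with, in the interior of each edge, a prescribed ordered sequence of multiplicities of distinct points; it is parametrized by the positions of these points. For finitely generated $\Sigma$, $|\Sigma|$ is a polyhedral subset of $\mathrm{Sym}^d(\Gamma)$, and dimension is that of a polyhedral set. *)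

theory Defs
  imports
    "HOL-Analysis.Analysis"
    "HOL-Analysis.Finite_Function_Topology"
begin

section \<open>Metric graphs\<close>

definition path_length :: "(real \<Rightarrow> 'a::metric_space) \<Rightarrow> ennreal" where
  "path_length g =
     (SUP ts\<in>{ts. sorted ts \<and> set ts \<subseteq> {0..1}}.
        ennreal (\<Sum>i<length ts - 1. dist (g (ts ! i)) (g (ts ! Suc i))))"

definition length_metric_on :: "'a::metric_space set \<Rightarrow> bool" where
  "length_metric_on \<Gamma> \<longleftrightarrow>
     (\<forall>p\<in>\<Gamma>. \<forall>q\<in>\<Gamma>. ennreal (dist p q) =
        (INF g\<in>{g. path g \<and> path_image g \<subseteq> \<Gamma> \<and> pathstart g = p \<and> pathfinish g = q}. path_length g))"

text \<open>A star with \<open>n\<close> legs is a union of \<open>n\<close> intervals glued at their initial points, with the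
  length metric; \<open>leg i t\<close> is the point of the \<open>i\<close>-th leg at distance \<open>t\<close> from the center.
  A neighbourhood of \<open>p\<close> isometric to a star contains a ball of this form.\<close>

definition star_at :: "'a::metric_space set \<Rightarrow> 'a \<Rightarrow> nat \<Rightarrow> bool" where
  "star_at \<Gamma> p n \<longleftrightarrow>
     (\<exists>\<epsilon>>0. \<exists>leg :: nat \<Rightarrow> real \<Rightarrow> 'a.
        (\<forall>i<n. leg i 0 = p) \<and>
        (\<forall>i<n. \<forall>j<n. \<forall>s\<in>{0..<\<epsilon>}. \<forall>t\<in>{0..<\<epsilon>}.
           dist (leg i s) (leg j t) = (if i = j then \<bar>s - t\<bar> else s + t)) \<and>
        ball p \<epsilon> \<inter> \<Gamma> = (\<Union>i<n. leg i ` {0..<\<epsilon>}))"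

definition metric_graph :: "'a::metric_space set \<Rightarrow> bool" where
  "metric_graph \<Gamma> \<longleftrightarrow>
     \<Gamma> \<noteq> {} \<and> compact \<Gamma> \<and> connected \<Gamma> \<and> length_metric_on \<Gamma> \<and>
     (\<forall>p\<in>\<Gamma>. \<exists>n\<ge>1. star_at \<Gamma> p n)"

definition isometric_segment :: "'a::metric_space set \<Rightarrow> real \<Rightarrow> (real \<Rightarrow> 'a) \<Rightarrow> bool" where
  "isometric_segment \<Gamma> l \<alpha> \<longleftrightarrow>
     \<alpha> ` {0..l} \<subseteq> \<Gamma> \<and> (\<forall>s\<in>{0..l}. \<forall>t\<in>{0..l}. dist (\<alpha> s) (\<alpha> t) = \<bar>s - t\<bar>)"

definition germs_at :: "'a::metric_space set \<Rightarrow> 'a \<Rightarrow> (real \<Rightarrow> 'a) set" where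
  "germs_at \<Gamma> p = {\<alpha>. (\<exists>\<epsilon>>0. isometric_segment \<Gamma> \<epsilon> \<alpha>) \<and> \<alpha> 0 = p}"

definition tangent_directions :: "'a::metric_space set \<Rightarrow> 'a \<Rightarrow> (real \<Rightarrow> 'a) set set" where
  "tangent_directions \<Gamma> p =
     germs_at \<Gamma> p //
       {(\<alpha>, \<beta>). \<alpha> \<in> germs_at \<Gamma> p \<and> \<beta> \<in> germs_at \<Gamma> p \<and> (\<forall>\<^sub>F t in at_right 0. \<alpha> t = \<beta> t)}"


section \<open>Divisors and piecewise linear functions\<close>

text \<open>The library order on \<^typ>\<open>'a \<Rightarrow>\<^sub>0 int\<close> is not the pointwise one, so effectivity is spelled out.\<close>

definition divisor_on :: "'a set \<Rightarrow> ('a \<Rightarrow>\<^sub>0 int) \<Rightarrow> bool" where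
  "divisor_on \<Gamma> D \<longleftrightarrow> Poly_Mapping.keys D \<subseteq> \<Gamma>"

definition divisor_degree :: "('a \<Rightarrow>\<^sub>0 int) \<Rightarrow> int" where
  "divisor_degree D = (\<Sum>p\<in>Poly_Mapping.keys D. Poly_Mapping.lookup D p)"

definition effective :: "('a \<Rightarrow>\<^sub>0 int) \<Rightarrow> bool" where
  "effective D \<longleftrightarrow> (\<forall>p. 0 \<le> Poly_Mapping.lookup D p)"

text \<open>Functions on \<open>\<Gamma>\<close> are extensional, so that equality of functions is equality on \<open>\<Gamma>\<close>.
  Piecewise linear means: along every geodesic segment there are finitely many breakpoints,
  between which the function is affine with integer slope.\<close>

definition PL :: "'a::metric_space set \<Rightarrow> ('a \<Rightarrow> real) set" where
  "PL \<Gamma> = {\<phi> \<in> extensional \<Gamma>. continuous_on \<Gamma> \<phi> \<and>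
     (\<forall>l>0. \<forall>\<gamma>. isometric_segment \<Gamma> l \<gamma> \<longrightarrow>
        (\<exists>B. finite B \<and>
           (\<forall>a b. 0 \<le> a \<and> a < b \<and> b \<le> l \<and> {a<..<b} \<inter> B = {} \<longrightarrow>
              (\<exists>(m::int) c. \<forall>t\<in>{a..b}. \<phi> (\<gamma> t) = of_int m * t + c))))}"

definition slope :: "('a \<Rightarrow> real) \<Rightarrow> (real \<Rightarrow> 'a) set \<Rightarrow> int" where
  "slope \<phi> \<zeta> = (THE m. \<forall>\<alpha>\<in>\<zeta>. \<forall>\<^sub>F t in at_right 0. \<phi> (\<alpha> t) = \<phi> (\<alpha> 0) + of_int m * t)"

definition pl_div :: "'a::metric_space set \<Rightarrow> ('a \<Rightarrow> real) \<Rightarrow> 'a \<Rightarrow>\<^sub>0 int" where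
  "pl_div \<Gamma> \<phi> = Poly_Mapping.Abs_poly_mapping (\<lambda>p. - (\<Sum>\<zeta>\<in>tangent_directions \<Gamma> p. slope \<phi> \<zeta>))"

definition R :: "'a::metric_space set \<Rightarrow> ('a \<Rightarrow>\<^sub>0 int) \<Rightarrow> ('a \<Rightarrow> real) set" where
  "R \<Gamma> D = {\<phi> \<in> PL \<Gamma>. effective (D + pl_div \<Gamma> \<phi>)}"


section \<open>Tropical linear series\<close>

text \<open>Only the real-valued elements of a tropical module are recorded; the element \<open>\<infinity>\<close> is left
  implicit. Accordingly a coefficient \<open>\<infinity>\<close> in a tropical linear combination is expressed by
  leaving out the generator, and \<open>{}\<close> stands for the zero module \<open>{\<infinity>}\<close>.\<close>

definition tropical_submodule :: "'a::metric_space set \<Rightarrow> ('a \<Rightarrow> real) set \<Rightarrow> bool" where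
  "tropical_submodule \<Gamma> \<Sigma> \<longleftrightarrow>
     \<Sigma> \<subseteq> PL \<Gamma> \<and>
     (\<forall>\<phi>\<in>\<Sigma>. \<forall>\<psi>\<in>\<Sigma>. (\<lambda>x\<in>\<Gamma>. min (\<phi> x) (\<psi> x)) \<in> \<Sigma>) \<and>
     (\<forall>\<phi>\<in>\<Sigma>. \<forall>c. (\<lambda>x\<in>\<Gamma>. \<phi> x + c) \<in> \<Sigma>)"

definition tropical_span :: "'a set \<Rightarrow> ('a \<Rightarrow> real) set \<Rightarrow> ('a \<Rightarrow> real) set" where
  "tropical_span \<Gamma> G =
     {(\<lambda>x\<in>\<Gamma>. Min ((\<lambda>\<phi>. \<phi> x + a \<phi>) ` H)) | H a. H \<subseteq> G \<and> finite H \<and> H \<noteq> {}}"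

definition finitely_generated :: "'a set \<Rightarrow> ('a \<Rightarrow> real) set \<Rightarrow> bool" where
  "finitely_generated \<Gamma> \<Sigma> \<longleftrightarrow> (\<exists>G. finite G \<and> G \<subseteq> \<Sigma> \<and> \<Sigma> = tropical_span \<Gamma> G)"

definition tropically_dependent :: "'a set \<Rightarrow> ('a \<Rightarrow> real) set \<Rightarrow> bool" where
  "tropically_dependent \<Gamma> F \<longleftrightarrow>
     (\<exists>a. \<forall>x\<in>\<Gamma>. 2 \<le> card {\<phi>\<in>F. \<phi> x + a \<phi> = Min ((\<lambda>\<psi>. \<psi> x + a \<psi>) ` F)})"

text \<open>For negative \<open>r\<close> the condition is vacuous, so the zero module has rank \<open>-1\<close>.\<close>

definition BN_rank :: "'a::metric_space set \<Rightarrow> ('a \<Rightarrow>\<^sub>0 int) \<Rightarrow> ('a \<Rightarrow> real) set \<Rightarrow> int" where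
  "BN_rank \<Gamma> D \<Sigma> =
     (GREATEST r. \<forall>D'. divisor_on \<Gamma> D' \<and> effective D' \<and> divisor_degree D' = r \<longrightarrow>
        (\<exists>\<phi>\<in>\<Sigma>. effective (D - D' + pl_div \<Gamma> \<phi>)))"

definition ind_rank :: "'a set \<Rightarrow> ('a \<Rightarrow> real) set \<Rightarrow> nat" where
  "ind_rank \<Gamma> \<Sigma> =
     (GREATEST n. \<exists>F\<subseteq>\<Sigma>. finite F \<and> \<not> tropically_dependent \<Gamma> F \<and> card F = n)"

definition tropical_linear_series ::
    "'a::metric_space set \<Rightarrow> ('a \<Rightarrow>\<^sub>0 int) \<Rightarrow> ('a \<Rightarrow> real) set \<Rightarrow> bool" where
  "tropical_linear_series \<Gamma> D \<Sigma> \<longleftrightarrow>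
     \<Sigma> \<subseteq> R \<Gamma> D \<and> tropical_submodule \<Gamma> \<Sigma> \<and> finitely_generated \<Gamma> \<Sigma> \<and>
     int (ind_rank \<Gamma> \<Sigma>) = BN_rank \<Gamma> D \<Sigma> + 1"

definition linear_system ::
    "'a::metric_space set \<Rightarrow> ('a \<Rightarrow>\<^sub>0 int) \<Rightarrow> ('a \<Rightarrow> real) set \<Rightarrow> ('a \<Rightarrow>\<^sub>0 int) set" where
  "linear_system \<Gamma> D \<Sigma> = (\<lambda>\<phi>. D + pl_div \<Gamma> \<phi>) ` \<Sigma>"


section \<open>The symmetric product as a polyhedral space\<close>

text \<open>The quotient topology along the map \<open>\<Gamma>^d \<rightarrow> Sym^d \<Gamma>\<close>, with points of
  \<open>Sym^d \<Gamma> = \<Gamma>^d/S_d\<close> written as effective divisors of degree \<open>d\<close>.\<close>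

definition Sym :: "'a::metric_space set \<Rightarrow> nat \<Rightarrow> ('a \<Rightarrow>\<^sub>0 int) topology" where
  "Sym \<Gamma> d = topology (\<lambda>U.
     U \<subseteq> {E. divisor_on \<Gamma> E \<and> effective E \<and> divisor_degree E = int d} \<and>
     openin (product_topology (\<lambda>_. top_of_set \<Gamma>) {..<d})
       {f \<in> {..<d} \<rightarrow>\<^sub>E \<Gamma>. (\<Sum>i<d. Poly_Mapping.single (f i) 1) \<in> U})"

lemma openin_Sym:
  "openin (Sym \<Gamma> d) U \<longleftrightarrow>
     U \<subseteq> {E. divisor_on \<Gamma> E \<and> effective E \<and> divisor_degree E = int d} \<and>
     openin (product_topology (\<lambda>_. top_of_set \<Gamma>) {..<d})
       {f \<in> {..<d} \<rightarrow>\<^sub>E \<Gamma>. (\<Sum>i<d. Poly_Mapping.single (f i) 1) \<in> U}"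
proof -
  let ?X = "product_topology (\<lambda>_. top_of_set \<Gamma>) {..<d}"
  let ?pre = "\<lambda>U. {f \<in> {..<d} \<rightarrow>\<^sub>E \<Gamma>. (\<Sum>i<d. Poly_Mapping.single (f i) (1::int)) \<in> U}"
  have "?pre (U \<inter> U') = ?pre U \<inter> ?pre U'" for U U'
    by blast
  moreover have "?pre (\<Union>\<U>) = \<Union>(?pre ` \<U>)" for \<U>
    by blast
  ultimately have "istopology (\<lambda>U.
      U \<subseteq> {E. divisor_on \<Gamma> E \<and> effective E \<and> divisor_degree E = int d} \<and> openin ?X (?pre U))"
    unfolding istopology_def by (auto intro!: openin_Int openin_Union)
  then show ?thesis
    unfolding Sym_def by (simp add: topology_inverse')
qed

text \<open>An oriented edge is a pair \<open>(l, \<gamma>)\<close> with \<open>\<gamma>\<close> an arc length parametrization on \<open>[0, l]\<close>.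
  An edge need not be a geodesic, so \<open>\<gamma>\<close> is only locally isometric.\<close>

type_synonym 'a edge = "real \<times> (real \<Rightarrow> 'a)"

definition edge_interior :: "'a edge \<Rightarrow> 'a set" where
  "edge_interior e = snd e ` {0<..<fst e}"

definition edge_ends :: "'a edge \<Rightarrow> 'a set" where
  "edge_ends e = {snd e 0, snd e (fst e)}"

definition is_edge :: "'a::metric_space set \<Rightarrow> 'a set \<Rightarrow> 'a edge \<Rightarrow> bool" where
  "is_edge \<Gamma> V e \<longleftrightarrow>
     (case e of (l, \<gamma>) \<Rightarrow>
       0 < l \<and> \<gamma> ` {0..l} \<subseteq> \<Gamma> \<and> inj_on \<gamma> {0..l} \<and>
       (\<forall>t\<in>{0..l}. \<exists>\<epsilon>>0. \<forall>s\<in>{0..l} \<inter> ball t \<epsilon>. \<forall>s'\<in>{0..l} \<inter> ball t \<epsilon>.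
          dist (\<gamma> s) (\<gamma> s') = \<bar>s - s'\<bar>)) \<and>
     edge_ends e \<subseteq> V \<and> edge_interior e \<inter> V = {}"

definition simple_graph_model :: "'a::metric_space set \<Rightarrow> 'a set \<Rightarrow> 'a edge set \<Rightarrow> bool" where
  "simple_graph_model \<Gamma> V \<E> \<longleftrightarrow>
     finite V \<and> finite \<E> \<and> V \<subseteq> \<Gamma> \<and> (\<forall>e\<in>\<E>. is_edge \<Gamma> V e) \<and>
     pairwise (\<lambda>e e'. edge_interior e \<inter> edge_interior e' = {} \<and> edge_ends e \<noteq> edge_ends e') \<E> \<and>
     \<Gamma> = V \<union> (\<Union>e\<in>\<E>. edge_interior e)"

text \<open>A face is given by a multiplicity \<open>m v\<close> at each vertex \<open>v\<close> and, for each edge \<open>e\<close>, the list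
  \<open>\<mu> e\<close> of positive multiplicities of the successive points in the interior of \<open>e\<close>. Its relative
  interior is parametrized by \<open>face_coords\<close>, an open polyhedron in \<open>\<real>^I\<close> with \<open>I = face_index \<E> \<mu>\<close>
  finite: the coordinate \<open>(e, j)\<close> is the position on \<open>e\<close> of its \<open>j\<close>-th point.\<close>

definition face_index :: "'a edge set \<Rightarrow> ('a edge \<Rightarrow> nat list) \<Rightarrow> ('a edge \<times> nat) set" where
  "face_index \<E> \<mu> = {(e, j). e \<in> \<E> \<and> j < length (\<mu> e)}"

definition face_coords ::
    "'a edge set \<Rightarrow> ('a edge \<Rightarrow> nat list) \<Rightarrow> ('a edge \<times> nat \<Rightarrow>\<^sub>0 real) set" where
  "face_coords \<E> \<mu> =
     {x. Poly_Mapping.keys x \<subseteq> face_index \<E> \<mu> \<and>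
         (\<forall>e\<in>\<E>. \<forall>j<length (\<mu> e). Poly_Mapping.lookup x (e, j) \<in> {0<..<fst e}) \<and>
         (\<forall>e\<in>\<E>. \<forall>i j. i < j \<and> j < length (\<mu> e) \<longrightarrow>
            Poly_Mapping.lookup x (e, i) < Poly_Mapping.lookup x (e, j))}"

definition face_point ::
    "'a set \<Rightarrow> 'a edge set \<Rightarrow> ('a \<Rightarrow> nat) \<Rightarrow> ('a edge \<Rightarrow> nat list) \<Rightarrow>
     ('a edge \<times> nat \<Rightarrow>\<^sub>0 real) \<Rightarrow> 'a \<Rightarrow>\<^sub>0 int" where
  "face_point V \<E> m \<mu> x =
     (\<Sum>v\<in>V. Poly_Mapping.single v (int (m v))) +
     (\<Sum>(e, j)\<in>face_index \<E> \<mu>.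
        Poly_Mapping.single (snd e (Poly_Mapping.lookup x (e, j))) (int (\<mu> e ! j)))"

text \<open>The dimension of a nonempty polyhedral set \<open>S\<close> in \<open>Sym^d \<Gamma>\<close> (or of its intersection with an
  open set): the largest dimension of a polytope, equivalently of a simplex, that lies in the
  interior of a face, in its coordinates, and is contained in \<open>S\<close>. It is at most \<open>d\<close>.\<close>

definition polyhedral_dim :: "'a set \<Rightarrow> 'a edge set \<Rightarrow> ('a \<Rightarrow>\<^sub>0 int) set \<Rightarrow> nat" where
  "polyhedral_dim V \<E> S =
     Sup {n. \<exists>m \<mu> W. (\<forall>e\<in>\<E>. 0 \<notin> set (\<mu> e)) \<and>
            finite W \<and> card W = n + 1 \<and> \<not> affine_dependent W \<and>
            convex hull W \<subseteq> face_coords \<E> \<mu> \<and>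
            face_point V \<E> m \<mu> ` (convex hull W) \<subseteq> S}"

definition local_dim ::
    "'a::metric_space set \<Rightarrow> 'a set \<Rightarrow> 'a edge set \<Rightarrow> nat \<Rightarrow> ('a \<Rightarrow>\<^sub>0 int) set \<Rightarrow>
     ('a \<Rightarrow>\<^sub>0 int) \<Rightarrow> nat" where
  "local_dim \<Gamma> V \<E> d S x =
     (INF U\<in>{U. openin (Sym \<Gamma> d) U \<and> x \<in> U}. polyhedral_dim V \<E> (S \<inter> U))"

end

theory Submission
  imports Defs
begin

text \<open>
  Fix generators of \<open>\<Sigma>\<close> and write an element as a minimum of translates of generators, dropping
  those that are redundant. The remaining ones are tropically independent, since each of them is
  the unique minimizer somewhere, so at most \<open>r + 1\<close> of them occur. The breakpoints of such a minimum are
  affine functions of the differences of its coefficients, which bounds the dimension of \<open>|\<Sigma>|\<close> by \<open>r\<close>.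

  For the lower bound, let \<open>\<theta>\<close> be an irredundant minimum with at most \<open>r\<close> terms. Pick a generic
  point in the region where each term is the minimizer. The Baker--Norine property gives \<open>\<psi> \<in> \<Sigma>\<close>
  bending at all these points, so that \<open>min \<theta> (\<psi> + c)\<close>, for \<open>c\<close> slightly below \<open>max (\<theta> - \<psi>)\<close>,
  is close to \<open>\<theta>\<close> and needs more terms. Hence every element of \<open>\<Sigma>\<close> is a limit of irredundant minima
  with \<open>r + 1\<close> terms, and moving the coefficients of one of these sweeps out an \<open>r\<close>-dimensional
  simplex of divisors.

  Divisors depend continuously on the function, and determine it up to a constant, by Green's formula
  for the pairing \<open>\<Sum>\<^sub>x div \<phi> (x) h(x)\<close>, applied with tent functions \<open>h\<close> in the former case.
\<close>

section \<open>Piecewise linear functions on an interval\<close>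

text \<open>The coefficients of a minimum are not determined by the function: a redundant term can
  be raised freely. In an irredundant one each coefficient can be read off where its term alone is
  minimal, up to the constant lost in passing to divisors. So irredundant minima carry the dimension
  count, and r + 1 terms give dimension r. The obstacle is that dimension is measured inside single
  faces of the symmetric product, while the divisor is only piecewise affine in the coefficients:
  support points that coincide may separate, or leave a vertex, as soon as the coefficients move.
  Hence the lower bound first makes the coefficients generic. That the face then stays the same
  follows from continuity in the form of conservation of mass: the mass in small balls changes by
  less than one unit, hence not at all. In the upper bound the simplex is given and may cross many
  types of minima; there it is covered by finitely many affine cells, one of which contains it. The
  hypothesis on ranks makes the two counts meet: r + 1 terms are the most that independence permits
  and the least that the Baker--Norine property forces, after approximation.\<close>

text \<open>The functions \<open>p\<close> and \<open>q\<close> record the outgoing slopes of \<open>u\<close> to the right and to the left,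
  so \<open>p t = - q t\<close> wherever \<open>u\<close> does not bend.\<close>

definition pwl ::
    "(real \<Rightarrow> real) \<Rightarrow> (real \<Rightarrow> real) \<Rightarrow> (real \<Rightarrow> real) \<Rightarrow> real \<Rightarrow> real \<Rightarrow> real set \<Rightarrow> bool" where
  "pwl u p q a b T \<longleftrightarrow>
     (\<forall>x y. a \<le> x \<and> x < y \<and> y \<le> b \<and> {x<..<y} \<inter> T = {} \<longrightarrow>
        (\<exists>m c. (\<forall>t\<in>{x..y}. u t = m * t + c) \<and> p x = m \<and> q y = - m))"

text \<open>If T contains a, b and all breaks of u, this equals minus the integral of u' h' over
  [a, b]: a gap from x to y with slope m contributes m (h x - h y). The half-open ranges leave out
  the slope at a to the left and the slope at b to the right, which point out of the
  interval.\<close>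

definition pairing ::
    "(real \<Rightarrow> real) \<Rightarrow> (real \<Rightarrow> real) \<Rightarrow> real set \<Rightarrow> real \<Rightarrow> real \<Rightarrow> (real \<Rightarrow> real) \<Rightarrow> real" where
  "pairing p q T a b h = (\<Sum>t\<in>T \<inter> {a..<b}. p t * h t) + (\<Sum>t\<in>T \<inter> {a<..b}. q t * h t)"

lemma pwl_gap:
  assumes "pwl u p q a b T" "a \<le> x" "x < y" "y \<le> b" "{x<..<y} \<inter> T = {}"
  shows "\<exists>m c. (\<forall>t\<in>{x..y}. u t = m * t + c) \<and> p x = m \<and> q y = - m"
proof -
  have "\<forall>x y. a \<le> x \<and> x < y \<and> y \<le> b \<and> {x<..<y} \<inter> T = {} \<longrightarrow>
        (\<exists>m c. (\<forall>t\<in>{x..y}. u t = m * t + c) \<and> p x = m \<and> q y = - m)"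
    using assms(1) by (simp only: pwl_def)
  moreover have "a \<le> x \<and> x < y \<and> y \<le> b \<and> {x<..<y} \<inter> T = {}"
    using assms(2-5) by (intro conjI)
  ultimately show ?thesis
    by (elim allE[of _ x] allE[of _ y]) (erule (1) mp)
qed

lemma pwl_subinterval:
  assumes "pwl u p q a b T" "a \<le> a'" "b' \<le> b"
  shows "pwl u p q a' b' T"
  unfolding pwl_def
proof (intro allI impI)
  fix x y assume "a' \<le> x \<and> x < y \<and> y \<le> b' \<and> {x<..<y} \<inter> T = {}"
  then show "\<exists>m c. (\<forall>t\<in>{x..y}. u t = m * t + c) \<and> p x = m \<and> q y = - m"
    using assms by (intro pwl_gap[OF assms(1)]) auto
qed

lemma pwl_diff:
  assumes "pwl u p q a b T" "pwl u' p' q' a b T"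
  shows "pwl (\<lambda>t. u t - u' t) (\<lambda>t. p t - p' t) (\<lambda>t. q t - q' t) a b T"
  unfolding pwl_def
proof (intro allI impI)
  fix x y assume *: "a \<le> x \<and> x < y \<and> y \<le> b \<and> {x<..<y} \<inter> T = {}"
  obtain m c where "\<forall>t\<in>{x..y}. u t = m * t + c" "p x = m" "q y = - m"
    using pwl_gap[OF assms(1)] * by blast
  moreover obtain m' c' where "\<forall>t\<in>{x..y}. u' t = m' * t + c'" "p' x = m'" "q' y = - m'"
    using pwl_gap[OF assms(2)] * by blast
  ultimately show "\<exists>m c. (\<forall>t\<in>{x..y}. u t - u' t = m * t + c) \<and> p x - p' x = m \<and> q y - q' y = - m"
    by (intro exI[of _ "m - m'"] exI[of _ "c - c'"]) (auto simp: algebra_simps)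
qed

lemma pairing_diff:
  "finite T \<Longrightarrow> pairing (\<lambda>t. p t - p' t) (\<lambda>t. q t - q' t) T a b h = pairing p q T a b h - pairing p' q' T a b h"
  by (simp add: pairing_def left_diff_distrib sum_subtractf)

lemma pairing_split:
  assumes "finite T" "a \<le> c" "c \<le> b"
  shows "pairing p q T a b h = pairing p q T a c h + pairing p q T c b h"
proof -
  have "T \<inter> {a..<b} = (T \<inter> {a..<c}) \<union> (T \<inter> {c..<b})" "T \<inter> {a<..b} = (T \<inter> {a<..c}) \<union> (T \<inter> {c<..b})"
    using assms by auto
  moreover have "(T \<inter> {a..<c}) \<inter> (T \<inter> {c..<b}) = {}" "(T \<inter> {a<..c}) \<inter> (T \<inter> {c<..b}) = {}"
    by auto
  ultimately show ?thesis
    using assms(1) by (simp add: pairing_def sum.union_disjoint)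
qed

lemma pairing_no_break:
  assumes "a < b" "a \<in> T" "b \<in> T" "T \<inter> {a<..<b} = {}"
  shows "pairing p q T a b h = p a * h a + q b * h b"
proof -
  have "T \<inter> {a..<b} = {a}" "T \<inter> {a<..b} = {b}"
    using assms by (auto simp: disjoint_iff less_le)
  then show ?thesis by (simp add: pairing_def)
qed

text \<open>Induction on the number of breaks strictly between a and b. Splitting at an arbitrary
  break spares the enumeration of T in increasing order.\<close>

lemma break_induct [consumes 2, case_names gap split]:
  fixes T :: "real set"
  assumes "finite T" "a < b"
    and gap: "\<And>a b. a < b \<Longrightarrow> {a<..<b} \<inter> T = {} \<Longrightarrow> P a b"
    and split: "\<And>a b c. a < c \<Longrightarrow> c < b \<Longrightarrow> c \<in> T \<Longrightarrow> P a c \<Longrightarrow> P c b \<Longrightarrow> P a b"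
  shows "P a b"
  using \<open>a < b\<close>
proof (induction "card (T \<inter> {a<..<b})" arbitrary: a b rule: less_induct)
  case less
  show ?case
  proof (cases "{a<..<b} \<inter> T = {}")
    case True
    then show ?thesis using gap less.prems by simp
  next
    case False
    then obtain c where c: "c \<in> T" "a < c" "c < b" by auto
    have "T \<inter> {a<..<c} \<subset> T \<inter> {a<..<b}" "T \<inter> {c<..<b} \<subset> T \<inter> {a<..<b}"
      using c by auto
    then have "card (T \<inter> {a<..<c}) < card (T \<inter> {a<..<b})" "card (T \<inter> {c<..<b}) < card (T \<inter> {a<..<b})"
      using \<open>finite T\<close> by (simp_all add: psubset_card_mono)
    then show ?thesis using less.hyps c split by blast
  qed
qed

text \<open>Green's formula. On a gap both end terms carry the same slope m up to sign and give - m
  n (b - a), which is - n times the increment of u; increments add up under splitting. The right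
  side has values of u but no slopes, which later allows bounds by the size of u alone.\<close>

lemma pairing_affine:
  assumes "finite T" "a < b" "pwl u p q a b T" "a \<in> T" "b \<in> T" "\<forall>t\<in>{a..b}. h t = n * t + k"
  shows "pairing p q T a b h = - n * (u b - u a)"
  using assms
proof (induction rule: break_induct)
  case (gap a b)
  obtain m c where "\<forall>t\<in>{a..b}. u t = m * t + c" "p a = m" "q b = - m"
    using pwl_gap[of u p q a b T a b] gap by auto
  moreover have "pairing p q T a b h = p a * h a + q b * h b"
    using gap by (intro pairing_no_break) auto
  ultimately show ?case
    using gap by (simp add: algebra_simps)
next
  case (split a b c)
  have "pwl u p q a c T" "pwl u p q c b T"
    using split by (auto elim: pwl_subinterval)
  then have "pairing p q T a c h = - n * (u c - u a)" "pairing p q T c b h = - n * (u b - u c)"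
    using split by auto
  then show ?case
    using pairing_split[of T a c b p q h] split \<open>finite T\<close> by (simp add: algebra_simps)
qed

text \<open>C is twice the sum of the absolute slopes of h over its pieces. It is chosen before u
  and T, so neither the number of breaks of u nor the size of its slopes enters.\<close>

lemma pairing_bound:
  assumes "finite S" "a < b"
    and "\<forall>x y. a \<le> x \<and> x < y \<and> y \<le> b \<and> {x<..<y} \<inter> S = {} \<longrightarrow> (\<exists>n k. \<forall>t\<in>{x..y}. h t = n * t + k)"
  shows "\<exists>C\<ge>0. \<forall>u p q T M. finite T \<longrightarrow> pwl u p q a b T \<longrightarrow> S \<union> {a, b} \<subseteq> T \<longrightarrow> (\<forall>t\<in>{a..b}. \<bar>u t\<bar> \<le> M) \<longrightarrow>
           \<bar>pairing p q T a b h\<bar> \<le> C * M"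
  using assms
proof (induction rule: break_induct)
  case (gap a b)
  obtain n k where h: "\<forall>t\<in>{a..b}. h t = n * t + k"
    using gap by (metis order_refl)
  show ?case
  proof (intro exI[of _ "2 * \<bar>n\<bar>"] conjI allI impI)
    fix u p q T M
    assume T: "finite T" "pwl u p q a b T" "S \<union> {a, b} \<subseteq> T" and M: "\<forall>t\<in>{a..b}. \<bar>u t\<bar> \<le> M"
    have "pairing p q T a b h = - n * (u b - u a)"
      using T h \<open>a < b\<close> by (intro pairing_affine) auto
    moreover have "\<bar>u b - u a\<bar> \<le> 2 * M"
      using M[rule_format, of a] M[rule_format, of b] \<open>a < b\<close> by auto
    ultimately show "\<bar>pairing p q T a b h\<bar> \<le> 2 * \<bar>n\<bar> * M"
      using mult_left_mono[of "\<bar>u b - u a\<bar>" "2 * M" "\<bar>n\<bar>"] by (simp add: abs_mult)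
  qed simp
next
  case (split a b c)
  obtain C where C: "C \<ge> 0" "\<And>u p q T M. finite T \<Longrightarrow> pwl u p q a c T \<Longrightarrow> S \<union> {a, c} \<subseteq> T \<Longrightarrow>
      (\<forall>t\<in>{a..c}. \<bar>u t\<bar> \<le> M) \<Longrightarrow> \<bar>pairing p q T a c h\<bar> \<le> C * M"
    using split.IH(1) split.prems split.hyps(2) by fastforce
  obtain C' where C': "C' \<ge> 0" "\<And>u p q T M. finite T \<Longrightarrow> pwl u p q c b T \<Longrightarrow> S \<union> {c, b} \<subseteq> T \<Longrightarrow>
      (\<forall>t\<in>{c..b}. \<bar>u t\<bar> \<le> M) \<Longrightarrow> \<bar>pairing p q T c b h\<bar> \<le> C' * M"
    using split.IH(2) split.prems split.hyps(1) by fastforce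
  show ?case
  proof (intro exI[of _ "C + C'"] conjI allI impI)
    fix u p q T M
    assume T: "finite T" "pwl u p q a b T" "S \<union> {a, b} \<subseteq> T" and M: "\<forall>t\<in>{a..b}. \<bar>u t\<bar> \<le> M"
    have "\<bar>pairing p q T a c h\<bar> \<le> C * M"
      using T M split.hyps by (intro C(2)[of T u]) (auto intro: pwl_subinterval)
    moreover have "\<bar>pairing p q T c b h\<bar> \<le> C' * M"
      using T M split.hyps by (intro C'(2)[of T u]) (auto intro: pwl_subinterval)
    ultimately show "\<bar>pairing p q T a b h\<bar> \<le> (C + C') * M"
      using pairing_split[of T a c b p q h] T(1) split.hyps by (simp add: algebra_simps)
  qed (use C C' in simp)
qed

text \<open>The pairing of \<open>u\<close> with itself is minus the Dirichlet energy of \<open>u\<close>.\<close>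

lemma pairing_self:
  assumes "finite T" "a < b" "pwl u p q a b T" "a \<in> T" "b \<in> T"
  shows "pairing p q T a b u \<le> 0 \<and> (pairing p q T a b u = 0 \<longrightarrow> (\<forall>t\<in>{a..b}. u t = u a))"
  using assms
proof (induction rule: break_induct)
  case (gap a b)
  obtain m c where m: "\<forall>t\<in>{a..b}. u t = m * t + c" "p a = m" "q b = - m"
    using pwl_gap[of u p q a b T a b] gap by auto
  moreover have "pairing p q T a b u = p a * u a + q b * u b"
    using gap by (intro pairing_no_break) auto
  ultimately have eq: "pairing p q T a b u = - (m * m * (b - a))"
    using gap by (simp add: algebra_simps)
  have "m * m * (b - a) \<ge> 0"
    using gap(1) by (intro mult_nonneg_nonneg[OF zero_le_square]) auto
  have const: "\<forall>t\<in>{a..b}. u t = u a" if "pairing p q T a b u = 0"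
  proof -
    have "m = 0" using that gap(1) unfolding eq by simp
    then show ?thesis using m(1) gap(1) by simp
  qed
  have "pairing p q T a b u \<le> 0"
    using \<open>m * m * (b - a) \<ge> 0\<close> unfolding eq by linarith
  then show ?case
    by (intro conjI impI const)
next
  case (split a b c)
  have "pwl u p q a c T" "pwl u p q c b T"
    using split.hyps split.prems by (auto elim: pwl_subinterval)
  then have 1: "pairing p q T a c u \<le> 0 \<and> (pairing p q T a c u = 0 \<longrightarrow> (\<forall>t\<in>{a..c}. u t = u a))"
    and 2: "pairing p q T c b u \<le> 0 \<and> (pairing p q T c b u = 0 \<longrightarrow> (\<forall>t\<in>{c..b}. u t = u c))"
    using split.IH split.prems split.hyps by blast+
  have eq: "pairing p q T a b u = pairing p q T a c u + pairing p q T c b u"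
    using split.hyps \<open>finite T\<close> by (intro pairing_split) auto
  have const: "u t = u a" if "\<forall>t\<in>{a..c}. u t = u a" "\<forall>t\<in>{c..b}. u t = u c" "t \<in> {a..b}" for t
    using that(1)[rule_format, of t] that(1)[rule_format, of c] that(2)[rule_format, of t] that(3) split.hyps
    by (cases "t \<le> c") auto
  show ?case
  proof (intro conjI impI ballI)
    show "pairing p q T a b u \<le> 0"
      using eq 1 2 by linarith
  next
    fix t assume "pairing p q T a b u = 0" and t: "t \<in> {a..b}"
    then have "pairing p q T a c u = 0" "pairing p q T c b u = 0"
      using eq 1 2 by linarith+
    then show "u t = u a"
      using const[OF conjunct2[OF 1, THEN mp] conjunct2[OF 2, THEN mp] t] by blast
  qed
qed

section \<open>Tangent directions in a graph model\<close>

lemma gap_around: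
  fixes T :: "real set"
  assumes "finite T" "t \<notin> T" "a < t" "t < b"
  obtains x y where "a \<le> x" "x < t" "t < y" "y \<le> b" "{x<..<y} \<inter> T = {}"
proof -
  have "open (- T)" using assms(1) by (simp add: finite_imp_closed open_Compl)
  then obtain \<delta> where \<delta>: "\<delta> > 0" "ball t \<delta> \<subseteq> - T"
    using assms(2) by (metis ComplI openE)
  show ?thesis
  proof
    show "{max a (t - \<delta>)<..<min b (t + \<delta>)} \<inter> T = {}"
      using \<delta>(2) by (auto simp: ball_def dist_real_def subset_iff)
  qed (use \<delta> assms in auto)
qed

locale graph_model =
  fixes \<Gamma> :: "'a::metric_space set" and V :: "'a set" and \<E> :: "'a edge set"
  assumes model: "simple_graph_model \<Gamma> V \<E>"
begin

lemma finite_V: "finite V" and finite_E: "finite \<E>" and V_sub: "V \<subseteq> \<Gamma>"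
  using model by (auto simp: simple_graph_model_def)

lemma edge_is_edge: "e \<in> \<E> \<Longrightarrow> is_edge \<Gamma> V e"
  using model by (auto simp: simple_graph_model_def)

lemma edge_pos: "e \<in> \<E> \<Longrightarrow> 0 < fst e"
  using edge_is_edge[of e] by (auto simp: is_edge_def split: prod.splits)

lemma edge_in: "e \<in> \<E> \<Longrightarrow> 0 \<le> t \<Longrightarrow> t \<le> fst e \<Longrightarrow> snd e t \<in> \<Gamma>"
  using edge_is_edge[of e] by (auto simp: is_edge_def split: prod.splits)

lemma edge_inj: "e \<in> \<E> \<Longrightarrow> inj_on (snd e) {0..fst e}"
  using edge_is_edge[of e] by (auto simp: is_edge_def split: prod.splits)

lemma edge_local_isometry:
  assumes "e \<in> \<E>" "t \<in> {0..fst e}"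
  obtains \<epsilon> where "\<epsilon> > 0" "\<And>s s'. s \<in> {0..fst e} \<Longrightarrow> s' \<in> {0..fst e} \<Longrightarrow> \<bar>s - t\<bar> < \<epsilon> \<Longrightarrow> \<bar>s' - t\<bar> < \<epsilon> \<Longrightarrow>
    dist (snd e s) (snd e s') = \<bar>s - s'\<bar>"
proof -
  have "\<forall>t\<in>{0..fst e}. \<exists>\<epsilon>>0. \<forall>s\<in>{0..fst e} \<inter> ball t \<epsilon>. \<forall>s'\<in>{0..fst e} \<inter> ball t \<epsilon>.
          dist (snd e s) (snd e s') = \<bar>s - s'\<bar>"
    using edge_is_edge[OF assms(1)] by (auto simp: is_edge_def split: prod.splits)
  then obtain \<epsilon> where "\<epsilon> > 0" "\<forall>s\<in>{0..fst e} \<inter> ball t \<epsilon>. \<forall>s'\<in>{0..fst e} \<inter> ball t \<epsilon>.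
          dist (snd e s) (snd e s') = \<bar>s - s'\<bar>"
    using assms(2) by blast
  then show ?thesis
    by (intro that[of \<epsilon>]) (auto simp: dist_real_def abs_minus_commute)
qed

lemma edge_continuous: "e \<in> \<E> \<Longrightarrow> continuous_on {0..fst e} (snd e)"
  unfolding continuous_on_iff
proof (intro ballI allI impI)
  fix t \<eta> :: real assume "e \<in> \<E>" "t \<in> {0..fst e}" "0 < \<eta>"
  then obtain \<epsilon> where \<epsilon>: "\<epsilon> > 0" "\<And>s s'. s \<in> {0..fst e} \<Longrightarrow> s' \<in> {0..fst e} \<Longrightarrow> \<bar>s - t\<bar> < \<epsilon> \<Longrightarrow> \<bar>s' - t\<bar> < \<epsilon> \<Longrightarrow>
    dist (snd e s) (snd e s') = \<bar>s - s'\<bar>"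
    using edge_local_isometry by blast
  show "\<exists>d>0. \<forall>x'\<in>{0..fst e}. dist x' t < d \<longrightarrow> dist (snd e x') (snd e t) < \<eta>"
    using \<epsilon> \<open>0 < \<eta>\<close> \<open>t \<in> {0..fst e}\<close>
    by (intro exI[of _ "min \<epsilon> \<eta>"]) (auto simp: dist_real_def)
qed

lemma edge_image_compact: "e \<in> \<E> \<Longrightarrow> compact (snd e ` {0..fst e})"
  by (intro compact_continuous_image edge_continuous) auto

lemma edge_ends_V: "e \<in> \<E> \<Longrightarrow> snd e 0 \<in> V" "e \<in> \<E> \<Longrightarrow> snd e (fst e) \<in> V"
  using edge_is_edge[of e] by (auto simp: is_edge_def edge_ends_def)

lemma edge_interior_not_V: "e \<in> \<E> \<Longrightarrow> 0 < t \<Longrightarrow> t < fst e \<Longrightarrow> snd e t \<notin> V"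
proof -
  assume "e \<in> \<E>" "0 < t" "t < fst e"
  then have "snd e t \<in> edge_interior e" "edge_interior e \<inter> V = {}"
    using edge_is_edge[of e] by (auto simp: edge_interior_def is_edge_def)
  then show ?thesis by blast
qed

text \<open>t' may be an end of e', because open edges avoid the vertices: the common point is no
  vertex, hence lies in both interiors, and these are disjoint for different edges.\<close>

lemma edge_point_unique:
  assumes "e \<in> \<E>" "e' \<in> \<E>" "0 < t" "t < fst e" "0 \<le> t'" "t' \<le> fst e'" "snd e t = snd e' t'"
  shows "e = e' \<and> t = t'"
proof -
  have "snd e' t' \<notin> V" using edge_interior_not_V assms by metis
  then have "t' \<noteq> 0" "t' \<noteq> fst e'" using edge_ends_V[OF assms(2)] by auto
  then have "snd e t \<in> edge_interior e" "snd e t \<in> edge_interior e'"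
    using assms(3-6) unfolding edge_interior_def assms(7)[symmetric]
    by (simp_all add: assms(7) image_iff) (use assms(7) in force)+
  then have "e = e'"
    using model assms(1,2) unfolding simple_graph_model_def pairwise_def by blast
  then show ?thesis
    using edge_inj[OF assms(1)] assms by (auto dest: inj_onD)
qed

lemma point_cases:
  assumes "x \<in> \<Gamma>"
  obtains "x \<in> V" | e t where "e \<in> \<E>" "0 < t" "t < fst e" "x = snd e t"
  using model assms unfolding simple_graph_model_def edge_interior_def by auto

text \<open>An edge need not be geodesic and could return close to p. Its part outside a parameter
  ball about t0 is compact and misses p by injectivity, so it keeps a positive distance; close to p
  only the part is left on which the edge is isometric.\<close>

lemma edge_near:
  assumes "e \<in> \<E>"
  shows "\<exists>\<delta>>0. (\<forall>t\<in>{0..fst e}. dist p (snd e t) \<ge> \<delta>) \<or>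
     (\<exists>t0\<in>{0..fst e}. snd e t0 = p \<and>
       (\<forall>t\<in>{0..fst e}. dist p (snd e t) < \<delta> \<or> \<bar>t - t0\<bar> < \<delta> \<longrightarrow> dist p (snd e t) = \<bar>t - t0\<bar>) \<and>
       (\<forall>s\<in>{0..fst e}. \<forall>s'\<in>{0..fst e}. \<bar>s - t0\<bar> < \<delta> \<and> \<bar>s' - t0\<bar> < \<delta> \<longrightarrow> dist (snd e s) (snd e s') = \<bar>s - s'\<bar>))"
proof (cases "p \<in> snd e ` {0..fst e}")
  case False
  have "open (- (snd e ` {0..fst e}))"
    using edge_image_compact[OF assms] by (simp add: compact_imp_closed open_Compl)
  then obtain \<delta> where "\<delta> > 0" "ball p \<delta> \<subseteq> - (snd e ` {0..fst e})"
    using False by (metis ComplI openE)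
  then show ?thesis
    by (intro exI[of _ \<delta>]) (force simp: subset_iff not_less[symmetric])
next
  case True
  then obtain t0 where t0: "t0 \<in> {0..fst e}" "snd e t0 = p" by auto
  obtain \<epsilon> where \<epsilon>: "\<epsilon> > 0" "\<And>s s'. s \<in> {0..fst e} \<Longrightarrow> s' \<in> {0..fst e} \<Longrightarrow> \<bar>s - t0\<bar> < \<epsilon> \<Longrightarrow> \<bar>s' - t0\<bar> < \<epsilon> \<Longrightarrow>
    dist (snd e s) (snd e s') = \<bar>s - s'\<bar>"
    using edge_local_isometry[OF assms t0(1)] by blast
  let ?K = "snd e ` ({0..fst e} - ball t0 \<epsilon>)"
  have "compact ?K"
    using continuous_on_subset[OF edge_continuous[OF assms]]
    by (intro compact_continuous_image compact_diff) auto
  then have "open (- ?K)" by (simp add: compact_imp_closed open_Compl)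
  moreover have "p \<notin> ?K"
    using t0 \<epsilon>(1) edge_inj[OF assms] by (auto dest: inj_onD)
  ultimately obtain \<delta> where \<delta>: "\<delta> > 0" "ball p \<delta> \<subseteq> - ?K"
    by (metis ComplI openE)
  have near: "\<bar>t - t0\<bar> < \<epsilon>" if "t \<in> {0..fst e}" "dist p (snd e t) < \<delta>" for t
  proof (rule ccontr)
    assume "\<not> \<bar>t - t0\<bar> < \<epsilon>"
    then have "snd e t \<in> ?K" using that(1) by (intro imageI) (auto simp: dist_real_def abs_minus_commute)
    then show False using \<delta>(2) that(2) by auto
  qed
  have "dist p (snd e t) = \<bar>t - t0\<bar>" if "t \<in> {0..fst e}" "\<bar>t - t0\<bar> < \<epsilon>" for t
    using \<epsilon>(2)[of t0 t] that t0 \<epsilon>(1) by (auto simp: abs_minus_commute)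
  note loc = this
  show ?thesis
  proof (intro exI[of _ "min \<delta> \<epsilon>"] conjI disjI2 bexI[of _ t0] ballI impI)
    show "dist p (snd e t) = \<bar>t - t0\<bar>"
      if "t \<in> {0..fst e}" "dist p (snd e t) < min \<delta> \<epsilon> \<or> \<bar>t - t0\<bar> < min \<delta> \<epsilon>" for t
      using that near[of t] loc[of t] by linarith
    show "dist (snd e s) (snd e s') = \<bar>s - s'\<bar>"
      if "s \<in> {0..fst e}" "s' \<in> {0..fst e}" "\<bar>s - t0\<bar> < min \<delta> \<epsilon> \<and> \<bar>s' - t0\<bar> < min \<delta> \<epsilon>" for s s'
      using that by (intro \<epsilon>(2)) auto
  qed (use \<epsilon>(1) \<delta>(1) t0 in auto)
qed

definition ray :: "'a edge \<times> real \<times> real \<Rightarrow> real \<Rightarrow> 'a" where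
  "ray = (\<lambda>(e, t, \<sigma>) s. snd e (t + \<sigma> * s))"

text \<open>A finite stand-in for the tangent directions: \<sigma> is the orientation along e, and
  the bounds on t exclude the orientation that would leave the edge at an end. At a vertex every
  incident edge end gives one triple.\<close>

definition dirs :: "'a \<Rightarrow> ('a edge \<times> real \<times> real) set" where
  "dirs p = {(e, t, \<sigma>). e \<in> \<E> \<and> t \<in> {0..fst e} \<and> snd e t = p \<and> (\<sigma> = 1 \<and> t < fst e \<or> \<sigma> = -1 \<and> 0 < t)}"

lemma ray_range:
  assumes "(e, t, \<sigma>) \<in> dirs p"
  obtains \<epsilon> where "\<epsilon> > 0" "\<And>s. 0 < s \<Longrightarrow> s \<le> \<epsilon> \<Longrightarrow> 0 < t + \<sigma> * s \<and> t + \<sigma> * s < fst e"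
proof
  show "(if \<sigma> = 1 then fst e - t else t) / 2 > 0"
    using assms by (auto simp: dirs_def)
  show "0 < t + \<sigma> * s \<and> t + \<sigma> * s < fst e"
    if "0 < s" "s \<le> (if \<sigma> = 1 then fst e - t else t) / 2" for s
    using assms that by (auto simp: dirs_def)
qed

lemma ray_germ:
  assumes "d \<in> dirs p"
  shows "ray d \<in> germs_at \<Gamma> p"
proof -
  obtain e t \<sigma> where d: "d = (e, t, \<sigma>)" by (cases d)
  have e: "e \<in> \<E>" "t \<in> {0..fst e}" "snd e t = p" "\<bar>\<sigma>\<bar> = 1"
    using assms by (auto simp: d dirs_def)
  obtain \<epsilon> where \<epsilon>: "\<epsilon> > 0" "\<And>s. 0 < s \<Longrightarrow> s \<le> \<epsilon> \<Longrightarrow> 0 < t + \<sigma> * s \<and> t + \<sigma> * s < fst e"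
    using ray_range assms d by blast
  have in_edge: "t + \<sigma> * s \<in> {0..fst e}" if "s \<in> {0..\<epsilon>}" for s
    using \<epsilon>(2)[of s] that e by (cases "s = 0") auto
  obtain \<eta> where \<eta>: "\<eta> > 0" "\<And>s s'. s \<in> {0..fst e} \<Longrightarrow> s' \<in> {0..fst e} \<Longrightarrow> \<bar>s - t\<bar> < \<eta> \<Longrightarrow> \<bar>s' - t\<bar> < \<eta> \<Longrightarrow>
    dist (snd e s) (snd e s') = \<bar>s - s'\<bar>"
    using edge_local_isometry[OF e(1,2)] by blast
  have "isometric_segment \<Gamma> (min \<epsilon> (\<eta> / 2)) (ray d)"
    unfolding isometric_segment_def
  proof (intro conjI ballI)
    show "ray d ` {0..min \<epsilon> (\<eta> / 2)} \<subseteq> \<Gamma>"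
      using in_edge edge_in[OF e(1)] by (auto simp: d ray_def)
    fix s s' assume s: "s \<in> {0..min \<epsilon> (\<eta> / 2)}" "s' \<in> {0..min \<epsilon> (\<eta> / 2)}"
    have "dist (ray d s) (ray d s') = \<bar>(t + \<sigma> * s) - (t + \<sigma> * s')\<bar>"
      using s in_edge e(4) \<eta>(1) unfolding d ray_def split_conv
      by (intro \<eta>(2)) (auto simp: abs_mult)
    also have "\<dots> = \<bar>s - s'\<bar>"
      using e(4) by (simp add: abs_mult flip: right_diff_distrib)
    finally show "dist (ray d s) (ray d s') = \<bar>s - s'\<bar>" .
  qed
  then show ?thesis
    unfolding germs_at_def using \<epsilon>(1) \<eta>(1) e(3)
    by (auto simp: d ray_def intro!: exI[of _ "min \<epsilon> (\<eta> / 2)"])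
qed

lemma ray_distinct:
  assumes "d \<in> dirs p" "d' \<in> dirs p" "\<forall>\<^sub>F s in at_right 0. ray d s = ray d' s"
  shows "d = d'"
proof -
  obtain e t \<sigma> e' t' \<sigma>' where d: "d = (e, t, \<sigma>)" "d' = (e', t', \<sigma>')" by (cases d, cases d')
  obtain \<epsilon> where \<epsilon>: "\<epsilon> > 0" "\<And>s. 0 < s \<Longrightarrow> s \<le> \<epsilon> \<Longrightarrow> 0 < t + \<sigma> * s \<and> t + \<sigma> * s < fst e"
    using ray_range assms d by blast
  obtain \<epsilon>' where \<epsilon>': "\<epsilon>' > 0" "\<And>s. 0 < s \<Longrightarrow> s \<le> \<epsilon>' \<Longrightarrow> 0 < t' + \<sigma>' * s \<and> t' + \<sigma>' * s < fst e'"
    using ray_range assms d by blast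
  obtain b where b: "b > 0" "\<And>s. 0 < s \<Longrightarrow> s < b \<Longrightarrow> ray d s = ray d' s"
    using assms(3) by (auto simp: eventually_at_right_field)
  define s where "s = min \<epsilon> (min \<epsilon>' (b / 2))"
  have s: "0 < s" "s \<le> \<epsilon>" "s \<le> \<epsilon>'" "s < b"
    using \<epsilon>(1) \<epsilon>'(1) b(1) by (auto simp: s_def)
  have "e = e' \<and> t + \<sigma> * s = t' + \<sigma>' * s"
    using assms(1,2) \<epsilon>(2)[of s] \<epsilon>'(2)[of s] b(2)[of s] s
    by (intro edge_point_unique) (auto simp: d dirs_def ray_def)
  moreover from this have "t = t'"
    using assms(1,2) edge_inj[of e] by (auto simp: d dirs_def dest: inj_onD)
  ultimately show ?thesis using s(1) by (simp add: d)
qed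

text \<open>An isometric segment is injective and meets the finite set V finitely often, so a short
  initial piece, without its start, avoids V. By connectedness this piece stays in one edge, and
  near p that edge is an interval, on which an isometric path from p can only run straight to one
  side.\<close>

lemma germ_ray:
  assumes "\<alpha> \<in> germs_at \<Gamma> p"
  shows "\<exists>d\<in>dirs p. \<forall>\<^sub>F s in at_right 0. \<alpha> s = ray d s"
proof -
  obtain \<epsilon> where \<epsilon>: "\<epsilon> > 0" "\<alpha> ` {0..\<epsilon>} \<subseteq> \<Gamma>" "\<And>s t. s \<in> {0..\<epsilon>} \<Longrightarrow> t \<in> {0..\<epsilon>} \<Longrightarrow> dist (\<alpha> s) (\<alpha> t) = \<bar>s - t\<bar>"
    and "\<alpha> 0 = p"
    using assms by (auto simp: germs_at_def isometric_segment_def)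
  have inj: "inj_on \<alpha> {0<..\<epsilon>}"
  proof (rule inj_onI)
    fix x y assume "x \<in> {0<..\<epsilon>}" "y \<in> {0<..\<epsilon>}" "\<alpha> x = \<alpha> y"
    moreover from this have "dist (\<alpha> x) (\<alpha> y) = \<bar>x - y\<bar>" by (intro \<epsilon>(3)) auto
    ultimately show "x = y" by simp
  qed
  have cont: "continuous_on {0..\<epsilon>} \<alpha>"
    unfolding continuous_on_iff using \<epsilon>(3) by (auto simp: dist_real_def)
  have "finite (\<alpha> -` V \<inter> {0<..\<epsilon>})"
    using finite_V inj by (rule finite_vimage_IntI)
  then have "\<forall>\<^sub>F s in at_right 0. \<forall>a\<in>\<alpha> -` V \<inter> {0<..\<epsilon>}. s < a"
    by (intro eventually_ball_finite) (auto simp: eventually_at_right_field)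
  then obtain b where b: "b > 0" "\<And>s. 0 < s \<Longrightarrow> s < b \<Longrightarrow> \<forall>a\<in>\<alpha> -` V \<inter> {0<..\<epsilon>}. s < a"
    by (auto simp: eventually_at_right_field)
  define \<epsilon>1 where "\<epsilon>1 = min \<epsilon> (b / 2)"
  have \<epsilon>1: "0 < \<epsilon>1" "\<epsilon>1 \<le> \<epsilon>" using b(1) \<epsilon>(1) by (auto simp: \<epsilon>1_def)
  have notV: "\<alpha> s \<notin> V" if "0 < s" "s \<le> \<epsilon>1" for s
    using b(2)[of s] b(1) that by (auto simp: \<epsilon>1_def)
  have inE: "\<exists>e\<in>\<E>. \<exists>\<tau>. 0 < \<tau> \<and> \<tau> < fst e \<and> \<alpha> s = snd e \<tau>" if "0 < s" "s \<le> \<epsilon>1" for s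
  proof -
    have "\<alpha> s \<in> \<Gamma>" using \<epsilon>(2) that \<epsilon>1 by auto
    then show ?thesis using notV[OF that] by (cases rule: point_cases) auto
  qed
  obtain e where e: "e \<in> \<E>" "\<exists>\<tau>. 0 < \<tau> \<and> \<tau> < fst e \<and> \<alpha> \<epsilon>1 = snd e \<tau>"
    using inE[of \<epsilon>1] \<epsilon>1 by auto
  let ?S = "\<alpha> ` {0<..\<epsilon>1}"
  \<comment> \<open>\<open>?A\<close> and \<open>?B\<close> are closed, as finite unions of compact
    edges, and they meet only in vertices, which \<open>?S\<close> avoids; so the connected set
    \<open>?S\<close> cannot meet both.\<close>
  let ?A = "snd e ` {0..fst e}" and ?B = "\<Union>e'\<in>\<E> - {e}. snd e' ` {0..fst e'}"
  have "connected ?S"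
    by (intro connected_continuous_image continuous_on_subset[OF cont]) (use \<epsilon>1 in auto)
  moreover have "closed ?A" "closed ?B"
    using edge_image_compact finite_E e(1) by (auto intro!: closed_UN compact_imp_closed)
  moreover have "?S \<subseteq> ?A \<union> ?B"
  proof
    fix x assume "x \<in> ?S"
    then obtain s where "0 < s" "s \<le> \<epsilon>1" "x = \<alpha> s" by auto
    then obtain e' \<tau> where "e' \<in> \<E>" "0 < \<tau>" "\<tau> < fst e'" "x = snd e' \<tau>" using inE by blast
    then have "x \<in> snd e' ` {0..fst e'}" by auto
    then show "x \<in> ?A \<union> ?B" using \<open>e' \<in> \<E>\<close> by (cases "e' = e") auto
  qed
  moreover have "?A \<inter> ?B \<inter> ?S = {}"
  proof -
    have False if s: "0 < s" "s \<le> \<epsilon>1" and t: "\<alpha> s = snd e t" "t \<in> {0..fst e}"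
      and t': "\<alpha> s = snd e' t'" "t' \<in> {0..fst e'}" and e': "e' \<in> \<E>" "e' \<noteq> e" for s t e' t'
    proof -
      obtain e2 \<tau> where *: "e2 \<in> \<E>" "0 < \<tau>" "\<tau> < fst e2" and \<tau>: "\<alpha> s = snd e2 \<tau>"
        using inE[OF s] by blast
      have "e2 = e" using edge_point_unique[OF *(1) e(1) *(2,3), of t] t(2) trans[OF \<tau>[symmetric] t(1)] by simp
      moreover have "e2 = e'" using edge_point_unique[OF *(1) e'(1) *(2,3), of t'] t'(2) trans[OF \<tau>[symmetric] t'(1)] by simp
      ultimately show False using e'(2) by simp
    qed
    note contra = this
    show ?thesis
    proof (rule equals0I)
      fix x assume "x \<in> ?A \<inter> ?B \<inter> ?S"
      then obtain s t e' t' where s: "s \<in> {0<..\<epsilon>1}" "x = \<alpha> s" and t: "t \<in> {0..fst e}" "x = snd e t"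
        and e': "e' \<in> \<E>" "e' \<noteq> e" and t': "t' \<in> {0..fst e'}" "x = snd e' t'" by blast
      show False
        by (rule contra[of s t e' t']) (use s t t' e' in simp_all)
    qed
  qed
  moreover have "?A \<inter> ?S \<noteq> {}"
  proof -
    obtain \<tau> where "0 < \<tau>" "\<tau> < fst e" "\<alpha> \<epsilon>1 = snd e \<tau>" using e(2) by auto
    then have "\<alpha> \<epsilon>1 \<in> ?A" by auto
    moreover have "\<alpha> \<epsilon>1 \<in> ?S" using \<epsilon>1(1) by auto
    ultimately show ?thesis by blast
  qed
  ultimately have "?B \<inter> ?S = {}"
    unfolding connected_closed by blast
  then have SA: "?S \<subseteq> ?A" using \<open>?S \<subseteq> ?A \<union> ?B\<close> by blast
  obtain \<delta> where \<delta>: "\<delta> > 0" "(\<forall>t\<in>{0..fst e}. dist p (snd e t) \<ge> \<delta>) \<or>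
     (\<exists>t0\<in>{0..fst e}. snd e t0 = p \<and>
       (\<forall>t\<in>{0..fst e}. dist p (snd e t) < \<delta> \<or> \<bar>t - t0\<bar> < \<delta> \<longrightarrow> dist p (snd e t) = \<bar>t - t0\<bar>) \<and>
       (\<forall>s\<in>{0..fst e}. \<forall>s'\<in>{0..fst e}. \<bar>s - t0\<bar> < \<delta> \<and> \<bar>s' - t0\<bar> < \<delta> \<longrightarrow> dist (snd e s) (snd e s') = \<bar>s - s'\<bar>))"
    using edge_near[OF e(1), of p] by blast
  define \<tau> where "\<tau> s = (SOME t. t \<in> {0..fst e} \<and> \<alpha> s = snd e t)" for s
  have \<tau>: "\<tau> s \<in> {0..fst e}" "\<alpha> s = snd e (\<tau> s)" if "0 < s" "s \<le> \<epsilon>1" for s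
  proof -
    have "\<alpha> s \<in> snd e ` {0..fst e}" using that by (intro subsetD[OF SA] imageI) simp
    then have "\<exists>t. t \<in> {0..fst e} \<and> \<alpha> s = snd e t" by blast
    from someI_ex[OF this] show "\<tau> s \<in> {0..fst e}" "\<alpha> s = snd e (\<tau> s)" by (auto simp: \<tau>_def)
  qed
  have dp: "dist p (snd e (\<tau> s)) = s" if "0 < s" "s \<le> \<epsilon>1" for s
    using \<epsilon>(3)[of 0 s] that \<epsilon>1 \<tau>[OF that] \<open>\<alpha> 0 = p\<close> by auto
  define s0 where "s0 = min \<epsilon>1 (\<delta> / 2)"
  have s0: "0 < s0" "s0 \<le> \<epsilon>1" "s0 < \<delta>" using \<epsilon>1 \<delta>(1) by (auto simp: s0_def)
  have "\<not> dist p (snd e (\<tau> s0)) \<ge> \<delta>" using dp[of s0] s0 by auto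
  then obtain t0 where t0: "t0 \<in> {0..fst e}" "snd e t0 = p"
      "\<And>t. t \<in> {0..fst e} \<Longrightarrow> dist p (snd e t) < \<delta> \<Longrightarrow> dist p (snd e t) = \<bar>t - t0\<bar>"
      "\<And>s s'. s \<in> {0..fst e} \<Longrightarrow> s' \<in> {0..fst e} \<Longrightarrow> \<bar>s - t0\<bar> < \<delta> \<Longrightarrow> \<bar>s' - t0\<bar> < \<delta> \<Longrightarrow> dist (snd e s) (snd e s') = \<bar>s - s'\<bar>"
    using \<delta>(2) \<tau>(1)[of s0] s0 by blast
  have abs: "\<bar>\<tau> s - t0\<bar> = s" if "0 < s" "s \<le> s0" for s
    using t0(3)[OF \<tau>(1)] dp that s0 by force
  define \<sigma> where "\<sigma> = (\<tau> s0 - t0) / s0"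
  have \<sigma>: "\<sigma> = 1 \<or> \<sigma> = -1" "\<tau> s0 = t0 + \<sigma> * s0"
    using abs[of s0] s0 by (auto simp: \<sigma>_def field_simps abs_if split: if_splits)
  have eq: "\<tau> s = t0 + \<sigma> * s" if "0 < s" "s \<le> s0" for s
  proof -
    \<comment> \<open>If \<open>\<tau> s\<close> and \<open>\<tau> s0\<close> were on different
      sides of t0, their distance would be s + s0.\<close>
    have "\<bar>\<tau> s - \<tau> s0\<bar> = \<bar>s - s0\<bar>"
      using t0(4)[of "\<tau> s" "\<tau> s0"] \<tau>[of s] \<tau>[of s0] abs[of s] abs[of s0] \<epsilon>(3)[of s s0] that s0 \<epsilon>1 by auto
    then show ?thesis
      using abs[OF that] \<sigma> that by auto
  qed
  have "(e, t0, \<sigma>) \<in> dirs p"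
    using \<sigma> \<tau>(1)[of s0] s0 t0(1,2) e(1) by (auto simp: dirs_def)
  moreover have "\<forall>\<^sub>F s in at_right 0. \<alpha> s = ray (e, t0, \<sigma>) s"
    unfolding eventually_at_right_field
    using eq \<tau>(2) s0 by (intro exI[of _ s0]) (auto simp: ray_def)
  ultimately show ?thesis by blast
qed

definition dslope :: "('a \<Rightarrow> real) \<Rightarrow> 'a edge \<times> real \<times> real \<Rightarrow> int" where
  "dslope \<phi> d = (THE m. \<forall>\<^sub>F s in at_right 0. \<phi> (ray d s) = \<phi> (ray d 0) + of_int m * s)"

lemma finite_dirs: "finite (dirs p)"
proof (rule finite_subset)
  show "dirs p \<subseteq> (\<lambda>(e, \<sigma>). (e, the_inv_into {0..fst e} (snd e) p, \<sigma>)) ` (\<E> \<times> {1, -1})"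
    using the_inv_into_f_f[OF edge_inj] by (fastforce simp: dirs_def image_iff)
qed (use finite_E in auto)

text \<open>By \<open>germ_ray\<close> and \<open>ray_distinct\<close> each class of germs contains
  exactly one ray, and the slope of a class may be tested on that ray. This replaces a sum over a
  quotient by a sum over a finite set of triples.\<close>

lemma sum_tangent_directions:
  "(\<Sum>\<zeta>\<in>tangent_directions \<Gamma> p. slope \<phi> \<zeta>) = (\<Sum>d\<in>dirs p. dslope \<phi> d)"
proof -
  let ?r = "{(\<alpha>, \<beta>). \<alpha> \<in> germs_at \<Gamma> p \<and> \<beta> \<in> germs_at \<Gamma> p \<and> (\<forall>\<^sub>F t in at_right 0. \<alpha> t = \<beta> t)}"
  have class_eq: "?r `` {\<alpha>} = ?r `` {\<beta>}" if "(\<alpha>, \<beta>) \<in> ?r" for \<alpha> \<beta>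
  proof -
    have *: "(\<beta>, \<alpha>) \<in> ?r" using that by (auto elim: eventually_mono)
    have "(\<alpha>, \<gamma>) \<in> ?r" if "(\<alpha>, \<beta>) \<in> ?r" "(\<beta>, \<gamma>) \<in> ?r" for \<alpha> \<beta> \<gamma>
      using that by (auto elim: eventually_elim2)
    then show ?thesis using that * by blast
  qed
  have "bij_betw (\<lambda>d. ?r `` {ray d}) (dirs p) (tangent_directions \<Gamma> p)"
    unfolding bij_betw_def
  proof
    show "inj_on (\<lambda>d. ?r `` {ray d}) (dirs p)"
    proof (rule inj_onI)
      fix d d' assume *: "d \<in> dirs p" "d' \<in> dirs p" "?r `` {ray d} = ?r `` {ray d'}"
      have "ray d' \<in> ?r `` {ray d'}" using ray_germ[OF *(2)] by auto
      then have "ray d' \<in> ?r `` {ray d}" using *(3) by simp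
      then show "d = d'" using *(1,2) by (intro ray_distinct) auto
    qed
    show "(\<lambda>d. ?r `` {ray d}) ` dirs p = tangent_directions \<Gamma> p"
    proof (intro equalityI subsetI)
      fix \<zeta> assume "\<zeta> \<in> tangent_directions \<Gamma> p"
      then obtain \<alpha> where \<alpha>: "\<alpha> \<in> germs_at \<Gamma> p" "\<zeta> = ?r `` {\<alpha>}"
        by (auto simp: tangent_directions_def quotient_def)
      obtain d where d: "d \<in> dirs p" "\<forall>\<^sub>F s in at_right 0. \<alpha> s = ray d s"
        using germ_ray[OF \<alpha>(1)] by auto
      have "?r `` {\<alpha>} = ?r `` {ray d}"
        by (rule class_eq) (use \<alpha> d ray_germ[OF d(1)] in auto)
      then show "\<zeta> \<in> (\<lambda>d. ?r `` {ray d}) ` dirs p" using \<alpha> d by blast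
    qed (auto simp: tangent_directions_def quotient_def dest: ray_germ)
  qed
  moreover have "slope \<phi> (?r `` {ray d}) = dslope \<phi> d" if "d \<in> dirs p" for d
  proof -
    have "(\<forall>\<alpha>\<in>?r `` {ray d}. \<forall>\<^sub>F t in at_right 0. \<phi> (\<alpha> t) = \<phi> (\<alpha> 0) + of_int m * t) \<longleftrightarrow>
        (\<forall>\<^sub>F s in at_right 0. \<phi> (ray d s) = \<phi> (ray d 0) + of_int m * s)" (is "?L \<longleftrightarrow> ?R") for m :: int
    proof
      assume ?L then show ?R using ray_germ[OF that] by auto
    next
      assume R: ?R
      show ?L
      proof
        fix \<alpha> assume \<alpha>: "\<alpha> \<in> ?r `` {ray d}"
        then have "\<alpha> 0 = ray d 0" "\<forall>\<^sub>F t in at_right 0. ray d t = \<alpha> t" by (auto simp: germs_at_def)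
        with R show "\<forall>\<^sub>F t in at_right 0. \<phi> (\<alpha> t) = \<phi> (\<alpha> 0) + of_int m * t"
          by (auto elim: eventually_elim2)
      qed
    qed
    then show ?thesis by (simp add: slope_def dslope_def)
  qed
  ultimately show ?thesis
    by (simp add: sum.reindex_bij_betw[symmetric])
qed

lemma dslope_eq:
  assumes "\<eta> > 0" "\<And>s. 0 < s \<Longrightarrow> s < \<eta> \<Longrightarrow> \<phi> (ray d s) = \<phi> (ray d 0) + of_int m * s"
  shows "dslope \<phi> d = m"
  unfolding dslope_def
proof (rule the_equality)
  show *: "\<forall>\<^sub>F s in at_right 0. \<phi> (ray d s) = \<phi> (ray d 0) + of_int m * s"
    unfolding eventually_at_right_field using assms by blast
  fix m' :: int assume "\<forall>\<^sub>F s in at_right 0. \<phi> (ray d s) = \<phi> (ray d 0) + of_int m' * s"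
  from eventually_conj[OF this *]
  have "\<forall>\<^sub>F s in at_right 0. of_int m' * s = of_int m * (s::real) \<and> s > 0"
    using eventually_at_right_less[of "0::real"] by (auto elim: eventually_elim2)
  then obtain s :: real where "of_int m' * s = of_int m * s" "s > 0"
    using eventually_happens'[OF trivial_limit_at_right_real] by blast
  then show "m' = m" by simp
qed

section \<open>Divisors of piecewise linear functions\<close>

definition paffine :: "('a \<Rightarrow> real) \<Rightarrow> 'a edge \<Rightarrow> real set \<Rightarrow> bool" where
  "paffine \<phi> e T \<longleftrightarrow>
     (\<forall>x y. 0 \<le> x \<and> x < y \<and> y \<le> fst e \<and> {x<..<y} \<inter> T = {} \<longrightarrow>
        (\<exists>(m::int) c. \<forall>t\<in>{x..y}. \<phi> (snd e t) = of_int m * t + c))"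

definition epl :: "('a \<Rightarrow> real) \<Rightarrow> bool" where
  "epl \<phi> \<longleftrightarrow> (\<forall>e\<in>\<E>. \<exists>T. finite T \<and> paffine \<phi> e T)"

lemma paffine_gap:
  assumes "paffine \<phi> e T" "0 \<le> x" "x < y" "y \<le> fst e" "{x<..<y} \<inter> T = {}"
  obtains m :: int and c where "\<And>t. t \<in> {x..y} \<Longrightarrow> \<phi> (snd e t) = of_int m * t + c"
proof -
  have "\<exists>(m::int) c. \<forall>t\<in>{x..y}. \<phi> (snd e t) = of_int m * t + c"
    using assms unfolding paffine_def by blast
  then show ?thesis by (elim exE) (rule that, erule (1) bspec)
qed

lemma paffine_mono:
  assumes "paffine \<phi> e T" "T \<subseteq> T'" shows "paffine \<phi> e T'"
  unfolding paffine_def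
proof (intro allI impI)
  fix x y assume "0 \<le> x \<and> x < y \<and> y \<le> fst e \<and> {x<..<y} \<inter> T' = {}"
  then have "0 \<le> x \<and> x < y \<and> y \<le> fst e \<and> {x<..<y} \<inter> T = {}" using assms(2) by blast
  then show "\<exists>(m::int) c. \<forall>t\<in>{x..y}. \<phi> (snd e t) = of_int m * t + c"
    using assms(1) unfolding paffine_def by (elim allE[of _ x] allE[of _ y]) (erule (1) mp)
qed

lemma dslope_affine:
  assumes "0 \<le> x" "x < y" "y \<le> fst e" "\<And>t. t \<in> {x..y} \<Longrightarrow> \<phi> (snd e t) = of_int m * t + c"
  shows "dslope \<phi> (e, x, 1) = m" "dslope \<phi> (e, y, -1) = - m"
proof -
  show "dslope \<phi> (e, x, 1) = m"
  proof (rule dslope_eq)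
    fix s assume s: "0 < s" "s < y - x"
    have "\<phi> (snd e (x + s)) = of_int m * (x + s) + c" "\<phi> (snd e x) = of_int m * x + c"
      using s assms(2) by (intro assms(4); simp)+
    then show "\<phi> (ray (e, x, 1) s) = \<phi> (ray (e, x, 1) 0) + of_int m * s"
      by (simp add: ray_def algebra_simps)
  qed (use assms in simp)
  show "dslope \<phi> (e, y, -1) = - m"
  proof (rule dslope_eq)
    fix s assume s: "0 < s" "s < y - x"
    have "\<phi> (snd e (y - s)) = of_int m * (y - s) + c" "\<phi> (snd e y) = of_int m * y + c"
      using s assms(2) by (intro assms(4); simp)+
    then show "\<phi> (ray (e, y, -1) s) = \<phi> (ray (e, y, -1) 0) + of_int (- m) * s"
      by (simp add: ray_def algebra_simps)
  qed (use assms in simp)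
qed

lemma paffine_pwl:
  assumes "paffine \<phi> e T"
  shows "pwl (\<lambda>t. \<phi> (snd e t)) (\<lambda>t. of_int (dslope \<phi> (e, t, 1))) (\<lambda>t. of_int (dslope \<phi> (e, t, -1))) 0 (fst e) T"
  unfolding pwl_def
proof (intro allI impI)
  fix x y assume *: "0 \<le> x \<and> x < y \<and> y \<le> fst e \<and> {x<..<y} \<inter> T = {}"
  then obtain m :: int and c where m: "\<And>t. t \<in> {x..y} \<Longrightarrow> \<phi> (snd e t) = of_int m * t + c"
    using paffine_gap[OF assms] by blast
  have "dslope \<phi> (e, x, 1) = m" "dslope \<phi> (e, y, -1) = - m"
    using dslope_affine[of x y e \<phi> m c] m * by auto
  then show "\<exists>m c. (\<forall>t\<in>{x..y}. \<phi> (snd e t) = m * t + c) \<and> of_int (dslope \<phi> (e, x, 1)) = m \<and>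
      of_int (dslope \<phi> (e, y, -1)) = - m"
    by (intro exI[of _ "of_int m"] exI[of _ c] conjI ballI m) simp_all
qed

text \<open>\<open>PL\<close> speaks of geodesic segments, while an edge is only locally geodesic.
  Bisection glues the finite break sets of short subintervals, which are isometric segments after a
  shift of the parameter.\<close>

lemma PL_epl:
  assumes "\<phi> \<in> PL \<Gamma>" shows "epl \<phi>"
  unfolding epl_def
proof
  fix e assume e: "e \<in> \<E>"
  define A where "A x y \<longleftrightarrow> (\<exists>(m::int) c. \<forall>t\<in>{x..y}. \<phi> (snd e t) = of_int m * t + c)" for x y
  define P where "P a b \<longleftrightarrow> (0 \<le> a \<and> b \<le> fst e \<longrightarrow> (\<exists>T. finite T \<and>
    (\<forall>x y. a \<le> x \<and> x < y \<and> y \<le> b \<and> {x<..<y} \<inter> T = {} \<longrightarrow> A x y)))" for a b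
  have "P 0 (fst e)"
  proof (rule Bolzano)
    show "0 \<le> fst e" using edge_pos[OF e] by simp
  next
    fix a b c assume *: "P a b" "P b c" "a \<le> b" "b \<le> c"
    show "P a c"
      unfolding P_def
    proof
      assume "0 \<le> a \<and> c \<le> fst e"
      then obtain T T' where T: "finite T" "\<And>x y. a \<le> x \<and> x < y \<and> y \<le> b \<and> {x<..<y} \<inter> T = {} \<Longrightarrow> A x y"
        and T': "finite T'" "\<And>x y. b \<le> x \<and> x < y \<and> y \<le> c \<and> {x<..<y} \<inter> T' = {} \<Longrightarrow> A x y"
        using * unfolding P_def by force
      show "\<exists>T. finite T \<and> (\<forall>x y. a \<le> x \<and> x < y \<and> y \<le> c \<and> {x<..<y} \<inter> T = {} \<longrightarrow> A x y)"
      \<comment> \<open>A gap across b would be covered by neither half, so b is made a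
        break.\<close>
      proof (intro exI[of _ "insert b (T \<union> T')"] conjI allI impI)
        fix x y assume xy: "a \<le> x \<and> x < y \<and> y \<le> c \<and> {x<..<y} \<inter> insert b (T \<union> T') = {}"
        then have "{x<..<y} \<inter> T = {}" "{x<..<y} \<inter> T' = {}" "b \<le> x \<or> y \<le> b"
          by auto
        then show "A x y"
          using T(2)[of x y] T'(2)[of x y] xy by argo
      qed (use T T' in simp)
    qed
  next
    fix x assume x: "0 \<le> x" "x \<le> fst e"
    then obtain \<epsilon> where \<epsilon>: "\<epsilon> > 0" "\<And>s s'. s \<in> {0..fst e} \<Longrightarrow> s' \<in> {0..fst e} \<Longrightarrow> \<bar>s - x\<bar> < \<epsilon> \<Longrightarrow> \<bar>s' - x\<bar> < \<epsilon> \<Longrightarrow>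
      dist (snd e s) (snd e s') = \<bar>s - s'\<bar>"
      using edge_local_isometry[OF e, of x] by auto
    have "P a b" if ab: "a \<le> x \<and> x \<le> b \<and> b - a < \<epsilon>" for a b
    proof (cases "0 \<le> a \<and> a < b \<and> b \<le> fst e")
      case False
      then have "\<not> (a \<le> x' \<and> x' < y' \<and> y' \<le> b)" if "0 \<le> a" "b \<le> fst e" for x' y'
        using ab that by auto
      then show ?thesis by (auto simp: P_def)
    next
      case True
      define \<gamma> where "\<gamma> s = snd e (a + s)" for s
      have "isometric_segment \<Gamma> (b - a) \<gamma>"
        unfolding isometric_segment_def
      proof (intro conjI ballI)
        show "\<gamma> ` {0..b - a} \<subseteq> \<Gamma>" using edge_in[OF e] True by (auto simp: \<gamma>_def)
        fix s s' assume "s \<in> {0..b - a}" "s' \<in> {0..b - a}"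
        then have "dist (\<gamma> s) (\<gamma> s') = \<bar>(a + s) - (a + s')\<bar>"
          unfolding \<gamma>_def using True ab by (intro \<epsilon>(2)) auto
        then show "dist (\<gamma> s) (\<gamma> s') = \<bar>s - s'\<bar>" by simp
      qed
      moreover have "b - a > 0" using True by simp
      ultimately obtain B where B: "finite B" "\<And>x y. 0 \<le> x \<and> x < y \<and> y \<le> b - a \<and> {x<..<y} \<inter> B = {} \<Longrightarrow>
          (\<exists>(m::int) c. \<forall>t\<in>{x..y}. \<phi> (\<gamma> t) = of_int m * t + c)"
        using assms unfolding PL_def mem_Collect_eq by blast
      show ?thesis
        unfolding P_def
      proof (intro impI exI[of _ "(+) a ` B"] conjI allI)
        fix x y assume xy: "a \<le> x \<and> x < y \<and> y \<le> b \<and> {x<..<y} \<inter> (+) a ` B = {}"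
        have "{x - a<..<y - a} \<inter> B = {}"
        proof (rule equals0I)
          fix z assume "z \<in> {x - a<..<y - a} \<inter> B"
          then have "a + z \<in> {x<..<y} \<inter> (+) a ` B" by auto
          then show False using xy by blast
        qed
        then obtain m :: int and c where mc: "\<forall>t\<in>{x - a..y - a}. \<phi> (\<gamma> t) = of_int m * t + c"
          using B(2)[of "x - a" "y - a"] xy by (metis add_diff_cancel_left' diff_ge_0_iff_ge diff_mono diff_strict_right_mono order_refl)
        show "A x y"
          unfolding A_def
        proof (intro exI[of _ m] exI[of _ "c - of_int m * a"] ballI)
          fix t assume "t \<in> {x..y}"
          then have "\<phi> (\<gamma> (t - a)) = of_int m * (t - a) + c" by (intro bspec[OF mc]) auto
          then show "\<phi> (snd e t) = of_int m * t + (c - of_int m * a)"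
            by (simp add: \<gamma>_def algebra_simps)
        qed
      qed (use B(1) in simp)
    qed
    then show "\<exists>d>0. \<forall>a b. a \<le> x \<and> x \<le> b \<and> b - a < d \<longrightarrow> P a b"
      using \<epsilon>(1) by blast
  qed
  then show "\<exists>T. finite T \<and> paffine \<phi> e T"
    unfolding P_def A_def paffine_def by simp
qed

lemma dirs_interior:
  assumes "e \<in> \<E>" "0 < t" "t < fst e"
  shows "dirs (snd e t) = {(e, t, 1), (e, t, -1)}"
proof (intro equalityI subsetI)
  fix d assume "d \<in> dirs (snd e t)"
  then obtain e' t' \<sigma> where d: "d = (e', t', \<sigma>)" "e' \<in> \<E>" "t' \<in> {0..fst e'}" "snd e' t' = snd e t" "\<sigma> = 1 \<or> \<sigma> = -1"
    unfolding dirs_def by blast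
  then have "e = e' \<and> t = t'" using assms by (intro edge_point_unique) auto
  then show "d \<in> {(e, t, 1), (e, t, -1)}" using d by auto
qed (use assms in \<open>auto simp: dirs_def\<close>)

lemma no_bend:
  assumes "e \<in> \<E>" "0 < t" "t < fst e" "finite T" "t \<notin> T" "paffine \<phi> e T"
  shows "(\<Sum>d\<in>dirs (snd e t). dslope \<phi> d) = 0"
proof -
  obtain x y where xy: "0 \<le> x" "x < t" "t < y" "y \<le> fst e" "{x<..<y} \<inter> T = {}"
    using gap_around[OF assms(4,5,2,3)] by blast
  obtain m :: int and c where m: "\<And>t. t \<in> {x..y} \<Longrightarrow> \<phi> (snd e t) = of_int m * t + c"
    using paffine_gap[OF assms(6) xy(1) _ xy(4,5)] xy by auto
  have "dslope \<phi> (e, t, 1) = m"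
    by (rule dslope_affine(1)[of t y]) (use xy m in auto)
  moreover have "dslope \<phi> (e, t, -1) = - m"
    by (rule dslope_affine(2)[of x t]) (use xy m in auto)
  ultimately show ?thesis
    by (simp add: dirs_interior[OF assms(1-3)])
qed

lemma dirs_outside: "p \<notin> \<Gamma> \<Longrightarrow> dirs p = {}"
  using edge_in by (auto simp: dirs_def)

lemma bend_in_breaks:
  assumes "\<And>e. e \<in> \<E> \<Longrightarrow> finite (T e) \<and> paffine \<phi> e (T e)" "(\<Sum>d\<in>dirs p. dslope \<phi> d) \<noteq> 0"
  shows "p \<in> V \<union> (\<Union>e\<in>\<E>. snd e ` (T e \<inter> {0<..<fst e}))"
proof -
  have "p \<in> \<Gamma>" using assms(2) dirs_outside by fastforce
  then show ?thesis
  proof (cases rule: point_cases)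
    case (2 e t)
    then have "t \<in> T e" using assms no_bend[of e t "T e"] by blast
    then have "p \<in> snd e ` (T e \<inter> {0<..<fst e})" using 2 by auto
    then show ?thesis using 2(1) by blast
  qed simp
qed

text \<open>\<open>Abs_poly_mapping\<close> returns its argument only if the support is finite. It
  is, since the slopes cancel away from vertices and breaks.\<close>

lemma lookup_pl_div:
  assumes "epl \<phi>"
  shows "Poly_Mapping.lookup (pl_div \<Gamma> \<phi>) p = - (\<Sum>d\<in>dirs p. dslope \<phi> d)"
proof -
  obtain T where T: "\<And>e. e \<in> \<E> \<Longrightarrow> finite (T e) \<and> paffine \<phi> e (T e)"
    using assms unfolding epl_def by metis
  have "{p. - (\<Sum>\<zeta>\<in>tangent_directions \<Gamma> p. slope \<phi> \<zeta>) \<noteq> 0} \<subseteq> V \<union> (\<Union>e\<in>\<E>. snd e ` (T e \<inter> {0<..<fst e}))"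
    using bend_in_breaks[OF T] by (auto simp: sum_tangent_directions)
  moreover have "finite (V \<union> (\<Union>e\<in>\<E>. snd e ` (T e \<inter> {0<..<fst e})))"
    using T finite_V finite_E by auto
  ultimately have "finite {p. - (\<Sum>\<zeta>\<in>tangent_directions \<Gamma> p. slope \<phi> \<zeta>) \<noteq> 0}"
    by (rule finite_subset)
  then show ?thesis
    unfolding pl_div_def by (simp add: Poly_Mapping.lookup_Abs_poly_mapping sum_tangent_directions)
qed

lemma pl_div_support: "epl \<phi> \<Longrightarrow> Poly_Mapping.keys (pl_div \<Gamma> \<phi>) \<subseteq> \<Gamma>"
  using dirs_outside by (force simp: in_keys_iff lookup_pl_div)

text \<open>The slopes are regrouped from points to edges: the directions at the points of
  \<open>X\<close> are the triples (e, t, 1) with t < fst e and (e, t, -1) with t > 0, for t in T e,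
  and these make up the two half-open sums of \<open>pairing\<close>. The sign comes from the
  definition of the divisor.\<close>

lemma sum_pl_div:
  assumes "epl \<phi>" "finite K" "Poly_Mapping.keys (pl_div \<Gamma> \<phi>) \<subseteq> K"
    and T: "\<And>e. e \<in> \<E> \<Longrightarrow> finite (T e) \<and> {0, fst e} \<subseteq> T e \<and> T e \<subseteq> {0..fst e} \<and> paffine \<phi> e (T e)"
  shows "(\<Sum>x\<in>K. of_int (Poly_Mapping.lookup (pl_div \<Gamma> \<phi>) x) * h x) =
    - (\<Sum>e\<in>\<E>. pairing (\<lambda>t. of_int (dslope \<phi> (e, t, 1))) (\<lambda>t. of_int (dslope \<phi> (e, t, -1))) (T e) 0 (fst e)
          (\<lambda>t. h (snd e t)))"
proof -
  define X where "X = V \<union> (\<Union>e\<in>\<E>. snd e ` T e)"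
  define F where "F = (\<lambda>(e, t, \<sigma>). of_int (dslope \<phi> (e, t, \<sigma>)) * h (snd e t))"
  define A where "A = (\<lambda>(e, t). (e, t, 1::real)) ` Sigma \<E> (\<lambda>e. T e \<inter> {0..<fst e})"
  define B where "B = (\<lambda>(e, t). (e, t, -1::real)) ` Sigma \<E> (\<lambda>e. T e \<inter> {0<..fst e})"
  have "finite X" using T finite_V finite_E by (auto simp: X_def)
  have "x \<in> X" if "Poly_Mapping.lookup (pl_div \<Gamma> \<phi>) x \<noteq> 0" for x
    using that bend_in_breaks[of T \<phi> x] T by (auto simp: X_def lookup_pl_div[OF assms(1)])
  then have "Poly_Mapping.keys (pl_div \<Gamma> \<phi>) \<subseteq> X" by (auto simp: in_keys_iff)
  have "(\<Sum>x\<in>K. of_int (Poly_Mapping.lookup (pl_div \<Gamma> \<phi>) x) * h x) =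
      (\<Sum>x\<in>Poly_Mapping.keys (pl_div \<Gamma> \<phi>). of_int (Poly_Mapping.lookup (pl_div \<Gamma> \<phi>) x) * h x)"
    using assms(2,3) by (intro sum.mono_neutral_right) (auto simp: in_keys_iff)
  also have "\<dots> = (\<Sum>x\<in>X. of_int (Poly_Mapping.lookup (pl_div \<Gamma> \<phi>) x) * h x)"
    using \<open>finite X\<close> \<open>_ \<subseteq> X\<close> by (intro sum.mono_neutral_left) (auto simp: in_keys_iff)
  also have "\<dots> = - (\<Sum>x\<in>X. \<Sum>d\<in>dirs x. F d)"
  proof -
    have "of_int (Poly_Mapping.lookup (pl_div \<Gamma> \<phi>) x) * h x = - (\<Sum>d\<in>dirs x. F d)" for x
    proof -
      have "(\<Sum>d\<in>dirs x. F d) = (\<Sum>d\<in>dirs x. of_int (dslope \<phi> d) * h x)"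
        by (intro sum.cong) (auto simp: F_def dirs_def)
      then show ?thesis by (simp add: lookup_pl_div[OF assms(1)] sum_distrib_right)
    qed
    then show ?thesis by (simp add: sum_negf)
  qed
  also have "(\<Sum>x\<in>X. \<Sum>d\<in>dirs x. F d) = (\<Sum>d\<in>(\<Union>x\<in>X. dirs x). F d)"
    using \<open>finite X\<close> finite_dirs by (intro sum.UNION_disjoint[symmetric]) (auto simp: dirs_def)
  also have "(\<Union>x\<in>X. dirs x) = A \<union> B"
  proof (intro equalityI subsetI)
    fix d assume "d \<in> (\<Union>x\<in>X. dirs x)"
    then obtain e t \<sigma> where d: "d = (e, t, \<sigma>)" "e \<in> \<E>" "t \<in> {0..fst e}" "snd e t \<in> X"
      "\<sigma> = 1 \<and> t < fst e \<or> \<sigma> = -1 \<and> 0 < t"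
      by (cases d) (auto simp: dirs_def)
    have "t \<in> T e"
    proof (cases "0 < t \<and> t < fst e")
      case True
      then have "snd e t \<notin> V" using edge_interior_not_V d(2) by blast
      then obtain e' t' where e': "e' \<in> \<E>" "t' \<in> T e'" "snd e t = snd e' t'"
        using d(4) unfolding X_def by blast
      moreover have "0 \<le> t'" "t' \<le> fst e'" using T[OF e'(1)] e'(2) by auto
      ultimately have "e = e' \<and> t = t'"
        using True d(2) by (intro edge_point_unique) auto
      then show ?thesis using e' by simp
    next
      case False
      then have "t = 0 \<or> t = fst e" using d(3) by auto
      then show ?thesis using T[OF d(2)] by auto
    qed
    then show "d \<in> A \<union> B" using d by (auto simp: A_def B_def image_iff)
  next
    fix d assume "d \<in> A \<union> B"
    then obtain e t \<sigma> where d: "d = (e, t, \<sigma>)" "e \<in> \<E>" "t \<in> T e" "t \<in> {0..fst e}"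
      "\<sigma> = 1 \<and> t < fst e \<or> \<sigma> = -1 \<and> 0 < t"
      by (auto simp: A_def B_def)
    then have "d \<in> dirs (snd e t)" "snd e t \<in> X" by (auto simp: dirs_def X_def)
    then show "d \<in> (\<Union>x\<in>X. dirs x)" by blast
  qed
  also have "(\<Sum>d\<in>A \<union> B. F d) = (\<Sum>d\<in>A. F d) + (\<Sum>d\<in>B. F d)"
    using finite_E T by (intro sum.union_disjoint) (auto simp: A_def B_def)
  also have "(\<Sum>d\<in>A. F d) = (\<Sum>e\<in>\<E>. \<Sum>t\<in>T e \<inter> {0..<fst e}. of_int (dslope \<phi> (e, t, 1)) * h (snd e t))"
    unfolding A_def using finite_E T
    by (subst sum.reindex) (auto simp: inj_on_def F_def sum.Sigma comp_def intro!: sum.cong)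
  also have "(\<Sum>d\<in>B. F d) = (\<Sum>e\<in>\<E>. \<Sum>t\<in>T e \<inter> {0<..fst e}. of_int (dslope \<phi> (e, t, -1)) * h (snd e t))"
    unfolding B_def using finite_E T
    by (subst sum.reindex) (auto simp: inj_on_def F_def sum.Sigma comp_def intro!: sum.cong)
  finally show ?thesis
    unfolding pairing_def sum.distrib .
qed

lemma common_breaks:
  assumes "epl \<phi>" "epl \<psi>" "\<And>e. e \<in> \<E> \<Longrightarrow> finite (S e) \<and> S e \<subseteq> {0..fst e}"
  obtains T where "\<And>e. e \<in> \<E> \<Longrightarrow> finite (T e) \<and> {0, fst e} \<subseteq> T e \<and> T e \<subseteq> {0..fst e} \<and> S e \<subseteq> T e \<and>
      paffine \<phi> e (T e) \<and> paffine \<psi> e (T e)"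
proof -
  obtain A where A: "\<And>e. e \<in> \<E> \<Longrightarrow> finite (A e) \<and> paffine \<phi> e (A e)"
    using assms(1) unfolding epl_def by metis
  obtain B where B: "\<And>e. e \<in> \<E> \<Longrightarrow> finite (B e) \<and> paffine \<psi> e (B e)"
    using assms(2) unfolding epl_def by metis
  have cut: "paffine \<theta> e (C \<inter> {0..fst e})" if "paffine \<theta> e C" for \<theta> e C
    unfolding paffine_def
  proof (intro allI impI)
    fix x y assume *: "0 \<le> x \<and> x < y \<and> y \<le> fst e \<and> {x<..<y} \<inter> (C \<inter> {0..fst e}) = {}"
    then have "{x<..<y} \<inter> C = {}" by fastforce
    then show "\<exists>(m::int) c. \<forall>t\<in>{x..y}. \<theta> (snd e t) = of_int m * t + c"
      using paffine_gap[OF that, of x y] * by metis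
  qed
  show ?thesis
  proof (rule that[of "\<lambda>e. {0, fst e} \<union> S e \<union> (A e \<inter> {0..fst e}) \<union> (B e \<inter> {0..fst e})"], intro conjI)
    fix e assume e: "e \<in> \<E>"
    show "paffine \<phi> e ({0, fst e} \<union> S e \<union> (A e \<inter> {0..fst e}) \<union> (B e \<inter> {0..fst e}))"
      by (rule paffine_mono[OF cut]) (use A[OF e] in auto)
    show "paffine \<psi> e ({0, fst e} \<union> S e \<union> (A e \<inter> {0..fst e}) \<union> (B e \<inter> {0..fst e}))"
      by (rule paffine_mono[OF cut]) (use B[OF e] in auto)
  qed (use A B assms(3) edge_pos in \<open>auto intro: less_imp_le\<close>)
qed

end

section \<open>Stability of divisors\<close>

text \<open>Smallness conditions are stated for all \<epsilon> up to a threshold, so that finitely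
  many of them can be met at once by the least threshold.\<close>

lemma uniform_small:
  fixes Q :: "'b \<Rightarrow> real \<Rightarrow> bool"
  assumes "finite A" "\<And>a. a \<in> A \<Longrightarrow> \<exists>\<delta>>0. \<forall>\<epsilon>. 0 < \<epsilon> \<and> \<epsilon> \<le> \<delta> \<longrightarrow> Q a \<epsilon>"
  shows "\<exists>\<delta>>0. \<forall>\<epsilon>. 0 < \<epsilon> \<and> \<epsilon> \<le> \<delta> \<longrightarrow> (\<forall>a\<in>A. Q a \<epsilon>)"
  using assms
proof (induction A rule: finite_induct)
  case empty
  show ?case by (intro exI[of _ 1]) simp
next
  case (insert a A)
  obtain \<delta> where "\<delta> > 0" "\<forall>\<epsilon>. 0 < \<epsilon> \<and> \<epsilon> \<le> \<delta> \<longrightarrow> (\<forall>a\<in>A. Q a \<epsilon>)" using insert by auto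
  moreover obtain \<delta>' where "\<delta>' > 0" "\<forall>\<epsilon>. 0 < \<epsilon> \<and> \<epsilon> \<le> \<delta>' \<longrightarrow> Q a \<epsilon>" using insert.prems by (meson insertI1)
  ultimately show ?case by (intro exI[of _ "min \<delta> \<delta>'"]) auto
qed

text \<open>Closeness of divisors as conservation of mass: the balls around the support of E contain
  the support of E', and each carries the mass of its centre. It is meant for \<epsilon> at most
  half the distances within the support of E, when the balls are disjoint.\<close>

definition window :: "('a::metric_space \<Rightarrow>\<^sub>0 int) \<Rightarrow> ('a \<Rightarrow>\<^sub>0 int) \<Rightarrow> real \<Rightarrow> bool" where
  "window E E' \<epsilon> \<longleftrightarrow>
     Poly_Mapping.keys E' \<subseteq> (\<Union>p\<in>Poly_Mapping.keys E. ball p \<epsilon>) \<and>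
     (\<forall>p\<in>Poly_Mapping.keys E. (\<Sum>x\<in>Poly_Mapping.keys E' \<inter> ball p \<epsilon>. Poly_Mapping.lookup E' x) = Poly_Mapping.lookup E p)"

lemma keys_separated:
  fixes E :: "'a::metric_space \<Rightarrow>\<^sub>0 int"
  shows "\<exists>\<delta>>0. \<forall>\<epsilon>. 0 < \<epsilon> \<and> \<epsilon> \<le> \<delta> \<longrightarrow> (\<forall>p\<in>Poly_Mapping.keys E. \<forall>q\<in>Poly_Mapping.keys E. p \<noteq> q \<longrightarrow> 2 * \<epsilon> \<le> dist p q)"
proof -
  have "\<exists>\<delta>>0. \<forall>\<epsilon>. 0 < \<epsilon> \<and> \<epsilon> \<le> \<delta> \<longrightarrow> (\<forall>a\<in>Poly_Mapping.keys E \<times> Poly_Mapping.keys E. fst a \<noteq> snd a \<longrightarrow> 2 * \<epsilon> \<le> dist (fst a) (snd a))"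
  proof (rule uniform_small)
    fix a :: "'a \<times> 'a"
    show "\<exists>\<delta>>0. \<forall>\<epsilon>. 0 < \<epsilon> \<and> \<epsilon> \<le> \<delta> \<longrightarrow> fst a \<noteq> snd a \<longrightarrow> 2 * \<epsilon> \<le> dist (fst a) (snd a)"
      by (cases "fst a = snd a") (auto intro: exI[of _ 1] exI[of _ "dist (fst a) (snd a) / 2"])
  qed simp
  then show ?thesis by force
qed

context graph_model
begin

definition near :: "'a \<Rightarrow> 'a edge \<Rightarrow> real \<Rightarrow> bool" where
  "near p e \<epsilon> \<longleftrightarrow> (\<forall>t\<in>{0..fst e}. dist p (snd e t) \<ge> \<epsilon>) \<or>
     (\<exists>t0\<in>{0..fst e}. snd e t0 = p \<and>
       (\<forall>t\<in>{0..fst e}. dist p (snd e t) < \<epsilon> \<or> \<bar>t - t0\<bar> < \<epsilon> \<longrightarrow> dist p (snd e t) = \<bar>t - t0\<bar>))"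

lemma near_small: "\<exists>\<delta>>0. \<forall>\<epsilon>. 0 < \<epsilon> \<and> \<epsilon> \<le> \<delta> \<longrightarrow> (\<forall>e\<in>\<E>. near p e \<epsilon>)"
proof (rule uniform_small[OF finite_E])
  fix e assume "e \<in> \<E>"
  obtain \<delta> where "\<delta> > 0" and \<delta>: "(\<forall>t\<in>{0..fst e}. dist p (snd e t) \<ge> \<delta>) \<or>
     (\<exists>t0\<in>{0..fst e}. snd e t0 = p \<and>
       (\<forall>t\<in>{0..fst e}. dist p (snd e t) < \<delta> \<or> \<bar>t - t0\<bar> < \<delta> \<longrightarrow> dist p (snd e t) = \<bar>t - t0\<bar>))"
    using edge_near[OF \<open>e \<in> \<E>\<close>, of p] by blast
  have "near p e \<epsilon>" if "0 < \<epsilon> \<and> \<epsilon> \<le> \<delta>" for \<epsilon>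
    using \<delta>
  proof
    assume "\<forall>t\<in>{0..fst e}. dist p (snd e t) \<ge> \<delta>"
    then show ?thesis unfolding near_def using that by fastforce
  next
    assume "\<exists>t0\<in>{0..fst e}. snd e t0 = p \<and>
       (\<forall>t\<in>{0..fst e}. dist p (snd e t) < \<delta> \<or> \<bar>t - t0\<bar> < \<delta> \<longrightarrow> dist p (snd e t) = \<bar>t - t0\<bar>)"
    then obtain t0 where "t0 \<in> {0..fst e}" "snd e t0 = p"
      and *: "\<And>t. t \<in> {0..fst e} \<Longrightarrow> dist p (snd e t) < \<delta> \<or> \<bar>t - t0\<bar> < \<delta> \<Longrightarrow> dist p (snd e t) = \<bar>t - t0\<bar>"
      by blast
    moreover have "dist p (snd e t) = \<bar>t - t0\<bar>"
      if "t \<in> {0..fst e}" "dist p (snd e t) < \<epsilon> \<or> \<bar>t - t0\<bar> < \<epsilon>" for t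
      using that \<open>0 < \<epsilon> \<and> \<epsilon> \<le> \<delta>\<close> by (intro *) linarith+
    ultimately show ?thesis
      unfolding near_def by (intro disjI2 bexI[of _ t0] conjI ballI impI) blast+
  qed
  then show "\<exists>\<delta>>0. \<forall>\<epsilon>. 0 < \<epsilon> \<and> \<epsilon> \<le> \<delta> \<longrightarrow> near p e \<epsilon>" using \<open>\<delta> > 0\<close> by blast
qed

text \<open>The tent of height \<epsilon> at p. On the edge the distance to p may be replaced by the
  parameter distance to t0: where neither is below \<epsilon>, both tents vanish. So only t0, t0 -
  \<epsilon> and t0 + \<epsilon> can be breaks.\<close>

lemma tent_piecewise:
  assumes "near p e \<epsilon>" "\<epsilon> > 0"
  shows "\<exists>S. finite S \<and> S \<subseteq> {0..fst e} \<and> (\<forall>x y. 0 \<le> x \<and> x < y \<and> y \<le> fst e \<and> {x<..<y} \<inter> S = {} \<longrightarrow>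
    (\<exists>n k. \<forall>t\<in>{x..y}. max 0 (\<epsilon> - dist p (snd e t)) = n * t + k))"
  using assms(1) unfolding near_def
proof
  assume far: "\<forall>t\<in>{0..fst e}. dist p (snd e t) \<ge> \<epsilon>"
  have "max 0 (\<epsilon> - dist p (snd e t)) = 0 * t + 0" if "t \<in> {0..fst e}" for t
    using bspec[OF far that] by simp
  then have "\<exists>n k. \<forall>t\<in>{x..y}. max 0 (\<epsilon> - dist p (snd e t)) = n * t + k" if "0 \<le> x \<and> x < y \<and> y \<le> fst e" for x y
    using that by (intro exI[of _ 0]) auto
  then show ?thesis by (intro exI[of _ "{}"]) blast
next
  assume "\<exists>t0\<in>{0..fst e}. snd e t0 = p \<and>
       (\<forall>t\<in>{0..fst e}. dist p (snd e t) < \<epsilon> \<or> \<bar>t - t0\<bar> < \<epsilon> \<longrightarrow> dist p (snd e t) = \<bar>t - t0\<bar>)"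
  then obtain t0 where t0: "\<And>t. t \<in> {0..fst e} \<Longrightarrow> dist p (snd e t) < \<epsilon> \<or> \<bar>t - t0\<bar> < \<epsilon> \<Longrightarrow> dist p (snd e t) = \<bar>t - t0\<bar>"
    by blast
  have tent: "max 0 (\<epsilon> - dist p (snd e t)) = max 0 (\<epsilon> - \<bar>t - t0\<bar>)" if "t \<in> {0..fst e}" for t
    using t0[OF that] by (cases "dist p (snd e t) < \<epsilon> \<or> \<bar>t - t0\<bar> < \<epsilon>") auto
  show ?thesis
  proof (intro exI[of _ "{t0 - \<epsilon>, t0, t0 + \<epsilon>} \<inter> {0..fst e}"] conjI allI impI)
    fix x y assume xy: "0 \<le> x \<and> x < y \<and> y \<le> fst e \<and> {x<..<y} \<inter> ({t0 - \<epsilon>, t0, t0 + \<epsilon>} \<inter> {0..fst e}) = {}"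
    have out: "s \<le> x \<or> y \<le> s" if "s \<in> {t0 - \<epsilon>, t0, t0 + \<epsilon>}" for s
    proof (rule ccontr)
      assume "\<not> (s \<le> x \<or> y \<le> s)"
      then have "x < s" "s < y" "0 \<le> s" "s \<le> fst e" using xy by auto
      then have "s \<in> {x<..<y} \<inter> ({t0 - \<epsilon>, t0, t0 + \<epsilon>} \<inter> {0..fst e})" using that by simp
      then show False using xy by blast
    qed
    have cases: "y \<le> t0 - \<epsilon> \<or> t0 + \<epsilon> \<le> x \<or> (t0 - \<epsilon> \<le> x \<and> y \<le> t0) \<or> (t0 \<le> x \<and> y \<le> t0 + \<epsilon>)"
      using out[of "t0 - \<epsilon>"] out[of t0] out[of "t0 + \<epsilon>"] by auto
    have "\<exists>n k. \<forall>t\<in>{x..y}. max 0 (\<epsilon> - \<bar>t - t0\<bar>) = n * t + k"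
      using cases
    proof (elim disjE)
      assume "y \<le> t0 - \<epsilon>" then show ?thesis by (intro exI[of _ 0]) auto
    next
      assume "t0 + \<epsilon> \<le> x" then show ?thesis by (intro exI[of _ 0]) auto
    next
      assume "t0 - \<epsilon> \<le> x \<and> y \<le> t0" then show ?thesis by (intro exI[of _ 1] exI[of _ "\<epsilon> - t0"]) auto
    next
      assume "t0 \<le> x \<and> y \<le> t0 + \<epsilon>" then show ?thesis by (intro exI[of _ "-1"] exI[of _ "\<epsilon> + t0"]) auto
    qed
    then obtain n k where nk: "\<And>t. t \<in> {x..y} \<Longrightarrow> max 0 (\<epsilon> - \<bar>t - t0\<bar>) = n * t + k" by blast
    have "max 0 (\<epsilon> - dist p (snd e t)) = n * t + k" if "t \<in> {x..y}" for t
    proof -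
      have "t \<in> {0..fst e}" using that xy by auto
      from trans[OF tent[OF this] nk[OF that]] show ?thesis .
    qed
    then show "\<exists>n k. \<forall>t\<in>{x..y}. max 0 (\<epsilon> - dist p (snd e t)) = n * t + k" by blast
  qed auto
qed

lemma sum_pl_div_diff:
  assumes "epl \<phi>" "epl \<psi>" "finite K" "Poly_Mapping.keys (pl_div \<Gamma> \<phi>) \<union> Poly_Mapping.keys (pl_div \<Gamma> \<psi>) \<subseteq> K"
    and T: "\<And>e. e \<in> \<E> \<Longrightarrow> finite (T e) \<and> {0, fst e} \<subseteq> T e \<and> T e \<subseteq> {0..fst e} \<and> S e \<subseteq> T e \<and>
      paffine \<phi> e (T e) \<and> paffine \<psi> e (T e)"
  shows "(\<Sum>x\<in>K. of_int (Poly_Mapping.lookup (pl_div \<Gamma> \<phi>) x - Poly_Mapping.lookup (pl_div \<Gamma> \<psi>) x) * h x) =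
    - (\<Sum>e\<in>\<E>. pairing (\<lambda>t. of_int (dslope \<phi> (e, t, 1)) - of_int (dslope \<psi> (e, t, 1)))
         (\<lambda>t. of_int (dslope \<phi> (e, t, -1)) - of_int (dslope \<psi> (e, t, -1))) (T e) 0 (fst e) (\<lambda>t. h (snd e t)))"
proof -
  have "(\<Sum>e\<in>\<E>. pairing (\<lambda>t. of_int (dslope \<phi> (e, t, 1)) - of_int (dslope \<psi> (e, t, 1)))
         (\<lambda>t. of_int (dslope \<phi> (e, t, -1)) - of_int (dslope \<psi> (e, t, -1))) (T e) 0 (fst e) (\<lambda>t. h (snd e t))) =
     (\<Sum>e\<in>\<E>. pairing (\<lambda>t. of_int (dslope \<phi> (e, t, 1))) (\<lambda>t. of_int (dslope \<phi> (e, t, -1))) (T e) 0 (fst e) (\<lambda>t. h (snd e t))) -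
     (\<Sum>e\<in>\<E>. pairing (\<lambda>t. of_int (dslope \<psi> (e, t, 1))) (\<lambda>t. of_int (dslope \<psi> (e, t, -1))) (T e) 0 (fst e) (\<lambda>t. h (snd e t)))"
    unfolding sum_subtractf[symmetric] using T by (intro sum.cong refl pairing_diff) auto
  moreover have "(\<Sum>x\<in>K. of_int (Poly_Mapping.lookup (pl_div \<Gamma> \<phi>) x) * h x) =
    - (\<Sum>e\<in>\<E>. pairing (\<lambda>t. of_int (dslope \<phi> (e, t, 1))) (\<lambda>t. of_int (dslope \<phi> (e, t, -1))) (T e) 0 (fst e) (\<lambda>t. h (snd e t)))"
    by (rule sum_pl_div) (use assms in auto)
  moreover have "(\<Sum>x\<in>K. of_int (Poly_Mapping.lookup (pl_div \<Gamma> \<psi>) x) * h x) =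
    - (\<Sum>e\<in>\<E>. pairing (\<lambda>t. of_int (dslope \<psi> (e, t, 1))) (\<lambda>t. of_int (dslope \<psi> (e, t, -1))) (T e) 0 (fst e) (\<lambda>t. h (snd e t)))"
    by (rule sum_pl_div) (use assms in auto)
  ultimately show ?thesis
    by (simp add: left_diff_distrib sum_subtractf)
qed

text \<open>Green's formula for the constant test function 1, whose slope is 0.\<close>

lemma sum_pl_div_zero:
  assumes "epl \<phi>" "finite K" "Poly_Mapping.keys (pl_div \<Gamma> \<phi>) \<subseteq> K"
  shows "(\<Sum>x\<in>K. Poly_Mapping.lookup (pl_div \<Gamma> \<phi>) x) = 0"
proof -
  obtain T where T: "\<And>e. e \<in> \<E> \<Longrightarrow> finite (T e) \<and> {0, fst e} \<subseteq> T e \<and> T e \<subseteq> {0..fst e} \<and> {} \<subseteq> T e \<and>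
      paffine \<phi> e (T e) \<and> paffine \<phi> e (T e)"
    using common_breaks[OF assms(1,1), of "\<lambda>_. {}"] by auto
  have "(\<Sum>x\<in>K. of_int (Poly_Mapping.lookup (pl_div \<Gamma> \<phi>) x) * (1::real)) =
    - (\<Sum>e\<in>\<E>. pairing (\<lambda>t. of_int (dslope \<phi> (e, t, 1))) (\<lambda>t. of_int (dslope \<phi> (e, t, -1))) (T e) 0 (fst e) (\<lambda>t. 1))"
    by (rule sum_pl_div) (use assms T in auto)
  also have "\<dots> = - (\<Sum>e\<in>\<E>. - 0 * (\<phi> (snd e (fst e)) - \<phi> (snd e 0)))"
  proof (intro arg_cong[where f = uminus] sum.cong refl)
    fix e assume e: "e \<in> \<E>"
    show "pairing (\<lambda>t. of_int (dslope \<phi> (e, t, 1))) (\<lambda>t. of_int (dslope \<phi> (e, t, -1))) (T e) 0 (fst e) (\<lambda>t. 1)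
        = - 0 * (\<phi> (snd e (fst e)) - \<phi> (snd e 0))"
      by (rule pairing_affine[where u = "\<lambda>t. \<phi> (snd e t)" and k = 1])
        (use T[OF e] edge_pos[OF e] paffine_pwl in auto)
  qed
  finally have "(\<Sum>x\<in>K. of_int (Poly_Mapping.lookup (pl_div \<Gamma> \<phi>) x)) = (0::real)" by simp
  then show ?thesis by (simp flip: of_int_sum)
qed

text \<open>Weak continuity of the divisor: \<open>pairing_bound\<close> on every edge, applied to
  the difference of the two functions. C depends on h only, and uniform closeness of the functions
  suffices although their slopes may differ by whole units.\<close>

lemma green_bound:
  assumes "\<And>e. e \<in> \<E> \<Longrightarrow> \<exists>S. finite S \<and> S \<subseteq> {0..fst e} \<and> (\<forall>x y. 0 \<le> x \<and> x < y \<and> y \<le> fst e \<and> {x<..<y} \<inter> S = {} \<longrightarrow>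
    (\<exists>n k. \<forall>t\<in>{x..y}. h (snd e t) = n * t + k))"
  obtains C where "C \<ge> 0" "\<And>\<phi> \<psi> K M. epl \<phi> \<Longrightarrow> epl \<psi> \<Longrightarrow> finite K \<Longrightarrow>
      Poly_Mapping.keys (pl_div \<Gamma> \<phi>) \<union> Poly_Mapping.keys (pl_div \<Gamma> \<psi>) \<subseteq> K \<Longrightarrow> (\<And>x. x \<in> \<Gamma> \<Longrightarrow> \<bar>\<phi> x - \<psi> x\<bar> \<le> M) \<Longrightarrow>
      \<bar>\<Sum>x\<in>K. of_int (Poly_Mapping.lookup (pl_div \<Gamma> \<phi>) x - Poly_Mapping.lookup (pl_div \<Gamma> \<psi>) x) * h x\<bar> \<le> C * M"
proof -
  obtain S where S: "\<And>e. e \<in> \<E> \<Longrightarrow> finite (S e) \<and> S e \<subseteq> {0..fst e} \<and> (\<forall>x y. 0 \<le> x \<and> x < y \<and> y \<le> fst e \<and> {x<..<y} \<inter> S e = {} \<longrightarrow>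
    (\<exists>n k. \<forall>t\<in>{x..y}. h (snd e t) = n * t + k))"
    using assms by metis
  define Bd where "Bd e C \<longleftrightarrow> C \<ge> 0 \<and> (\<forall>u p q T M. finite T \<longrightarrow> pwl u p q 0 (fst e) T \<longrightarrow> S e \<union> {0, fst e} \<subseteq> T \<longrightarrow>
      (\<forall>t\<in>{0..fst e}. \<bar>u t\<bar> \<le> M) \<longrightarrow> \<bar>pairing p q T 0 (fst e) (\<lambda>t. h (snd e t))\<bar> \<le> C * M)" for e C
  have "\<exists>C. Bd e C" if "e \<in> \<E>" for e
    unfolding Bd_def by (rule pairing_bound) (use S[OF that] edge_pos[OF that] in auto)
  then obtain C where C: "\<And>e. e \<in> \<E> \<Longrightarrow> Bd e (C e)" by metis
  show ?thesis
  proof (rule that[of "\<Sum>e\<in>\<E>. C e"])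
    show "(\<Sum>e\<in>\<E>. C e) \<ge> 0" using C by (auto simp: Bd_def intro: sum_nonneg)
    fix \<phi> \<psi> K M assume a: "epl \<phi>" "epl \<psi>" "finite K" "Poly_Mapping.keys (pl_div \<Gamma> \<phi>) \<union> Poly_Mapping.keys (pl_div \<Gamma> \<psi>) \<subseteq> K"
      and M: "\<And>x. x \<in> \<Gamma> \<Longrightarrow> \<bar>\<phi> x - \<psi> x\<bar> \<le> M"
    obtain T where T: "\<And>e. e \<in> \<E> \<Longrightarrow> finite (T e) \<and> {0, fst e} \<subseteq> T e \<and> T e \<subseteq> {0..fst e} \<and> S e \<subseteq> T e \<and>
      paffine \<phi> e (T e) \<and> paffine \<psi> e (T e)"
      using common_breaks[OF a(1,2), of S] S by metis
    let ?P = "\<lambda>e. pairing (\<lambda>t. of_int (dslope \<phi> (e, t, 1)) - of_int (dslope \<psi> (e, t, 1)))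
         (\<lambda>t. of_int (dslope \<phi> (e, t, -1)) - of_int (dslope \<psi> (e, t, -1))) (T e) 0 (fst e) (\<lambda>t. h (snd e t))"
    have "\<bar>?P e\<bar> \<le> C e * M" if e: "e \<in> \<E>" for e
    proof -
      have "pwl (\<lambda>t. \<phi> (snd e t) - \<psi> (snd e t)) (\<lambda>t. of_int (dslope \<phi> (e, t, 1)) - of_int (dslope \<psi> (e, t, 1)))
         (\<lambda>t. of_int (dslope \<phi> (e, t, -1)) - of_int (dslope \<psi> (e, t, -1))) 0 (fst e) (T e)"
        using T[OF e] by (intro pwl_diff paffine_pwl) auto
      moreover have "\<forall>t\<in>{0..fst e}. \<bar>\<phi> (snd e t) - \<psi> (snd e t)\<bar> \<le> M" using M edge_in[OF e] by auto
      moreover have "finite (T e)" "S e \<union> {0, fst e} \<subseteq> T e" using T[OF e] by auto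
      moreover have "finite T \<Longrightarrow> pwl u p q 0 (fst e) T \<Longrightarrow> S e \<union> {0, fst e} \<subseteq> T \<Longrightarrow>
          \<forall>t\<in>{0..fst e}. \<bar>u t\<bar> \<le> M \<Longrightarrow> \<bar>pairing p q T 0 (fst e) (\<lambda>t. h (snd e t))\<bar> \<le> C e * M" for u p q T M
        using C[OF e] unfolding Bd_def by blast
      ultimately show ?thesis by blast
    qed
    then have "\<bar>\<Sum>e\<in>\<E>. ?P e\<bar> \<le> (\<Sum>e\<in>\<E>. C e * M)"
      by (intro order_trans[OF sum_abs] sum_mono)
    then show "\<bar>\<Sum>x\<in>K. of_int (Poly_Mapping.lookup (pl_div \<Gamma> \<phi>) x - Poly_Mapping.lookup (pl_div \<Gamma> \<psi>) x) * h x\<bar> \<le> (\<Sum>e\<in>\<E>. C e) * M"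
      by (subst sum_pl_div_diff[OF a T]) (auto simp: sum_distrib_right)
  qed
qed

text \<open>Dirichlet's argument: a difference of two functions with the same divisor has energy zero.\<close>

lemma pl_div_inj:
  assumes "connected \<Gamma>" "\<phi> \<in> PL \<Gamma>" "\<psi> \<in> PL \<Gamma>" "pl_div \<Gamma> \<phi> = pl_div \<Gamma> \<psi>"
  shows "\<exists>c. \<forall>x\<in>\<Gamma>. \<phi> x = \<psi> x + c"
proof -
  have epl: "epl \<phi>" "epl \<psi>" using assms PL_epl by auto
  define h where "h x = \<phi> x - \<psi> x" for x
  obtain T where T: "\<And>e. e \<in> \<E> \<Longrightarrow> finite (T e) \<and> {0, fst e} \<subseteq> T e \<and> T e \<subseteq> {0..fst e} \<and> {} \<subseteq> T e \<and>
      paffine \<phi> e (T e) \<and> paffine \<psi> e (T e)"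
    using common_breaks[OF epl, of "\<lambda>_. {}"] by auto
  let ?P = "\<lambda>e. pairing (\<lambda>t. of_int (dslope \<phi> (e, t, 1)) - of_int (dslope \<psi> (e, t, 1)))
         (\<lambda>t. of_int (dslope \<phi> (e, t, -1)) - of_int (dslope \<psi> (e, t, -1))) (T e) 0 (fst e) (\<lambda>t. h (snd e t))"
  have P: "?P e \<le> 0 \<and> (?P e = 0 \<longrightarrow> (\<forall>t\<in>{0..fst e}. h (snd e t) = h (snd e 0)))" if e: "e \<in> \<E>" for e
    unfolding h_def using T[OF e] edge_pos[OF e]
    by (intro pairing_self pwl_diff paffine_pwl) auto
  have "(\<Sum>e\<in>\<E>. ?P e) = 0"
    using sum_pl_div_diff[OF epl _ _ T, of "Poly_Mapping.keys (pl_div \<Gamma> \<phi>)" h] by (simp add: assms(4))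
  then have "(\<Sum>e\<in>\<E>. - ?P e) = 0" unfolding sum_negf by simp
  then have "?P e = 0" if "e \<in> \<E>" for e
    using P that finite_E sum_nonneg_eq_0_iff[of \<E> "\<lambda>e. - ?P e"] by fastforce
  then have const: "h (snd e t) = h (snd e 0)" if "e \<in> \<E>" "t \<in> {0..fst e}" for e t
    using P that by blast
  \<comment> \<open>As h is constant along edges, its values are those at the finitely many
    vertices, and a continuous function with finite range on a connected set is constant.\<close>
  have "h ` \<Gamma> \<subseteq> h ` V"
  proof
    fix y assume "y \<in> h ` \<Gamma>"
    then obtain x where x: "x \<in> \<Gamma>" "y = h x" by auto
    from x(1) show "y \<in> h ` V"
    proof (cases rule: point_cases)
      case (2 e t)
      then have "y = h (snd e 0)" using const[of e t] x(2) by simp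
      then show ?thesis using edge_ends_V(1)[OF 2(1)] by blast
    qed (use x in blast)
  qed
  then have "finite (h ` \<Gamma>)" using finite_V finite_surj by blast
  moreover have "continuous_on \<Gamma> h"
    unfolding h_def using assms(2,3) by (intro continuous_intros) (auto simp: PL_def)
  ultimately have "h constant_on \<Gamma>"
    using continuous_finite_range_constant assms(1) by blast
  then obtain c where "\<forall>x\<in>\<Gamma>. h x = c" unfolding constant_on_def by blast
  then show ?thesis by (intro exI[of _ c]) (auto simp: h_def)
qed

text \<open>Test with the tent of height \<epsilon> at each support point p. The mass of the new
  divisor in the ball of p is at least its tent sum divided by \<epsilon>, hence more than the mass
  at p minus one; being an integer, it is at least the mass at p. A point outside all balls would
  cost a whole \<epsilon> in the complementary sum. So the balls carry the full degree, which is the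
  same for both divisors, and equality holds in each ball.\<close>

lemma window_stable:
  assumes "divisor_on \<Gamma> D" "\<phi> \<in> R \<Gamma> D"
  shows "\<exists>\<delta>>0. \<forall>\<epsilon>. 0 < \<epsilon> \<and> \<epsilon> \<le> \<delta> \<longrightarrow> (\<exists>\<eta>>0. \<forall>\<theta>\<in>R \<Gamma> D. (\<forall>x\<in>\<Gamma>. \<bar>\<theta> x - \<phi> x\<bar> < \<eta>) \<longrightarrow>
    window (D + pl_div \<Gamma> \<phi>) (D + pl_div \<Gamma> \<theta>) \<epsilon>)"
proof -
  define E where "E \<theta> = D + pl_div \<Gamma> \<theta>" for \<theta>
  let ?k = "Poly_Mapping.keys (E \<phi>)" and ?l = "\<lambda>\<theta>. Poly_Mapping.lookup (E \<theta>)"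
  have "epl \<phi>" using assms(2) PL_epl by (auto simp: R_def)
  obtain \<delta>1 where \<delta>1: "\<delta>1 > 0" "\<And>\<epsilon>. 0 < \<epsilon> \<Longrightarrow> \<epsilon> \<le> \<delta>1 \<Longrightarrow> \<forall>p\<in>?k. \<forall>e\<in>\<E>. near p e \<epsilon>"
    using uniform_small[of ?k "\<lambda>p \<epsilon>. \<forall>e\<in>\<E>. near p e \<epsilon>"] near_small by (metis finite_keys)
  obtain \<delta>2 where \<delta>2: "\<delta>2 > 0" "\<And>\<epsilon>. 0 < \<epsilon> \<Longrightarrow> \<epsilon> \<le> \<delta>2 \<Longrightarrow> \<forall>p\<in>?k. \<forall>q\<in>?k. p \<noteq> q \<longrightarrow> 2 * \<epsilon> \<le> dist p q"
    using keys_separated[of "E \<phi>"] by metis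
  have main: "\<exists>\<eta>>0. \<forall>\<theta>\<in>R \<Gamma> D. (\<forall>x\<in>\<Gamma>. \<bar>\<theta> x - \<phi> x\<bar> < \<eta>) \<longrightarrow> window (E \<phi>) (E \<theta>) \<epsilon>"
    if "0 < \<epsilon> \<and> \<epsilon> \<le> min \<delta>1 \<delta>2" for \<epsilon>
  proof -
    have \<epsilon>: "0 < \<epsilon>" "\<epsilon> \<le> \<delta>1" "\<epsilon> \<le> \<delta>2" using that by auto
    define h where "h p x = max 0 (\<epsilon> - dist p x)" for p x :: 'a
    define Bd where "Bd p C \<longleftrightarrow> C \<ge> 0 \<and> (\<forall>\<theta> K M. epl \<theta> \<longrightarrow> finite K \<longrightarrow>
      Poly_Mapping.keys (pl_div \<Gamma> \<theta>) \<union> Poly_Mapping.keys (pl_div \<Gamma> \<phi>) \<subseteq> K \<longrightarrow> (\<forall>x\<in>\<Gamma>. \<bar>\<theta> x - \<phi> x\<bar> \<le> M) \<longrightarrow>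
      \<bar>\<Sum>x\<in>K. of_int (Poly_Mapping.lookup (pl_div \<Gamma> \<theta>) x - Poly_Mapping.lookup (pl_div \<Gamma> \<phi>) x) * h p x\<bar> \<le> C * M)" for p C
    have "\<exists>C. Bd p C" if "p \<in> ?k" for p
    proof -
      have "\<exists>S. finite S \<and> S \<subseteq> {0..fst e} \<and> (\<forall>x y. 0 \<le> x \<and> x < y \<and> y \<le> fst e \<and> {x<..<y} \<inter> S = {} \<longrightarrow>
        (\<exists>n k. \<forall>t\<in>{x..y}. h p (snd e t) = n * t + k))" if "e \<in> \<E>" for e
        unfolding h_def using \<delta>1(2)[OF \<epsilon>(1,2)] \<open>p \<in> ?k\<close> that \<epsilon>(1) by (intro tent_piecewise) auto
      from green_bound[of "h p", OF this] obtain C where C: "C \<ge> 0" "\<And>\<phi> \<psi> K M. epl \<phi> \<Longrightarrow> epl \<psi> \<Longrightarrow> finite K \<Longrightarrow>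
        Poly_Mapping.keys (pl_div \<Gamma> \<phi>) \<union> Poly_Mapping.keys (pl_div \<Gamma> \<psi>) \<subseteq> K \<Longrightarrow> (\<And>x. x \<in> \<Gamma> \<Longrightarrow> \<bar>\<phi> x - \<psi> x\<bar> \<le> M) \<Longrightarrow>
        \<bar>\<Sum>x\<in>K. of_int (Poly_Mapping.lookup (pl_div \<Gamma> \<phi>) x - Poly_Mapping.lookup (pl_div \<Gamma> \<psi>) x) * h p x\<bar> \<le> C * M"
        by blast
      show ?thesis
        unfolding Bd_def using C(1) \<open>epl \<phi>\<close> by (intro exI[of _ C] conjI allI impI C(2)) auto
    qed
    then obtain C where C: "\<And>p. p \<in> ?k \<Longrightarrow> Bd p (C p)" by metis
    define Ct where "Ct = 1 + (\<Sum>p\<in>?k. C p)"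
    have C0: "0 \<le> C p" if "p \<in> ?k" for p using C[OF that] by (simp add: Bd_def)
    have Cle: "C p \<le> Ct" if "p \<in> ?k" for p
      using member_le_sum[OF that, of C] C0 by (simp add: Ct_def)
    have "Ct \<ge> 1" using C0 by (simp add: Ct_def sum_nonneg)
    \<comment> \<open>The errors of all tents together are at most Ct * \<eta> = \<epsilon> / 2,
      less than one unit of mass at height \<epsilon>. The summand 1 makes \<open>Ct\<close>
      positive even for empty support.\<close>
    define \<eta> where "\<eta> = \<epsilon> / (2 * Ct)"
    have \<eta>: "\<eta> > 0" "Ct * \<eta> < \<epsilon>" using \<open>Ct \<ge> 1\<close> \<epsilon> by (auto simp: \<eta>_def field_simps)
    have "window (E \<phi>) (E \<theta>) \<epsilon>" if \<theta>: "\<theta> \<in> R \<Gamma> D" "\<forall>x\<in>\<Gamma>. \<bar>\<theta> x - \<phi> x\<bar> < \<eta>" for \<theta>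
    proof -
      have "epl \<theta>" using \<theta>(1) PL_epl by (auto simp: R_def)
      let ?k' = "Poly_Mapping.keys (E \<theta>)"
      define K where "K = ?k \<union> ?k' \<union> Poly_Mapping.keys (pl_div \<Gamma> \<theta>) \<union> Poly_Mapping.keys (pl_div \<Gamma> \<phi>)"
      have K: "finite K" "Poly_Mapping.keys (pl_div \<Gamma> \<theta>) \<union> Poly_Mapping.keys (pl_div \<Gamma> \<phi>) \<subseteq> K" "?k \<subseteq> K" "?k' \<subseteq> K"
        by (auto simp: K_def)
      have pos: "0 \<le> ?l \<theta> x" "0 \<le> ?l \<phi> x" for x
        using \<theta>(1) assms(2) by (auto simp: R_def effective_def E_def)
      have deg: "(\<Sum>x\<in>K. ?l \<theta> x) = (\<Sum>x\<in>K. ?l \<phi> x)"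
        using sum_pl_div_zero[OF \<open>epl \<theta>\<close> K(1)] sum_pl_div_zero[OF \<open>epl \<phi>\<close> K(1)] K(2)
        by (simp add: E_def lookup_add sum.distrib)
      have sep: "2 * \<epsilon> \<le> dist p q" if "p \<in> ?k" "q \<in> ?k" "p \<noteq> q" for p q
        using \<delta>2(2)[OF \<epsilon>(1,3)] that by blast
      have uniq: "p = q" if "p \<in> ?k" "q \<in> ?k" "dist p x < \<epsilon>" "dist q x < \<epsilon>" for p q x
        using sep[OF that(1,2)] that(3,4) dist_triangle_half_l[of p x "2 * \<epsilon>" q] by (auto simp: dist_commute)
      have h\<phi>: "(\<Sum>x\<in>K. ?l \<phi> x * h p x) = \<epsilon> * ?l \<phi> p" if p: "p \<in> ?k" for p
      proof -
        have "(\<Sum>x\<in>K. ?l \<phi> x * h p x) = (\<Sum>x\<in>{p}. ?l \<phi> x * h p x)"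
        proof (rule sum.mono_neutral_right)
          show "\<forall>i\<in>K - {p}. ?l \<phi> i * h p i = 0"
          proof
            fix i assume "i \<in> K - {p}"
            then show "?l \<phi> i * h p i = 0"
              using sep[OF p, of i] \<epsilon>(1) by (cases "i \<in> ?k") (auto simp: h_def in_keys_iff)
          qed
        qed (use K p in auto)
        then show ?thesis using \<epsilon>(1) by (simp add: h_def)
      qed
      have h\<theta>: "(\<Sum>x\<in>K. ?l \<theta> x * h p x) \<ge> \<epsilon> * ?l \<phi> p - C p * \<eta>" if p: "p \<in> ?k" for p
      proof -
        have "\<bar>\<Sum>x\<in>K. of_int (Poly_Mapping.lookup (pl_div \<Gamma> \<theta>) x - Poly_Mapping.lookup (pl_div \<Gamma> \<phi>) x) * h p x\<bar> \<le> C p * \<eta>"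
          using C[OF p] \<open>epl \<theta>\<close> K(1,2) \<theta>(2) unfolding Bd_def by (auto simp: less_imp_le)
        moreover have "(\<Sum>x\<in>K. of_int (Poly_Mapping.lookup (pl_div \<Gamma> \<theta>) x - Poly_Mapping.lookup (pl_div \<Gamma> \<phi>) x) * h p x) =
            (\<Sum>x\<in>K. ?l \<theta> x * h p x) - (\<Sum>x\<in>K. ?l \<phi> x * h p x)"
          by (simp add: E_def lookup_add algebra_simps sum_subtractf sum.distrib)
        ultimately show ?thesis using h\<phi>[OF p] by linarith
      qed
      \<comment> \<open>The function \<epsilon> - g is nonnegative, since the tents have disjoint
        supports, and equals \<epsilon> outside the balls: it weighs the mass that strays from the
        centres.\<close>
      define g where "g x = (\<Sum>p\<in>?k. h p x)" for x
      have g_le: "g x \<le> \<epsilon>" for x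
      proof (cases "\<exists>p\<in>?k. dist p x < \<epsilon>")
        case True
        then obtain p where p: "p \<in> ?k" "dist p x < \<epsilon>" by blast
        have "g x = (\<Sum>p\<in>{p}. h p x)"
          unfolding g_def using p uniq[OF p(1) _ p(2)]
          by (intro sum.mono_neutral_right) (force simp: h_def)+
        then show ?thesis using \<epsilon>(1) by (simp add: h_def)
      next
        case False
        then have "g x = 0" unfolding g_def by (intro sum.neutral) (auto simp: h_def)
        then show ?thesis using \<epsilon>(1) by simp
      qed
      have "(\<Sum>x\<in>K. ?l \<theta> x * (\<epsilon> - g x)) = \<epsilon> * (\<Sum>x\<in>K. ?l \<phi> x) - (\<Sum>p\<in>?k. \<Sum>x\<in>K. ?l \<theta> x * h p x)"
      proof -
        have "(\<Sum>x\<in>K. ?l \<theta> x * (\<epsilon> - g x)) = \<epsilon> * of_int (\<Sum>x\<in>K. ?l \<theta> x) - (\<Sum>x\<in>K. \<Sum>p\<in>?k. ?l \<theta> x * h p x)"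
          by (simp add: g_def right_diff_distrib sum_subtractf sum_distrib_left mult.commute)
        then show ?thesis by (subst sum.swap) (simp add: deg)
      qed
      also have "\<dots> \<le> \<epsilon> * (\<Sum>x\<in>K. ?l \<phi> x) - (\<Sum>p\<in>?k. \<epsilon> * ?l \<phi> p - C p * \<eta>)"
        using h\<theta> by (intro diff_left_mono sum_mono) auto
      also have "(\<Sum>x\<in>K. ?l \<phi> x) = (\<Sum>x\<in>?k. ?l \<phi> x)"
        using K by (intro sum.mono_neutral_right) (auto simp: in_keys_iff)
      also have "\<epsilon> * of_int (\<Sum>x\<in>?k. ?l \<phi> x) - (\<Sum>p\<in>?k. \<epsilon> * ?l \<phi> p - C p * \<eta>) = (\<Sum>p\<in>?k. C p) * \<eta>"
        by (simp add: sum_subtractf sum_distrib_left sum_distrib_right)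
      also have "\<dots> \<le> Ct * \<eta>" using \<eta>(1) by (intro mult_right_mono) (auto simp: Ct_def)
      also have "\<dots> < \<epsilon>" by (rule \<eta>(2))
      finally have small: "(\<Sum>x\<in>K. ?l \<theta> x * (\<epsilon> - g x)) < \<epsilon>" .
      have cover: "\<exists>p\<in>?k. dist p x < \<epsilon>" if x: "x \<in> ?k'" for x
      proof (rule ccontr)
        assume "\<not> ?thesis"
        then have "g x = 0" unfolding g_def by (intro sum.neutral) (auto simp: h_def)
        have "?l \<theta> x \<ge> 1" using pos(1)[of x] x by (simp add: in_keys_iff)
        then have "\<epsilon> \<le> ?l \<theta> x * (\<epsilon> - g x)" using \<epsilon>(1) \<open>g x = 0\<close> by simp
        also have "\<dots> \<le> (\<Sum>x\<in>K. ?l \<theta> x * (\<epsilon> - g x))"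
          using x K pos(1) g_le by (intro member_le_sum) auto
        finally show False using small by simp
      qed
      define n where "n p = (\<Sum>x\<in>?k' \<inter> ball p \<epsilon>. ?l \<theta> x)" for p
      have n_ge: "?l \<phi> p \<le> n p" if p: "p \<in> ?k" for p
      proof -
        have "(\<Sum>x\<in>K. ?l \<theta> x * h p x) = (\<Sum>x\<in>?k' \<inter> ball p \<epsilon>. ?l \<theta> x * h p x)"
          using K by (intro sum.mono_neutral_right) (auto simp: in_keys_iff h_def)
        also have "\<dots> \<le> (\<Sum>x\<in>?k' \<inter> ball p \<epsilon>. ?l \<theta> x * \<epsilon>)"
          using pos(1) \<epsilon>(1) by (intro sum_mono mult_left_mono) (auto simp: h_def)
        also have "\<dots> = \<epsilon> * n p" by (simp add: n_def sum_distrib_right sum_distrib_left mult.commute)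
        finally have "\<epsilon> * ?l \<phi> p - C p * \<eta> \<le> \<epsilon> * n p" using h\<theta>[OF p] by linarith
        moreover have "C p * \<eta> \<le> Ct * \<eta>" using Cle[OF p] \<eta>(1) by (intro mult_right_mono) auto
        ultimately have "\<epsilon> * ?l \<phi> p < \<epsilon> * (n p + 1)" using \<eta>(2) by (simp add: distrib_left)
        then have "real_of_int (?l \<phi> p) < n p + 1" using \<epsilon>(1) by (simp only: mult_less_cancel_left_pos)
        then show ?thesis by linarith
      qed
      have "(\<Sum>p\<in>?k. n p) = (\<Sum>x\<in>(\<Union>p\<in>?k. ?k' \<inter> ball p \<epsilon>). ?l \<theta> x)"
        unfolding n_def
      proof (rule sum.UNION_disjoint[symmetric])
        show "\<forall>i\<in>?k. \<forall>j\<in>?k. i \<noteq> j \<longrightarrow> ?k' \<inter> ball i \<epsilon> \<inter> (?k' \<inter> ball j \<epsilon>) = {}"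
          using uniq by (auto simp: disjoint_iff)
      qed auto
      also have "(\<Union>p\<in>?k. ?k' \<inter> ball p \<epsilon>) = ?k'" using cover by auto
      also have "(\<Sum>x\<in>?k'. ?l \<theta> x) = (\<Sum>x\<in>K. ?l \<theta> x)"
        using K by (intro sum.mono_neutral_left) (auto simp: in_keys_iff)
      also have "\<dots> = (\<Sum>x\<in>?k. ?l \<phi> x)"
        unfolding deg using K by (intro sum.mono_neutral_right) (auto simp: in_keys_iff)
      finally have "(\<Sum>p\<in>?k. n p - ?l \<phi> p) = 0" by (simp add: sum_subtractf)
      then have "n p = ?l \<phi> p" if "p \<in> ?k" for p
        using n_ge that by (subst (asm) sum_nonneg_eq_0_iff) auto
      then show ?thesis
        unfolding window_def using cover by (auto simp: n_def)
    qed
    then show ?thesis using \<eta>(1) by blast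
  qed
  show ?thesis
  proof (rule exI[of _ "min \<delta>1 \<delta>2"], rule conjI)
    show "\<forall>\<epsilon>. 0 < \<epsilon> \<and> \<epsilon> \<le> min \<delta>1 \<delta>2 \<longrightarrow> (\<exists>\<eta>>0. \<forall>\<theta>\<in>R \<Gamma> D. (\<forall>x\<in>\<Gamma>. \<bar>\<theta> x - \<phi> x\<bar> < \<eta>) \<longrightarrow>
      window (D + pl_div \<Gamma> \<phi>) (D + pl_div \<Gamma> \<theta>) \<epsilon>)"
      using main unfolding E_def by blast
  qed (use \<delta>1(1) \<delta>2(1) in simp)
qed

end

section \<open>Windows and the topology of the symmetric product\<close>

lemma effective_decomposition:
  fixes F :: "'a \<Rightarrow>\<^sub>0 int"
  assumes "finite I" "\<And>x. 0 \<le> Poly_Mapping.lookup F x"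
    and "(\<Sum>x\<in>Poly_Mapping.keys F. Poly_Mapping.lookup F x) = int (card I)"
  shows "\<exists>g. g ` I \<subseteq> Poly_Mapping.keys F \<and> F = (\<Sum>i\<in>I. Poly_Mapping.single (g i) 1)"
  using assms
proof (induction I arbitrary: F rule: finite_induct)
  case empty
  then have "\<forall>x\<in>Poly_Mapping.keys F. Poly_Mapping.lookup F x = 0"
    using sum_nonneg_eq_0_iff[of "Poly_Mapping.keys F" "Poly_Mapping.lookup F"] by simp
  then have "F = 0" by (intro poly_mapping_eqI) (auto simp: in_keys_iff)
  then show ?case by simp
next
  case (insert i I)
  then have "(\<Sum>x\<in>Poly_Mapping.keys F. Poly_Mapping.lookup F x) > 0" by simp
  then obtain x where x: "x \<in> Poly_Mapping.keys F" by fastforce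
  define F' where "F' = F - Poly_Mapping.single x 1"
  have l: "Poly_Mapping.lookup F' y = Poly_Mapping.lookup F y - (if y = x then 1 else 0)" for y
    by (auto simp: F'_def lookup_minus lookup_single)
  have pos: "0 \<le> Poly_Mapping.lookup F' y" for y
    using insert.prems(1)[of y] x by (auto simp: l in_keys_iff)
  have sub: "Poly_Mapping.keys F' \<subseteq> Poly_Mapping.keys F"
    using x by (auto simp: in_keys_iff l split: if_splits)
  have "(\<Sum>x\<in>Poly_Mapping.keys F'. Poly_Mapping.lookup F' x) = (\<Sum>x\<in>Poly_Mapping.keys F. Poly_Mapping.lookup F' x)"
    using sub by (intro sum.mono_neutral_left) (auto simp: in_keys_iff)
  also have "\<dots> = int (card I)"
    using insert.prems(2) insert.hyps x by (simp add: l sum_subtractf)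
  finally obtain g where g: "g ` I \<subseteq> Poly_Mapping.keys F'" "F' = (\<Sum>i\<in>I. Poly_Mapping.single (g i) 1)"
    using insert.IH[of F'] pos by blast
  have "(\<Sum>j\<in>I. Poly_Mapping.single ((g(i := x)) j) 1) = (\<Sum>j\<in>I. Poly_Mapping.single (g j) (1::int))"
    using insert.hyps(2) by (intro sum.cong) auto
  then have "F = (\<Sum>j\<in>insert i I. Poly_Mapping.single ((g(i := x)) j) 1)"
    using insert.hyps g(2) by (simp add: F'_def algebra_simps)
  moreover have "(g(i := x)) ` insert i I \<subseteq> Poly_Mapping.keys F"
    using g(1) sub x insert.hyps(2) by auto
  ultimately show ?case by blast
qed

text \<open>Lift E to a tuple f. The preimage of U contains a product of small balls around the
  entries of f, so it suffices to lift E' to a tuple g with g i in the ball of f i: the part of E'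
  in the ball of p is distributed over the indices that f sends to p, and \<open>window\<close> says
  that the numbers match.\<close>

lemma Sym_neighbourhood:
  fixes E :: "'a::metric_space \<Rightarrow>\<^sub>0 int"
  assumes "openin (Sym \<Gamma> d) U" "E \<in> U"
  shows "\<exists>\<delta>>0. \<forall>\<epsilon>. 0 < \<epsilon> \<and> \<epsilon> \<le> \<delta> \<longrightarrow>
    (\<forall>E'. Poly_Mapping.keys E' \<subseteq> \<Gamma> \<and> effective E' \<and> window E E' \<epsilon> \<longrightarrow> E' \<in> U)"
proof -
  have U: "U \<subseteq> {E. divisor_on \<Gamma> E \<and> effective E \<and> divisor_degree E = int d}"
    and op: "openin (product_topology (\<lambda>_. top_of_set \<Gamma>) {..<d})
       {f \<in> {..<d} \<rightarrow>\<^sub>E \<Gamma>. (\<Sum>i<d. Poly_Mapping.single (f i) 1) \<in> U}"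
    using assms(1) by (auto simp: openin_Sym)
  have E: "Poly_Mapping.keys E \<subseteq> \<Gamma>" "\<And>x. 0 \<le> Poly_Mapping.lookup E x"
    "(\<Sum>x\<in>Poly_Mapping.keys E. Poly_Mapping.lookup E x) = int (card {..<d})"
    using U assms(2) by (auto simp: divisor_on_def effective_def divisor_degree_def)
  obtain f0 where f0: "f0 ` {..<d} \<subseteq> Poly_Mapping.keys E" "E = (\<Sum>i<d. Poly_Mapping.single (f0 i) 1)"
    using effective_decomposition[OF _ E(2,3)] by auto
  define f where "f = restrict f0 {..<d}"
  have f: "f \<in> {..<d} \<rightarrow>\<^sub>E \<Gamma>" "E = (\<Sum>i<d. Poly_Mapping.single (f i) 1)" "f ` {..<d} \<subseteq> Poly_Mapping.keys E"
    using f0 E(1) by (auto simp: f_def)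
  have fS: "f \<in> {f \<in> {..<d} \<rightarrow>\<^sub>E \<Gamma>. (\<Sum>i<d. Poly_Mapping.single (f i) 1) \<in> U}"
    using f assms(2) by simp
  obtain O' where O': "\<forall>i\<in>{..<d}. openin (top_of_set \<Gamma>) (O' i)" "f \<in> Pi\<^sub>E {..<d} O'"
    "Pi\<^sub>E {..<d} O' \<subseteq> {f \<in> {..<d} \<rightarrow>\<^sub>E \<Gamma>. (\<Sum>i<d. Poly_Mapping.single (f i) 1) \<in> U}"
    using bspec[OF op[unfolded openin_product_topology_alt] fS] by (elim exE conjE) (rule that)
  have "\<exists>\<delta>>0. \<forall>\<epsilon>. 0 < \<epsilon> \<and> \<epsilon> \<le> \<delta> \<longrightarrow> (\<forall>i\<in>{..<d}. ball (f i) \<epsilon> \<inter> \<Gamma> \<subseteq> O' i)"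
  proof (rule uniform_small)
    fix i assume "i \<in> {..<d}"
    then obtain \<delta> where "\<delta> > 0" "ball (f i) \<delta> \<inter> \<Gamma> \<subseteq> O' i"
      using O' openin_contains_ball[of \<Gamma> "O' i"] by (metis PiE_mem)
    then show "\<exists>\<delta>>0. \<forall>\<epsilon>. 0 < \<epsilon> \<and> \<epsilon> \<le> \<delta> \<longrightarrow> ball (f i) \<epsilon> \<inter> \<Gamma> \<subseteq> O' i"
      by (intro exI[of _ \<delta>]) (use subset_ball in blast)
  qed simp
  then obtain \<delta>1 where \<delta>1: "\<delta>1 > 0" "\<And>\<epsilon>. 0 < \<epsilon> \<Longrightarrow> \<epsilon> \<le> \<delta>1 \<Longrightarrow> \<forall>i\<in>{..<d}. ball (f i) \<epsilon> \<inter> \<Gamma> \<subseteq> O' i"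
    by blast
  obtain \<delta>2 where \<delta>2: "\<delta>2 > 0" "\<And>\<epsilon>. 0 < \<epsilon> \<Longrightarrow> \<epsilon> \<le> \<delta>2 \<Longrightarrow>
      \<forall>p\<in>Poly_Mapping.keys E. \<forall>q\<in>Poly_Mapping.keys E. p \<noteq> q \<longrightarrow> 2 * \<epsilon> \<le> dist p q"
    using keys_separated[of E] by metis
  have "E' \<in> U" if \<epsilon>: "0 < \<epsilon>" "\<epsilon> \<le> \<delta>1" "\<epsilon> \<le> \<delta>2" and E': "Poly_Mapping.keys E' \<subseteq> \<Gamma>" "effective E'" "window E E' \<epsilon>" for \<epsilon> E'
  proof -
    have uniq: "p = q" if "p \<in> Poly_Mapping.keys E" "q \<in> Poly_Mapping.keys E" "dist p x < \<epsilon>" "dist q x < \<epsilon>" for p q x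
      using \<delta>2(2)[OF \<epsilon>(1,3)] that dist_triangle_half_l[of p x "2 * \<epsilon>" q] by (force simp: dist_commute)
    define I where "I p = {i \<in> {..<d}. f i = p}" for p
    define F where "F p = (\<Sum>x\<in>Poly_Mapping.keys E' \<inter> ball p \<epsilon>. Poly_Mapping.single x (Poly_Mapping.lookup E' x))" for p
    have lF: "Poly_Mapping.lookup (F p) x = (if x \<in> Poly_Mapping.keys E' \<inter> ball p \<epsilon> then Poly_Mapping.lookup E' x else 0)" for p x
    proof -
      have "Poly_Mapping.lookup (F p) x = (\<Sum>y\<in>Poly_Mapping.keys E' \<inter> ball p \<epsilon>. if y = x then Poly_Mapping.lookup E' x else 0)"
        unfolding F_def lookup_sum by (intro sum.cong) (auto simp: lookup_single when_def)
      then show ?thesis by (simp add: sum.delta)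
    qed
    have kF: "Poly_Mapping.keys (F p) = Poly_Mapping.keys E' \<inter> ball p \<epsilon>" for p
      by (auto simp: in_keys_iff lF split: if_splits)
    have "\<exists>g. g ` I p \<subseteq> Poly_Mapping.keys (F p) \<and> F p = (\<Sum>i\<in>I p. Poly_Mapping.single (g i) 1)"
      if p: "p \<in> Poly_Mapping.keys E" for p
    proof (rule effective_decomposition)
      have "Poly_Mapping.lookup E p = (\<Sum>i<d. if f i = p then 1 else 0)"
        by (subst f(2)) (auto simp: lookup_sum lookup_single when_def intro!: sum.cong)
      also have "\<dots> = int (card (I p))"
        by (simp add: I_def sum.If_cases Int_def)
      finally have "int (card (I p)) = Poly_Mapping.lookup E p" by simp
      also have "\<dots> = (\<Sum>x\<in>Poly_Mapping.keys (F p). Poly_Mapping.lookup (F p) x)"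
        using E'(3) p unfolding window_def kF by (auto simp: lF intro!: sum.cong)
      finally show "(\<Sum>x\<in>Poly_Mapping.keys (F p). Poly_Mapping.lookup (F p) x) = int (card (I p))" by simp
    qed (use E'(2) in \<open>auto simp: I_def lF effective_def\<close>)
    then obtain G where G: "\<And>p. p \<in> Poly_Mapping.keys E \<Longrightarrow> G p ` I p \<subseteq> Poly_Mapping.keys (F p) \<and>
        F p = (\<Sum>i\<in>I p. Poly_Mapping.single (G p i) 1)" by metis
    define g where "g = restrict (\<lambda>i. G (f i) i) {..<d}"
    have g: "g i \<in> Poly_Mapping.keys E' \<inter> ball (f i) \<epsilon>" if "i < d" for i
    proof -
      have "f i \<in> Poly_Mapping.keys E" "i \<in> I (f i)" using f(3) that by (auto simp: I_def)
      then have "G (f i) i \<in> Poly_Mapping.keys (F (f i))" using G[of "f i"] by blast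
      then show ?thesis using that by (simp add: kF g_def)
    qed
    have "(\<Sum>i<d. Poly_Mapping.single (g i) 1) = (\<Sum>p\<in>Poly_Mapping.keys E. \<Sum>i\<in>I p. Poly_Mapping.single (g i) (1::int))"
      unfolding I_def using f(3) by (intro sum.group[symmetric]) auto
    also have "\<dots> = (\<Sum>p\<in>Poly_Mapping.keys E. F p)"
    proof (intro sum.cong refl)
      fix p assume p: "p \<in> Poly_Mapping.keys E"
      have "(\<Sum>i\<in>I p. Poly_Mapping.single (g i) 1) = (\<Sum>i\<in>I p. Poly_Mapping.single (G p i) (1::int))"
        by (intro sum.cong) (auto simp: g_def I_def)
      then show "(\<Sum>i\<in>I p. Poly_Mapping.single (g i) 1) = F p" using G[OF p] by simp
    qed
    also have "\<dots> = E'"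
    proof (rule poly_mapping_eqI)
      fix x
      show "Poly_Mapping.lookup (\<Sum>p\<in>Poly_Mapping.keys E. F p) x = Poly_Mapping.lookup E' x"
      proof (cases "x \<in> Poly_Mapping.keys E'")
        case True
        then obtain p where p: "p \<in> Poly_Mapping.keys E" "x \<in> ball p \<epsilon>"
          using E'(3) unfolding window_def by blast
        have "(\<Sum>p\<in>Poly_Mapping.keys E. Poly_Mapping.lookup (F p) x) = (\<Sum>p\<in>{p}. Poly_Mapping.lookup (F p) x)"
        proof (rule sum.mono_neutral_right)
          show "\<forall>q\<in>Poly_Mapping.keys E - {p}. Poly_Mapping.lookup (F q) x = 0"
            using uniq[OF p(1)] p(2) by (force simp: lF)
        qed (use p in auto)
        then show ?thesis using p True by (simp add: lookup_sum lF)
      qed (simp add: lookup_sum lF in_keys_iff)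
    qed
    finally have "(\<Sum>i<d. Poly_Mapping.single (g i) 1) = E'" .
    moreover have "g \<in> Pi\<^sub>E {..<d} O'"
    proof (rule PiE_I)
      fix i assume i: "i \<in> {..<d}"
      then have "g i \<in> ball (f i) \<epsilon> \<inter> \<Gamma>" using g[of i] E'(1) by auto
      then show "g i \<in> O' i" using \<delta>1(2)[OF \<epsilon>(1,2)] i by blast
    qed (simp add: g_def)
    ultimately show ?thesis using O'(3) by auto
  qed
  then show ?thesis
    using \<delta>1(1) \<delta>2(1) by (intro exI[of _ "min \<delta>1 \<delta>2"]) auto
qed

section \<open>Tropical linear combinations\<close>

definition tmin :: "('a \<Rightarrow> real) set \<Rightarrow> (('a \<Rightarrow> real) \<Rightarrow> real) \<Rightarrow> 'a \<Rightarrow> real" where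
  "tmin H a x = Min ((\<lambda>g. g x + a g) ` H)"

definition irredundant :: "'a set \<Rightarrow> ('a \<Rightarrow> real) set \<Rightarrow> (('a \<Rightarrow> real) \<Rightarrow> real) \<Rightarrow> bool" where
  "irredundant \<Gamma> H a \<longleftrightarrow> (\<forall>g\<in>H. \<exists>q\<in>\<Gamma>. \<forall>k\<in>H. k \<noteq> g \<longrightarrow> g q + a g < k q + a k)"

lemma minimizer_exists:
  fixes f :: "'b \<Rightarrow> real"
  assumes "finite H" "H \<noteq> {}"
  shows "\<exists>g\<in>H. \<forall>k\<in>H. f g \<le> f k"
  using arg_min_if_finite(1)[OF assms, of f] arg_min_least[OF assms, of _ f] by blast

lemma tmin_le: "finite H \<Longrightarrow> g \<in> H \<Longrightarrow> tmin H a x \<le> g x + a g"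
  unfolding tmin_def by (intro Min_le) auto

lemma tmin_attained:
  assumes "finite H" "H \<noteq> {}"
  obtains g where "g \<in> H" "tmin H a x = g x + a g"
proof -
  have "tmin H a x \<in> (\<lambda>g. g x + a g) ` H"
    unfolding tmin_def using assms by (intro Min_in) auto
  then show ?thesis using that by blast
qed

lemma tmin_ge: "finite H \<Longrightarrow> H \<noteq> {} \<Longrightarrow> (\<And>g. g \<in> H \<Longrightarrow> c \<le> g x + a g) \<Longrightarrow> c \<le> tmin H a x"
  by (metis tmin_attained)

lemma tmin_eqI:
  assumes "finite H" "g \<in> H" "\<And>k. k \<in> H \<Longrightarrow> g x + a g \<le> k x + a k"
  shows "tmin H a x = g x + a g"
  using assms by (intro antisym tmin_le tmin_ge) auto

lemma tmin_perturb:
  assumes "finite H" "H \<noteq> {}" "\<And>g. g \<in> H \<Longrightarrow> \<bar>a g - b g\<bar> \<le> c"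
  shows "\<bar>tmin H a x - tmin H b x\<bar> \<le> c"
proof -
  obtain g where g: "g \<in> H" "tmin H a x = g x + a g" using tmin_attained[OF assms(1,2)] by blast
  obtain k where k: "k \<in> H" "tmin H b x = k x + b k" using tmin_attained[OF assms(1,2)] by blast
  show ?thesis
    using tmin_le[OF assms(1) g(1), of b x] tmin_le[OF assms(1) k(1), of a x] g(2) k(2)
      assms(3)[OF g(1)] assms(3)[OF k(1)] by linarith
qed

text \<open>If \<open>b - a\<close> is minimal at \<open>g\<close>, then \<open>g\<close> is still the only minimizer for \<open>b\<close> at the point
  where it was the only minimizer for \<open>a\<close>.\<close>

lemma irredundant_independent:
  assumes "finite H" "H \<noteq> {}" "irredundant \<Gamma> H a"
  shows "\<not> tropically_dependent \<Gamma> H"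
proof
  assume "tropically_dependent \<Gamma> H"
  then obtain b where b: "\<And>x. x \<in> \<Gamma> \<Longrightarrow> 2 \<le> card {\<phi>\<in>H. \<phi> x + b \<phi> = Min ((\<lambda>\<psi>. \<psi> x + b \<psi>) ` H)}"
    unfolding tropically_dependent_def by blast
  obtain g where g: "g \<in> H" "\<And>k. k \<in> H \<Longrightarrow> b g - a g \<le> b k - a k"
    using minimizer_exists[OF assms(1,2), of "\<lambda>k. b k - a k"] by blast
  obtain q where q: "q \<in> \<Gamma>" "\<And>k. k \<in> H \<Longrightarrow> k \<noteq> g \<Longrightarrow> g q + a g < k q + a k"
    using assms(3) g(1) unfolding irredundant_def by blast
  have lt: "g q + b g < k q + b k" if "k \<in> H" "k \<noteq> g" for k
    using g(2)[OF that(1)] q(2)[OF that] by linarith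
  have "tmin H b q = g q + b g"
    using lt by (intro tmin_eqI assms(1) g(1)) force
  then have "{\<phi>\<in>H. \<phi> q + b \<phi> = Min ((\<lambda>\<psi>. \<psi> q + b \<psi>) ` H)} \<subseteq> {g}"
    using lt unfolding tmin_def by force
  then have "card {\<phi>\<in>H. \<phi> q + b \<phi> = Min ((\<lambda>\<psi>. \<psi> q + b \<psi>) ` H)} \<le> card {g}"
    by (intro card_mono) auto
  then show False using b[OF q(1)] by simp
qed

text \<open>Among the subsets with the same minimum one of least size is taken; a member that is
  nowhere the sole minimizer could still be removed. A point of \<open>\<Gamma>\<close> ensures that
  a single remaining term is never removable.\<close>

lemma irredundant_reduce:
  assumes "finite K" "K \<noteq> {}" "\<Gamma> \<noteq> {}"
  obtains H where "H \<subseteq> K" "H \<noteq> {}" "irredundant \<Gamma> H a" "\<And>x. x \<in> \<Gamma> \<Longrightarrow> tmin H a x = tmin K a x"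
proof -
  define P where "P H \<longleftrightarrow> H \<subseteq> K \<and> H \<noteq> {} \<and> (\<forall>x\<in>\<Gamma>. tmin H a x = tmin K a x)" for H
  have "P K" using assms(2) by (simp add: P_def)
  then obtain H where H: "P H" "\<And>H'. P H' \<Longrightarrow> card H \<le> card H'"
    using ex_has_least_nat[of P K card] by blast
  then have HK: "H \<subseteq> K" "H \<noteq> {}" "\<And>x. x \<in> \<Gamma> \<Longrightarrow> tmin H a x = tmin K a x" by (auto simp: P_def)
  have "finite H" using HK(1) assms(1) finite_subset by blast
  have "irredundant \<Gamma> H a"
  proof (rule ccontr)
    assume "\<not> ?thesis"
    then obtain g where g: "g \<in> H" "\<And>q. q \<in> \<Gamma> \<Longrightarrow> \<exists>k\<in>H. k \<noteq> g \<and> k q + a k \<le> g q + a g"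
      unfolding irredundant_def by (meson not_less)
    have ne: "H - {g} \<noteq> {}" using g(2) assms(3) by blast
    have "tmin (H - {g}) a x = tmin H a x" if x: "x \<in> \<Gamma>" for x
    proof (rule antisym)
      show "tmin H a x \<le> tmin (H - {g}) a x"
        using \<open>finite H\<close> ne by (intro tmin_ge) (auto intro: tmin_le)
      obtain k where k: "k \<in> H" "tmin H a x = k x + a k" using tmin_attained[OF \<open>finite H\<close> HK(2)] by blast
      show "tmin (H - {g}) a x \<le> tmin H a x"
      proof (cases "k = g")
        case False
        then show ?thesis using k tmin_le[of "H - {g}" k a x] \<open>finite H\<close> by simp
      next
        case True
        obtain k' where "k' \<in> H" "k' \<noteq> g" "k' x + a k' \<le> g x + a g" using g(2)[OF x] by blast
        then show ?thesis using True k(2) tmin_le[of "H - {g}" k' a x] \<open>finite H\<close> by simp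
      qed
    qed
    then have "P (H - {g})" using HK ne by (auto simp: P_def)
    moreover have "card (H - {g}) < card H" using \<open>finite H\<close> g(1) by (intro card_Diff1_less)
    ultimately show False using H(2) by fastforce
  qed
  then show ?thesis using that HK by blast
qed

text \<open>Exchanging \<open>f\<close> with the partner of \<open>g\<close> in an optimal assignment gives a second minimizer.\<close>

lemma tropical_cramer:
  fixes B :: "'f \<Rightarrow> 'g \<Rightarrow> real"
  assumes "finite F" "finite G" "card G < card F"
  obtains b :: "'f \<Rightarrow> real" where "\<And>g. g \<in> G \<Longrightarrow> \<exists>f1\<in>F. \<exists>f2\<in>F. f1 \<noteq> f2 \<and>
    (\<forall>f\<in>F. b f1 + B f1 g \<le> b f + B f g) \<and> (\<forall>f\<in>F. b f2 + B f2 g \<le> b f + B f g)"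
proof -
  define S where "S f = {\<sigma> \<in> G \<rightarrow>\<^sub>E (F - {f}). inj_on \<sigma> G}" for f
  define c where "c \<sigma> = (\<Sum>g\<in>G. B (\<sigma> g) g)" for \<sigma>
  \<comment> \<open>The least cost of an injective assignment of G that avoids f. For card F = card
    G + 1 these are the tropical maximal minors, which Cramer's rule takes as coefficients.\<close>
  define b where "b f = Min (c ` S f)" for f
  have fin: "finite (S f)" for f
    unfolding S_def using assms(1,2) by (intro finite_subset[OF _ finite_PiE[of G "\<lambda>_. F - {f}"]]) auto
  have ne: "S f \<noteq> {}" if "f \<in> F" for f
  proof -
    have "card G \<le> card (F - {f})" using assms that by simp
    then obtain \<sigma> where "\<sigma> ` G \<subseteq> F - {f}" "inj_on \<sigma> G"
      using card_le_inj[OF assms(2), of "F - {f}"] assms(1) by auto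
    then have "restrict \<sigma> G \<in> S f" by (auto simp: S_def inj_on_def)
    then show ?thesis by blast
  qed
  have b_le: "b f \<le> c \<sigma>" if "\<sigma> \<in> S f" for f \<sigma>
    unfolding b_def using fin that by (intro Min_le) auto
  have b_att: "\<exists>\<sigma>\<in>S f. b f = c \<sigma>" if "f \<in> F" for f
  proof -
    have "b f \<in> c ` S f" unfolding b_def using fin ne[OF that] by (intro Min_in) auto
    then show ?thesis by blast
  qed
  show ?thesis
  proof (rule that[of b])
    fix g assume g: "g \<in> G"
    have "F \<noteq> {}" using assms(3) by auto
    obtain f1 where f1: "f1 \<in> F" "\<And>f. f \<in> F \<Longrightarrow> b f1 + B f1 g \<le> b f + B f g"
      using minimizer_exists[OF assms(1) \<open>F \<noteq> {}\<close>, of "\<lambda>f. b f + B f g"] by blast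
    obtain \<sigma> where \<sigma>: "\<sigma> \<in> S f1" "b f1 = c \<sigma>" using b_att[OF f1(1)] by blast
    define f2 where "f2 = \<sigma> g"
    have f2: "f2 \<in> F" "f2 \<noteq> f1" using \<sigma>(1) g by (auto simp: S_def f2_def)
    have notin: "f1 \<notin> \<sigma> ` G" using \<sigma>(1) by (auto simp: S_def)
    have "\<sigma>(g := f1) \<in> S f2"
      using \<sigma>(1) g f1(1) f2 notin unfolding S_def f2_def
      by (auto simp: inj_on_def PiE_def Pi_def extensional_def)
    then have "b f2 \<le> c (\<sigma>(g := f1))" by (rule b_le)
    moreover have "c (\<sigma>(g := f1)) = (\<Sum>k\<in>G - {g}. B (\<sigma> k) k) + B f1 g"
      unfolding c_def using assms(2) g by (subst sum.remove[of G g]) (auto intro!: sum.cong)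
    moreover have "c \<sigma> = (\<Sum>k\<in>G - {g}. B (\<sigma> k) k) + B f2 g"
      unfolding c_def f2_def using assms(2) g by (subst sum.remove[of G g]) auto
    ultimately have "b f2 + B f2 g \<le> b f1 + B f1 g" using \<sigma>(2) by linarith
    then show "\<exists>f1\<in>F. \<exists>f2\<in>F. f1 \<noteq> f2 \<and>
      (\<forall>f\<in>F. b f1 + B f1 g \<le> b f + B f g) \<and> (\<forall>f\<in>F. b f2 + B f2 g \<le> b f + B f g)"
      using f1 f2 by (metis order_trans)
  qed
qed

text \<open>All members of F are written over G, and b comes from \<open>tropical_cramer\<close>. At
  x take the minimizing f and then the term g that attains f x: the two minimizers f1 and f2 in
  column g are at most that low at x, so both attain the minimum over F.\<close>

lemma span_dependent:
  assumes "finite F" "finite G" "G \<noteq> {}" "card G < card F"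
    and "\<And>f. f \<in> F \<Longrightarrow> \<exists>b. \<forall>x\<in>\<Gamma>. f x = tmin G b x"
  shows "tropically_dependent \<Gamma> F"
proof -
  have "\<forall>f\<in>F. \<exists>b. \<forall>x\<in>\<Gamma>. f x = tmin G b x" using assms(5) by (intro ballI)
  from bchoice[OF this] obtain B where "\<forall>f\<in>F. \<forall>x\<in>\<Gamma>. f x = tmin G (B f) x" ..
  then have B: "f x = tmin G (B f) x" if "f \<in> F" "x \<in> \<Gamma>" for f x
    using that by (elim ballE[of _ _ f] ballE[of _ _ x]) (assumption | (erule notE, assumption))+
  obtain b where b: "\<And>g. g \<in> G \<Longrightarrow> \<exists>f1\<in>F. \<exists>f2\<in>F. f1 \<noteq> f2 \<and>
    (\<forall>f\<in>F. b f1 + B f1 g \<le> b f + B f g) \<and> (\<forall>f\<in>F. b f2 + B f2 g \<le> b f + B f g)"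
    using tropical_cramer[OF assms(1,2,4), of B] by metis
  have "F \<noteq> {}" using assms(4) by auto
  show ?thesis
    unfolding tropically_dependent_def
  proof (intro exI[of _ b] ballI)
    fix x assume x: "x \<in> \<Gamma>"
    obtain f where f: "f \<in> F" "tmin F b x = f x + b f" using tmin_attained[OF assms(1) \<open>F \<noteq> {}\<close>] by blast
    obtain g where g: "g \<in> G" "tmin G (B f) x = g x + B f g" using tmin_attained[OF assms(2,3)] by blast
    obtain f1 f2 where ff: "f1 \<in> F" "f2 \<in> F" "f1 \<noteq> f2"
      "\<And>f. f \<in> F \<Longrightarrow> b f1 + B f1 g \<le> b f + B f g" "\<And>f. f \<in> F \<Longrightarrow> b f2 + B f2 g \<le> b f + B f g"
      using b[OF g(1)] by blast
    have "f' x + b f' = tmin F b x" if "f' \<in> F" "b f' + B f' g \<le> b f + B f g" for f'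
    proof -
      have "f' x \<le> g x + B f' g" unfolding B[OF that(1) x] by (rule tmin_le[OF assms(2) g(1)])
      then show ?thesis
        using that(2) f(2) g(2) B[OF f(1) x] tmin_le[OF assms(1) that(1), of b x] by linarith
    qed
    then have "{f1, f2} \<subseteq> {\<phi>\<in>F. \<phi> x + b \<phi> = Min ((\<lambda>\<psi>. \<psi> x + b \<psi>) ` F)}"
      using ff f(1) unfolding tmin_def by auto
    then have "card {f1, f2} \<le> card {\<phi>\<in>F. \<phi> x + b \<phi> = Min ((\<lambda>\<psi>. \<psi> x + b \<psi>) ` F)}"
      using assms(1) by (intro card_mono) auto
    then show "2 \<le> card {\<phi>\<in>F. \<phi> x + b \<phi> = Min ((\<lambda>\<psi>. \<psi> x + b \<psi>) ` F)}" using ff(3) by simp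
  qed
qed

text \<open>A generator that is left out has coefficient infinity. On a compact space \<phi> - g is
  bounded, so a large finite coefficient does as well, and every element becomes a minimum over all
  of G.\<close>

lemma tropical_span_full:
  fixes \<Gamma> :: "'a::metric_space set"
  assumes "compact \<Gamma>" "finite G" "\<And>g. g \<in> G \<Longrightarrow> continuous_on \<Gamma> g" "continuous_on \<Gamma> \<phi>" "\<phi> \<in> tropical_span \<Gamma> G"
  shows "\<exists>b. \<forall>x\<in>\<Gamma>. \<phi> x = tmin G b x"
proof -
  obtain H a where H: "H \<subseteq> G" "finite H" "H \<noteq> {}" "\<phi> = (\<lambda>x\<in>\<Gamma>. Min ((\<lambda>\<phi>. \<phi> x + a \<phi>) ` H))"
    using assms(5) unfolding tropical_span_def by blast
  have \<phi>: "\<phi> x = tmin H a x" if "x \<in> \<Gamma>" for x using that by (simp add: H(4) tmin_def)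
  have "\<exists>M. \<forall>x\<in>\<Gamma>. \<phi> x \<le> g x + M" if "g \<in> G" for g
  proof -
    have "continuous_on \<Gamma> (\<lambda>x. \<phi> x - g x)" using assms(3)[OF that] assms(4) by (intro continuous_intros)
    then have "bounded ((\<lambda>x. \<phi> x - g x) ` \<Gamma>)"
      using assms(1) by (intro compact_imp_bounded compact_continuous_image)
    then obtain M where "\<forall>y\<in>(\<lambda>x. \<phi> x - g x) ` \<Gamma>. norm y \<le> M" unfolding bounded_iff by blast
    then show ?thesis by (intro exI[of _ M]) force
  qed
  then obtain M where M: "\<And>g x. g \<in> G \<Longrightarrow> x \<in> \<Gamma> \<Longrightarrow> \<phi> x \<le> g x + M g" by metis
  define b where "b g = (if g \<in> H then a g else M g)" for g
  show ?thesis
  proof (intro exI[of _ b] ballI antisym)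
    fix x assume x: "x \<in> \<Gamma>"
    show "\<phi> x \<le> tmin G b x"
    proof (rule tmin_ge)
      fix g assume "g \<in> G"
      then show "\<phi> x \<le> g x + b g"
        using M[of g x] x tmin_le[OF H(2), of g a x] \<phi>[OF x] by (simp add: b_def)
    qed (use H assms(2) in auto)
    obtain g where g: "g \<in> H" "tmin H a x = g x + a g" using tmin_attained[OF H(2,3)] by blast
    show "tmin G b x \<le> \<phi> x"
      using tmin_le[OF assms(2), of g b x] g H(1) \<phi>[OF x] by (auto simp: b_def)
  qed
qed

section \<open>Breakpoints as affine functionals of the coefficients\<close>

lemma lookup_scaleR [simp]:
  fixes x :: "'b \<Rightarrow>\<^sub>0 real"
  shows "Poly_Mapping.lookup (r *\<^sub>R x) i = r * Poly_Mapping.lookup x i"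
proof -
  have "{i. r * Poly_Mapping.lookup x i \<noteq> 0} \<subseteq> Poly_Mapping.keys x" by (auto simp: in_keys_iff)
  then have "finite {i. r * Poly_Mapping.lookup x i \<noteq> 0}" by (rule finite_subset) simp
  then show ?thesis by (simp add: scaleR_poly_mapping_def)
qed

text \<open>If no set contains C, induction gives x in C outside all sets of \<open>\<A>\<close>,
  and there is y in C outside A. The segment from x to y meets each of the affine sets at most once,
  for otherwise that set contains the whole line; so finitely many sets cannot cover it.\<close>

lemma convex_subset_affine_cover:
  assumes "finite \<A>" "convex C" "C \<noteq> {}" "C \<subseteq> \<Union>\<A>" "\<And>A. A \<in> \<A> \<Longrightarrow> affine A"
  shows "\<exists>A\<in>\<A>. C \<subseteq> A"
  using assms
proof (induction \<A> rule: finite_induct)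
  case (insert A \<A>)
  show ?case
  proof (rule ccontr)
    assume no: "\<not> ?thesis"
    then have "\<not> C \<subseteq> \<Union>\<A>" using insert.IH insert.prems by auto
    then obtain x where x: "x \<in> C" "x \<notin> \<Union>\<A>" by blast
    obtain y where y: "y \<in> C" "y \<notin> A" using no by blast
    define p where "p s = (1 - s) *\<^sub>R x + s *\<^sub>R y" for s :: real
    have "{0<..<1} \<subseteq> (\<Union>B\<in>insert A \<A>. {s. p s \<in> B})"
    proof
      fix s :: real assume "s \<in> {0<..<1}"
      then have "p s \<in> C" using insert.prems(1) x y unfolding p_def convex_alt by auto
      then show "s \<in> (\<Union>B\<in>insert A \<A>. {s. p s \<in> B})" using insert.prems(3) by blast
    qed
    moreover have "finite {s. p s \<in> B}" if B: "B \<in> insert A \<A>" for B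
    proof -
      have "s = s'" if s: "p s \<in> B" "p s' \<in> B" for s s'
      proof (rule ccontr)
        assume ne: "s \<noteq> s'"
        have line: "p u \<in> B" for u
        proof -
          define v where "v = (u - s) / (s' - s)"
          have v: "v * (s' - s) = u - s" using ne by (simp add: v_def)
          have "(1 - v) *\<^sub>R p s + v *\<^sub>R p s' \<in> B"
            using insert.prems(4)[OF B] s unfolding affine_alt by blast
          moreover have "(1 - v) *\<^sub>R p s + v *\<^sub>R p s' = (1 - (s + v * (s' - s))) *\<^sub>R x + (s + v * (s' - s)) *\<^sub>R y"
            by (simp add: p_def algebra_simps)
          ultimately show ?thesis by (simp add: v p_def)
        qed
        have "x \<in> B" "y \<in> B" using line[of 0] line[of 1] by (simp_all add: p_def)
        then show False using B x y by auto
      qed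
      then have "{s. p s \<in> B} \<subseteq> {SOME s. p s \<in> B}" by (metis (mono_tags, lifting) mem_Collect_eq singletonI someI_ex subsetI)
      then show ?thesis by (rule finite_subset) simp
    qed
    ultimately have "finite {0<..<1::real}"
      using insert.hyps(1) by (meson finite.insertI finite_UN_I finite_subset)
    then show False by (simp add: infinite_Ioo)
  qed
qed auto

text \<open>The zero lies between z, possibly at z, and s, but not at s. Since z is interior, the
  zero is interior too, even when s is an end.\<close>

lemma affine_sign_change:
  fixes A B :: real
  assumes "A * z + B \<ge> 0" "A * s + B < 0" "x < z" "z < y" "x \<le> s" "s \<le> y"
  shows "A \<noteq> 0" "x < - B / A" "- B / A < y"
proof -
  show "A \<noteq> 0" using assms by auto
  then consider "A > 0" | "A < 0" by linarith
  then have "x < - B / A \<and> - B / A < y"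
  proof cases
    case 1
    then have "s < - B / A" "- B / A \<le> z" using assms by (simp_all add: field_simps)
    then show ?thesis using assms by linarith
  next
    case 2
    then have "- B / A < s" "z \<le> - B / A" using assms by (simp_all add: field_simps)
    then show ?thesis using assms by linarith
  qed
  then show "x < - B / A" "- B / A < y" by auto
qed

text \<open>Kept as a tuple rather than as a function of the coefficients, because the factor and
  the two indices are read off later. \<open>val\<close> sees only a difference of coefficients, as
  a common shift leaves the divisor unchanged.\<close>

type_synonym 'a functional = "real \<times> real \<times> ('a \<Rightarrow> real) \<times> ('a \<Rightarrow> real)"

definition val :: "'a functional \<Rightarrow> (('a \<Rightarrow> real) \<Rightarrow> real) \<Rightarrow> real" where
  "val = (\<lambda>(c, q, i, k) a. c + q * (a i - a k))"

definition tcomb :: "'a set \<Rightarrow> ('a \<Rightarrow> real) set \<Rightarrow> (('a \<Rightarrow> real) \<Rightarrow> real) \<Rightarrow> 'a \<Rightarrow> real" where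
  "tcomb \<Gamma> H a = (\<lambda>x\<in>\<Gamma>. tmin H a x)"

context graph_model
begin

text \<open>The line is read off at t, the last point of T up to x, instead of at x itself. So g has
  only finitely many lines on e, indexed by T.\<close>

lemma gap_line:
  assumes "paffine g e T" "finite T" "0 \<in> T" "0 \<le> x" "x < y" "y \<le> fst e" "{x<..<y} \<inter> T = {}"
  defines "t \<equiv> Max {s \<in> T. s \<le> x}"
  shows "t \<in> T" "s \<in> {x..y} \<Longrightarrow>
    g (snd e s) = of_int (dslope g (e, t, 1)) * s + (g (snd e t) - of_int (dslope g (e, t, 1)) * t)"
proof -
  have "t \<in> {s \<in> T. s \<le> x}"
    unfolding t_def using assms(2-4) by (intro Max_in) auto
  then show "t \<in> T" by simp
  have tx: "t \<le> x" using \<open>t \<in> {s \<in> T. s \<le> x}\<close> by simp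
  have t0: "0 \<le> t" unfolding t_def using assms(2-4) by (intro Max_ge) auto
  have "{t<..<y} \<inter> T = {}"
  proof (rule equals0I)
    fix r assume r: "r \<in> {t<..<y} \<inter> T"
    have "x < r"
    proof (rule ccontr)
      assume "\<not> x < r"
      then have "r \<le> t" unfolding t_def using r assms(2) by (intro Max_ge) auto
      then show False using r by simp
    qed
    then show False using r assms(7) by auto
  qed
  then obtain m :: int and c where m: "\<And>s. s \<in> {t..y} \<Longrightarrow> g (snd e s) = of_int m * s + c"
    using paffine_gap[OF assms(1) t0 _ assms(6)] tx assms(5) by (metis le_less_trans)
  have d: "dslope g (e, t, 1) = m"
    by (rule dslope_affine(1)[of t y]) (use t0 tx assms m in auto)
  show "g (snd e s) = of_int (dslope g (e, t, 1)) * s + (g (snd e t) - of_int (dslope g (e, t, 1)) * t)"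
    if "s \<in> {x..y}"
  proof -
    have "g (snd e s) = of_int m * s + c" "g (snd e t) = of_int m * t + c"
      using that tx assms(5) by (auto intro!: m)
    then show ?thesis by (simp add: d)
  qed
qed

text \<open>Between common breaks of the generators all terms are lines, so the minimum breaks only
  at those breaks or where two lines cross. The crossing of the terms i and k is an intercept
  difference divided by a slope difference, hence affine in a k - a i. Thus one finite set
  \<open>Fn e\<close> serves all coefficients. Points of Z are taken in as constant
  functionals.\<close>

lemma break_functionals:
  assumes H: "finite H" "H \<noteq> {}" "\<And>g. g \<in> H \<Longrightarrow> epl g" and Z: "\<And>e. e \<in> \<E> \<Longrightarrow> finite (Z e)"
  obtains Fn :: "'a edge \<Rightarrow> 'a functional set" where
    "\<And>e. e \<in> \<E> \<Longrightarrow> finite (Fn e) \<and> Fn e \<subseteq> UNIV \<times> UNIV \<times> H \<times> H"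
    "\<And>e a. e \<in> \<E> \<Longrightarrow> paffine (tcomb \<Gamma> H a) e ((\<lambda>f. val f a) ` Fn e)"
    "\<And>e z. e \<in> \<E> \<Longrightarrow> z \<in> Z e \<Longrightarrow> \<exists>f\<in>Fn e. \<forall>a. val f a = z"
proof -
  obtain i0 where i0: "i0 \<in> H" using H(2) by blast
  have "\<exists>T. finite T \<and> insert 0 (Z e) \<subseteq> T \<and> (\<forall>g\<in>H. paffine g e T)" if e: "e \<in> \<E>" for e
  proof -
    have "\<forall>g\<in>H. \<exists>T. finite T \<and> paffine g e T" using H(3) e by (auto simp: epl_def)
    from bchoice[OF this] obtain B where B: "\<And>g. g \<in> H \<Longrightarrow> finite (B g) \<and> paffine g e (B g)" by blast
    show ?thesis
    proof (intro exI[of _ "insert 0 (Z e) \<union> \<Union>(B ` H)"] conjI ballI)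
      fix g assume g: "g \<in> H"
      show "paffine g e (insert 0 (Z e) \<union> \<Union>(B ` H))"
        by (rule paffine_mono[OF conjunct2[OF B[OF g]]]) (use g in blast)
    next
      have "finite (\<Union>(B ` H))" using H(1) conjunct1[OF B] by (rule finite_UN_I)
      then show "finite (insert 0 (Z e) \<union> \<Union>(B ` H))" using Z[OF e] by simp
    qed blast
  qed
  then have "\<forall>e\<in>\<E>. \<exists>T. finite T \<and> insert 0 (Z e) \<subseteq> T \<and> (\<forall>g\<in>H. paffine g e T)" by blast
  from bchoice[OF this] obtain T where
    T: "\<And>e. e \<in> \<E> \<Longrightarrow> finite (T e) \<and> insert 0 (Z e) \<subseteq> T e \<and> (\<forall>g\<in>H. paffine g e (T e))" by blast
  define m :: "('a \<Rightarrow> real) \<Rightarrow> 'a edge \<Rightarrow> real \<Rightarrow> real" where "m g e t = of_int (dslope g (e, t, 1))" for g e t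
  define c where "c g e t = g (snd e t) - m g e t * t" for g e t
  (* Equal slopes give junk functionals, as x / 0 = 0; superfluous breakpoints do no harm. *)
  define X where "X e = (\<lambda>(t, i, k). ((c k e t - c i e t) / (m i e t - m k e t), 1 / (m i e t - m k e t), k, i)) ` (T e \<times> H \<times> H)" for e
  define Fn where "Fn e = (\<lambda>z. (z, 0, i0, i0)) ` T e \<union> X e" for e
  show ?thesis
  proof (rule that[of Fn])
    show "finite (Fn e) \<and> Fn e \<subseteq> UNIV \<times> UNIV \<times> H \<times> H" if "e \<in> \<E>" for e
      using T[OF that] H(1) i0 by (auto simp: Fn_def X_def)
    have const: "z \<in> (\<lambda>f. val f a) ` Fn e" if "z \<in> T e" for z e a
      using that by (force simp: Fn_def val_def)
    show "\<exists>f\<in>Fn e. \<forall>a. val f a = z" if "e \<in> \<E>" "z \<in> Z e" for e z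
      using T[OF that(1)] that(2) by (intro bexI[of _ "(z, 0, i0, i0)"]) (auto simp: Fn_def val_def)
    show "paffine (tcomb \<Gamma> H a) e ((\<lambda>f. val f a) ` Fn e)" if e: "e \<in> \<E>" for e a
      unfolding paffine_def
    proof (intro allI impI)
      fix x y assume xy: "0 \<le> x \<and> x < y \<and> y \<le> fst e \<and> {x<..<y} \<inter> (\<lambda>f. val f a) ` Fn e = {}"
      have gap: "{x<..<y} \<inter> T e = {}" using const[of _ e a] xy by blast
      define t where "t = Max {s \<in> T e. s \<le> x}"
      have line: "t \<in> T e" "g (snd e s) = m g e t * s + c g e t" if "g \<in> H" "s \<in> {x..y}" for g s
        unfolding m_def c_def t_def using T[OF e] that xy gap
        by (intro gap_line[where y = y]; auto)+
      \<comment> \<open>A term that is minimal at an interior point z stays minimal on the whole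
        gap: if another one were lower somewhere, the two would cross strictly inside, at the value
        of a functional in \<open>Fn e\<close>.\<close>
      define z where "z = (x + y) / 2"
      have z: "x < z" "z < y" using xy by (auto simp: z_def)
      obtain g where g: "g \<in> H" "\<forall>k\<in>H. m g e t * z + c g e t + a g \<le> m k e t * z + c k e t + a k"
        using minimizer_exists[OF H(1,2), of "\<lambda>k. m k e t * z + c k e t + a k"] by blast
      have low: "m g e t * s + c g e t + a g \<le> m k e t * s + c k e t + a k" if k: "k \<in> H" and s: "s \<in> {x..y}" for k s
      proof (rule ccontr)
        assume neg: "\<not> ?thesis"
        define A where "A = m k e t - m g e t"
        define B where "B = c k e t + a k - c g e t - a g"
        have "A * z + B \<ge> 0" using bspec[OF g(2) k] by (simp add: A_def B_def algebra_simps)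
        moreover have "A * s + B < 0" using neg by (simp add: A_def B_def algebra_simps)
        ultimately have r: "A \<noteq> 0" "x < - B / A" "- B / A < y"
          using affine_sign_change[of A z B s x y] z s by auto
        let ?f = "((c k e t - c g e t) / (m g e t - m k e t), 1 / (m g e t - m k e t), k, g)"
        have f: "?f \<in> X e" unfolding X_def using line(1)[OF g(1) s] g(1) k by (intro image_eqI[of _ _ "(t, g, k)"]) auto
        have "- B / A = val ?f a"
        proof -
          have "val ?f a = (c k e t - c g e t + (a k - a g)) / (m g e t - m k e t)"
            by (simp add: val_def add_divide_distrib)
          also have "\<dots> = B / - A" by (simp add: A_def B_def algebra_simps)
          finally show ?thesis by simp
        qed
        moreover have "?f \<in> Fn e" unfolding Fn_def using f by (rule UnI2)
        ultimately have "- B / A \<in> (\<lambda>f. val f a) ` Fn e" by (rule image_eqI)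
        then show False using r xy by auto
      qed
      show "\<exists>(m::int) c. \<forall>s\<in>{x..y}. tcomb \<Gamma> H a (snd e s) = of_int m * s + c"
      proof (intro exI ballI)
        fix s assume s: "s \<in> {x..y}"
        have "snd e s \<in> \<Gamma>" using edge_in[OF e] s xy by auto
        then have "tcomb \<Gamma> H a (snd e s) = tmin H a (snd e s)" by (simp add: tcomb_def)
        also have "\<dots> = g (snd e s) + a g"
        proof (rule tmin_eqI[OF H(1) g(1)])
          fix k assume k: "k \<in> H"
          show "g (snd e s) + a g \<le> k (snd e s) + a k"
            unfolding line(2)[OF g(1) s] line(2)[OF k s] by (rule low[OF k s])
        qed
        also have "\<dots> = of_int (dslope g (e, t, 1)) * s + (c g e t + a g)"
          unfolding line(2)[OF g(1) s] by (simp add: m_def)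
        finally show "tcomb \<Gamma> H a (snd e s) = of_int (dslope g (e, t, 1)) * s + (c g e t + a g)" .
      qed
    qed
  qed
qed

section \<open>The upper bound for simplices of divisors\<close>

lemma support_in_breaks:
  assumes "epl \<theta>" "e \<in> \<E>" "0 < t" "t < fst e" "finite T" "paffine \<theta> e T"
    and "Poly_Mapping.lookup (D + pl_div \<Gamma> \<theta>) (snd e t) \<noteq> 0"
  shows "snd e t \<in> Poly_Mapping.keys D \<or> t \<in> T"
  using no_bend[OF assms(2-5) _ assms(6)] assms(7)
  by (cases "t \<in> T") (auto simp: lookup_add lookup_pl_div[OF assms(1)] in_keys_iff)

lemma finite_edge_preimage:
  assumes "e \<in> \<E>" "finite K"
  shows "finite {t \<in> {0..fst e}. snd e t \<in> K}"
proof -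
  have "finite (snd e -` K \<inter> {0..fst e})"
    using assms edge_inj by (intro finite_vimage_IntI)
  then show ?thesis by (rule rev_finite_subset) auto
qed

lemma finite_face_index: "finite (face_index \<E> \<mu>)"
proof -
  have "face_index \<E> \<mu> = Sigma \<E> (\<lambda>e. {..<length (\<mu> e)})" by (auto simp: face_index_def)
  then show ?thesis using finite_E by simp
qed

lemma face_point_pos:
  assumes "(e, j) \<in> face_index \<E> \<mu>" "0 \<notin> set (\<mu> e)"
  shows "Poly_Mapping.lookup (face_point V \<E> m \<mu> x) (snd e (Poly_Mapping.lookup x (e, j))) > 0"
proof -
  let ?p = "snd e (Poly_Mapping.lookup x (e, j))"
  let ?F = "\<lambda>(e, j). Poly_Mapping.lookup (Poly_Mapping.single (snd e (Poly_Mapping.lookup x (e, j))) (int (\<mu> e ! j))) ?p"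
  have "\<mu> e ! j \<in> set (\<mu> e)" using assms(1) by (auto simp: face_index_def)
  then have "?F (e, j) > 0" using assms(2) by (simp) (metis gr0I)
  also have "?F (e, j) \<le> sum ?F (face_index \<E> \<mu>)"
    by (rule member_le_sum[OF assms(1) _ finite_face_index]) (simp add: case_prod_beta lookup_single when_def)
  also have "\<dots> \<le> Poly_Mapping.lookup (face_point V \<E> m \<mu> x) ?p"
    by (simp add: face_point_def lookup_add lookup_sum case_prod_beta lookup_single when_def sum_nonneg)
  finally show ?thesis .
qed

text \<open>The order and range conditions of a face are dropped on purpose: what remains, for a
  fixed choice L of functionals, is the image of an affine map of the coefficients.\<close>

definition cell :: "('a edge \<times> nat) set \<Rightarrow> ('a edge \<times> nat \<Rightarrow> 'a functional) \<Rightarrow> ('a edge \<times> nat \<Rightarrow>\<^sub>0 real) set" where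
  "cell I L = {x. Poly_Mapping.keys x \<subseteq> I \<and> (\<exists>a. \<forall>i\<in>I. Poly_Mapping.lookup x i = val (L i) a)}"

lemma val_affine:
  "u + v = 1 \<Longrightarrow> val f (\<lambda>g. u * a g + v * b g) = u * val f a + v * val f b"
proof -
  assume "u + v = 1"
  obtain c q i k where f: "f = (c, q, i, k)" by (cases f)
  have "c = u * c + v * c" using \<open>u + v = 1\<close> by (metis distrib_right mult_1)
  then show ?thesis by (simp add: f val_def algebra_simps)
qed

lemma affine_cell: "affine (cell I L)"
  unfolding affine_def
proof (intro ballI allI impI)
  fix x y :: "'a edge \<times> nat \<Rightarrow>\<^sub>0 real" and u v :: real
  assume xy: "x \<in> cell I L" "y \<in> cell I L" and uv: "u + v = 1"
  obtain a where a: "\<And>i. i \<in> I \<Longrightarrow> Poly_Mapping.lookup x i = val (L i) a" using xy(1) by (auto simp: cell_def)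
  obtain b where b: "\<And>i. i \<in> I \<Longrightarrow> Poly_Mapping.lookup y i = val (L i) b" using xy(2) by (auto simp: cell_def)
  have "Poly_Mapping.keys (u *\<^sub>R x + v *\<^sub>R y) \<subseteq> I"
  proof
    fix i assume i: "i \<in> Poly_Mapping.keys (u *\<^sub>R x + v *\<^sub>R y)"
    have "i \<in> Poly_Mapping.keys x \<or> i \<in> Poly_Mapping.keys y"
    proof (rule ccontr)
      assume "\<not> ?thesis"
      then have "Poly_Mapping.lookup x i = 0" "Poly_Mapping.lookup y i = 0" by (simp_all add: in_keys_iff)
      then have "Poly_Mapping.lookup (u *\<^sub>R x + v *\<^sub>R y) i = 0" by (simp add: lookup_add)
      then show False using i by (simp add: in_keys_iff)
    qed
    moreover have "Poly_Mapping.keys x \<subseteq> I" "Poly_Mapping.keys y \<subseteq> I" using xy by (simp_all add: cell_def)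
    ultimately show "i \<in> I" by blast
  qed
  moreover have "\<forall>i\<in>I. Poly_Mapping.lookup (u *\<^sub>R x + v *\<^sub>R y) i = val (L i) (\<lambda>g. u * a g + v * b g)"
    by (simp add: lookup_add val_affine[OF uv] a b)
  ultimately show "u *\<^sub>R x + v *\<^sub>R y \<in> cell I L" unfolding cell_def by blast
qed

text \<open>The directions of the cell are spanned by the effects of single coefficients, and by
  shift invariance the coefficient of h0 may be held fixed. So the dimension is at most card H - 1,
  and affinely independent points are one more.\<close>

lemma cell_dimension:
  assumes "finite I" "finite H" "H \<noteq> {}" "\<And>i. i \<in> I \<Longrightarrow> L i \<in> UNIV \<times> UNIV \<times> H \<times> H"
    and W: "W \<subseteq> cell I L" "\<not> affine_dependent W" "finite W" "W \<noteq> {}"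
  shows "card W \<le> card H"
proof -
  obtain w0 where w0: "w0 \<in> W" using W(4) by blast
  obtain h0 where h0: "h0 \<in> H" using assms(3) by blast
  \<comment> \<open>The factor of a g in \<open>val (L i) a\<close>.\<close>
  define \<omega> where "\<omega> g i = fst (snd (L i)) * ((if fst (snd (snd (L i))) = g then 1 else 0) - (if snd (snd (snd (L i))) = g then 1 else 0))" for g i
  define v where "v g = (\<Sum>i\<in>I. Poly_Mapping.single i (\<omega> g i))" for g
  have lv: "Poly_Mapping.lookup (v g) i = (if i \<in> I then \<omega> g i else 0)" for g i
  proof -
    have "Poly_Mapping.lookup (v g) i = (\<Sum>j\<in>I. if j = i then \<omega> g j else 0)"
      unfolding v_def lookup_sum by (intro sum.cong) (auto simp: lookup_single when_def)
    then show ?thesis using assms(1) by (simp add: sum.delta)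
  qed
  let ?B = "(\<lambda>x. - w0 + x) ` (W - {w0})"
  have "independent ?B"
    using W(2) affine_dependent_iff_dependent2[OF w0] by blast
  moreover have "?B \<subseteq> span (v ` (H - {h0}))"
  proof
    fix z assume "z \<in> ?B"
    then obtain x where x: "x \<in> W" "z = x - w0" by auto
    obtain a where a: "\<And>i. i \<in> I \<Longrightarrow> Poly_Mapping.lookup x i = val (L i) a" "Poly_Mapping.keys x \<subseteq> I"
      using x(1) W(1) by (auto simp: cell_def)
    obtain b where b: "\<And>i. i \<in> I \<Longrightarrow> Poly_Mapping.lookup w0 i = val (L i) b" "Poly_Mapping.keys w0 \<subseteq> I"
      using w0 W(1) by (auto simp: cell_def)
    \<comment> \<open>Normalized to vanish at h0; the differences between two values of d are those
      of a - b.\<close>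
    define d where "d g = (a g - b g) - (a h0 - b h0)" for g
    have z: "z = (\<Sum>g\<in>H - {h0}. d g *\<^sub>R v g)"
    proof (rule poly_mapping_eqI)
      fix i
      show "Poly_Mapping.lookup z i = Poly_Mapping.lookup (\<Sum>g\<in>H - {h0}. d g *\<^sub>R v g) i"
      proof (cases "i \<in> I")
        case False
        then have "i \<notin> Poly_Mapping.keys x" "i \<notin> Poly_Mapping.keys w0" using a(2) b(2) by auto
        then show ?thesis using False by (simp add: x(2) lookup_minus lookup_sum lv in_keys_iff)
      next
        case True
        obtain c q j k where L: "L i = (c, q, j, k)" "j \<in> H" "k \<in> H" using assms(4)[OF True] by auto
        have "Poly_Mapping.lookup z i = q * (d j - d k)"
          using True by (simp add: x(2) lookup_minus a(1) b(1) L val_def d_def algebra_simps)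
        also have "\<dots> = (\<Sum>g\<in>H. d g * \<omega> g i)"
        proof -
          have "(\<Sum>g\<in>H. d g * \<omega> g i) = (\<Sum>g\<in>H. (if g = j then q * d g else 0) - (if g = k then q * d g else 0))"
            by (intro sum.cong) (auto simp: \<omega>_def L)
          then show ?thesis using L assms(2) by (simp add: sum_subtractf sum.delta right_diff_distrib)
        qed
        also have "\<dots> = (\<Sum>g\<in>H - {h0}. d g * \<omega> g i)"
          using assms(2) by (intro sum.mono_neutral_right) (auto simp: d_def)
        finally show ?thesis using True by (simp add: lookup_sum lv)
      qed
    qed
    show "z \<in> span (v ` (H - {h0}))"
      unfolding z by (intro span_sum span_scale span_base imageI)
  qed
  ultimately have "card ?B \<le> card (v ` (H - {h0}))"
    using independent_span_bound[of "v ` (H - {h0})" ?B] assms(2) by blast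
  also have "\<dots> \<le> card (H - {h0})" using assms(2) by (intro card_image_le) auto
  finally have "card (W - {w0}) \<le> card (H - {h0})"
    by (simp add: card_image)
  moreover have "card W > 0" "card H > 0" using W(3,4) assms(2,3) by (simp_all add: card_gt_0_iff)
  ultimately show ?thesis using w0 h0 by simp
qed

text \<open>Every coordinate of a point of the simplex is the position of a support point, hence a
  break or a position of D, hence the value of one of finitely many functionals. The choices of H
  and of one functional for each coordinate give finitely many affine cells that cover the simplex,
  so one cell contains it.\<close>

lemma simplex_bound:
  assumes fin: "finite \<H>" and \<H>: "\<And>H. H \<in> \<H> \<Longrightarrow> finite H \<and> H \<noteq> {} \<and> card H \<le> N \<and> (\<forall>g\<in>H. epl g)"
    and S: "\<And>E'. E' \<in> S \<Longrightarrow> \<exists>H\<in>\<H>. \<exists>a. E' = D + pl_div \<Gamma> (tcomb \<Gamma> H a)"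
    and \<mu>: "\<forall>e\<in>\<E>. 0 \<notin> set (\<mu> e)"
    and W: "finite W" "W \<noteq> {}" "\<not> affine_dependent W" "convex hull W \<subseteq> face_coords \<E> \<mu>"
      "face_point V \<E> m \<mu> ` (convex hull W) \<subseteq> S"
  shows "card W \<le> N"
proof -
  define Z :: "'a edge \<Rightarrow> real set" where "Z e = {t \<in> {0..fst e}. snd e t \<in> Poly_Mapping.keys D}" for e
  have Z: "finite (Z e)" if "e \<in> \<E>" for e
    unfolding Z_def by (rule finite_edge_preimage[OF that]) simp
  define I where "I = face_index \<E> \<mu>"
  have "finite I" unfolding I_def by (rule finite_face_index)
  define good where "good H Fn \<longleftrightarrow> (\<forall>e\<in>\<E>. finite (Fn e) \<and> Fn e \<subseteq> UNIV \<times> UNIV \<times> H \<times> H) \<and>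
    (\<forall>e\<in>\<E>. \<forall>a. paffine (tcomb \<Gamma> H a) e ((\<lambda>f. val f a) ` Fn e)) \<and>
    (\<forall>e\<in>\<E>. \<forall>z\<in>Z e. \<exists>f\<in>Fn e. \<forall>a. val f a = z)" for H Fn
  have "\<exists>Fn. good H Fn" if "H \<in> \<H>" for H
  proof -
    have "finite H" "H \<noteq> {}" "\<And>g. g \<in> H \<Longrightarrow> epl g" using \<H>[OF that] by auto
    from break_functionals[where Z = Z, OF this Z] show ?thesis unfolding good_def by metis
  qed
  then have "\<forall>H\<in>\<H>. \<exists>Fn. good H Fn" by blast
  from bchoice[OF this] obtain Fn where Fn: "\<And>H. H \<in> \<H> \<Longrightarrow> good H (Fn H)" by blast
  define \<L> where "\<L> H = (\<Pi>\<^sub>E i\<in>I. Fn H (fst i))" for H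
  have I_E: "fst i \<in> \<E>" if "i \<in> I" for i using that by (auto simp: I_def face_index_def)
  have fin\<L>: "finite (\<L> H)" if "H \<in> \<H>" for H
    unfolding \<L>_def using Fn[OF that] I_E \<open>finite I\<close> by (intro finite_PiE) (auto simp: good_def)
  have "convex hull W \<subseteq> \<Union>((\<lambda>(H, L). cell I L) ` Sigma \<H> \<L>)"
  proof
    fix x assume x: "x \<in> convex hull W"
    then have xc: "x \<in> face_coords \<E> \<mu>" "face_point V \<E> m \<mu> x \<in> S" using W by auto
    obtain H a where H: "H \<in> \<H>" "face_point V \<E> m \<mu> x = D + pl_div \<Gamma> (tcomb \<Gamma> H a)" using S[OF xc(2)] by blast
    have "\<exists>f\<in>Fn H (fst i). Poly_Mapping.lookup x i = val f a" if i: "i \<in> I" for i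
    proof -
      obtain e j where ij: "i = (e, j)" "e \<in> \<E>" "j < length (\<mu> e)" using i by (auto simp: I_def face_index_def)
      let ?t = "Poly_Mapping.lookup x i"
      have t: "0 < ?t" "?t < fst e" using xc(1) ij by (auto simp: face_coords_def)
      have "Poly_Mapping.lookup (D + pl_div \<Gamma> (tcomb \<Gamma> H a)) (snd e ?t) \<noteq> 0"
        using face_point_pos[of e j \<mu> m x] i \<mu> ij by (auto simp: I_def H(2))
      moreover have "epl (tcomb \<Gamma> H a)"
        unfolding epl_def using Fn[OF H(1)] unfolding good_def by blast
      ultimately have "snd e ?t \<in> Poly_Mapping.keys D \<or> ?t \<in> (\<lambda>f. val f a) ` Fn H e"
        using Fn[OF H(1)] ij(2) t unfolding good_def by (intro support_in_breaks[of "tcomb \<Gamma> H a"]) auto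
      then show ?thesis
      proof
        assume "snd e ?t \<in> Poly_Mapping.keys D"
        then have "?t \<in> Z e" using t by (simp add: Z_def)
        then obtain f where "f \<in> Fn H e" "\<forall>a. val f a = ?t"
          using Fn[OF H(1)] ij(2) unfolding good_def by blast
        then show ?thesis using ij(1) by (intro bexI[of _ f]) simp_all
      qed (use ij(1) in auto)
    qed
    then have "\<forall>i\<in>I. \<exists>f. f \<in> Fn H (fst i) \<and> Poly_Mapping.lookup x i = val f a" by blast
    from bchoice[OF this] obtain L where L: "\<And>i. i \<in> I \<Longrightarrow> L i \<in> Fn H (fst i) \<and> Poly_Mapping.lookup x i = val (L i) a" by blast
    have "x \<in> cell I (restrict L I)"
      using xc(1) L unfolding cell_def face_coords_def I_def by auto
    moreover have "restrict L I \<in> \<L> H" using L by (auto simp: \<L>_def)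
    ultimately show "x \<in> \<Union>((\<lambda>(H, L). cell I L) ` Sigma \<H> \<L>)" using H(1) by force
  qed
  moreover have "finite ((\<lambda>(H, L). cell I L) ` Sigma \<H> \<L>)" using fin fin\<L> by simp
  moreover have "affine A" if "A \<in> (\<lambda>(H, L). cell I L) ` Sigma \<H> \<L>" for A
    using that affine_cell by auto
  ultimately obtain A where A: "A \<in> (\<lambda>(H, L). cell I L) ` Sigma \<H> \<L>" "convex hull W \<subseteq> A"
    using convex_subset_affine_cover[of "(\<lambda>(H, L). cell I L) ` Sigma \<H> \<L>" "convex hull W"] W(2)
    by (metis convex_convex_hull convex_hull_eq_empty)
  then obtain H L where HL: "H \<in> \<H>" "L \<in> \<L> H" "convex hull W \<subseteq> cell I L" by auto
  have "card W \<le> card H"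
  proof (rule cell_dimension[OF \<open>finite I\<close>])
    show "L i \<in> UNIV \<times> UNIV \<times> H \<times> H" if "i \<in> I" for i
      using HL(2) Fn[OF HL(1)] I_E[OF that] that unfolding \<L>_def good_def by (blast dest: PiE_mem)
    show "W \<subseteq> cell I L" by (rule order_trans[OF hull_subset HL(3)])
  qed (use \<H>[OF HL(1)] W(1-3) in simp_all)
  then show ?thesis using \<H>[OF HL(1)] by simp
qed

end

section \<open>Finitely generated tropical modules\<close>

lemma divisor_degree_superset:
  assumes "finite K" "Poly_Mapping.keys F \<subseteq> K"
  shows "divisor_degree F = (\<Sum>x\<in>K. Poly_Mapping.lookup F x)"
  unfolding divisor_degree_def using assms by (intro sum.mono_neutral_left) (auto simp: in_keys_iff)

lemma divisor_degree_add: "divisor_degree (F + F') = divisor_degree F + divisor_degree F'"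
proof -
  let ?K = "Poly_Mapping.keys F \<union> Poly_Mapping.keys F'"
  have "divisor_degree (F + F') = (\<Sum>x\<in>?K. Poly_Mapping.lookup (F + F') x)"
    using Poly_Mapping.keys_add[of F F'] by (intro divisor_degree_superset) auto
  also have "\<dots> = (\<Sum>x\<in>?K. Poly_Mapping.lookup F x) + (\<Sum>x\<in>?K. Poly_Mapping.lookup F' x)"
    by (simp add: lookup_add sum.distrib)
  also have "\<dots> = divisor_degree F + divisor_degree F'"
    by (simp add: divisor_degree_superset[of ?K])
  finally show ?thesis .
qed

lemma divisor_degree_single: "divisor_degree (Poly_Mapping.single p n) = n"
  by (simp add: divisor_degree_def)

lemma divisor_degree_sum: "divisor_degree (\<Sum>i\<in>I. F i) = (\<Sum>i\<in>I. divisor_degree (F i))"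
  by (induction I rule: infinite_finite_induct) (simp_all add: divisor_degree_add, simp_all add: divisor_degree_def)

text \<open>\<open>nontrivial\<close> serves to make nonempty open sets infinite, so that they
  contain points off any finite set of exceptions.\<close>

locale generated_series = graph_model +
  fixes D :: "'a \<Rightarrow>\<^sub>0 int" and \<Sigma> G :: "('a \<Rightarrow> real) set"
  assumes compact: "compact \<Gamma>" and connected: "connected \<Gamma>"
    and nontrivial: "\<exists>x\<in>\<Gamma>. \<exists>y\<in>\<Gamma>. x \<noteq> y"
    and D_on: "divisor_on \<Gamma> D"
    and \<Sigma>_R: "\<Sigma> \<subseteq> R \<Gamma> D"
    and G: "finite G" "G \<subseteq> \<Sigma>" "\<Sigma> = tropical_span \<Gamma> G"
begin

lemma \<Gamma>_ne: "\<Gamma> \<noteq> {}"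
  using nontrivial by blast

lemma \<Sigma>_PL: "\<phi> \<in> \<Sigma> \<Longrightarrow> \<phi> \<in> PL \<Gamma>"
  using \<Sigma>_R by (auto simp: R_def)

lemma \<Sigma>_continuous: "\<phi> \<in> \<Sigma> \<Longrightarrow> continuous_on \<Gamma> \<phi>"
  using \<Sigma>_PL by (auto simp: PL_def)

lemma \<Sigma>_epl: "\<phi> \<in> \<Sigma> \<Longrightarrow> epl \<phi>"
  using \<Sigma>_PL PL_epl by blast

lemma finite_sub_G: "H \<subseteq> G \<Longrightarrow> finite H"
  using G(1) finite_subset by blast

lemma tcomb_in: "H \<subseteq> G \<Longrightarrow> H \<noteq> {} \<Longrightarrow> tcomb \<Gamma> H a \<in> \<Sigma>"
  unfolding G(3) tropical_span_def tcomb_def tmin_def mem_Collect_eq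
  by (intro exI[of _ H] exI[of _ a] conjI refl) (auto intro: finite_sub_G)

lemma tcomb_exists:
  assumes "\<phi> \<in> \<Sigma>"
  obtains H a where "H \<subseteq> G" "H \<noteq> {}" "\<phi> = tcomb \<Gamma> H a"
proof -
  obtain H a where H: "H \<subseteq> G" "H \<noteq> {}" "\<phi> = (\<lambda>x\<in>\<Gamma>. Min ((\<lambda>\<phi>. \<phi> x + a \<phi>) ` H))"
    using assms unfolding G(3) tropical_span_def mem_Collect_eq by blast
  have "\<phi> = tcomb \<Gamma> H a" unfolding H(3) by (simp only: tcomb_def tmin_def)
  then show ?thesis by (rule that[OF H(1,2)])
qed

lemma tcomb_apply: "x \<in> \<Gamma> \<Longrightarrow> tcomb \<Gamma> H a x = tmin H a x"
  by (simp add: tcomb_def)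

lemma tcomb_reduce:
  assumes "K \<subseteq> G" "K \<noteq> {}"
  obtains H where "H \<subseteq> K" "H \<noteq> {}" "irredundant \<Gamma> H a" "tcomb \<Gamma> H a = tcomb \<Gamma> K a"
proof -
  obtain H where H: "H \<subseteq> K" "H \<noteq> {}" "irredundant \<Gamma> H a" "\<And>x. x \<in> \<Gamma> \<Longrightarrow> tmin H a x = tmin K a x"
    using irredundant_reduce[OF finite_sub_G[OF assms(1)] assms(2) \<Gamma>_ne, of a] by blast
  have "tcomb \<Gamma> H a = tcomb \<Gamma> K a"
    unfolding tcomb_def by (rule restrict_ext) (rule H(4))
  then show ?thesis using that H by blast
qed

lemma irredundant_exists:
  assumes "\<phi> \<in> \<Sigma>"
  obtains H a where "H \<subseteq> G" "H \<noteq> {}" "irredundant \<Gamma> H a" "\<phi> = tcomb \<Gamma> H a"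
proof -
  obtain K a where K: "K \<subseteq> G" "K \<noteq> {}" "\<phi> = tcomb \<Gamma> K a" using tcomb_exists[OF assms] .
  obtain H where H: "H \<subseteq> K" "H \<noteq> {}" "irredundant \<Gamma> H a" "tcomb \<Gamma> H a = tcomb \<Gamma> K a"
    using tcomb_reduce[OF K(1,2)] .
  show ?thesis by (rule that[of H a]) (use H K in auto)
qed

text \<open>This also gives the \<open>GREATEST\<close> in \<open>ind_rank\<close> a meaning, which
  would be unspecified without an upper bound.\<close>

lemma independent_card:
  assumes "F \<subseteq> \<Sigma>" "finite F" "\<not> tropically_dependent \<Gamma> F"
  shows "card F \<le> card G"
proof (rule ccontr)
  assume "\<not> ?thesis"
  then have lt: "card G < card F" by simp
  then have "F \<noteq> {}" by auto
  then have "G \<noteq> {}" using assms(1) tcomb_exists by blast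
  have "\<exists>b. \<forall>x\<in>\<Gamma>. f x = tmin G b x" if "f \<in> F" for f
    using that assms(1) G \<Sigma>_continuous compact by (intro tropical_span_full) auto
  then have "tropically_dependent \<Gamma> F"
    by (rule span_dependent[OF assms(2) G(1) \<open>G \<noteq> {}\<close> lt])
  then show False using assms(3) by simp
qed

text \<open>A finite open set is also closed, so by connectedness it is the whole space, and a
  finite connected space is a single point.\<close>

lemma infinite_open:
  assumes "openin (top_of_set \<Gamma>) U" "U \<noteq> {}"
  shows "infinite U"
proof
  assume "finite U"
  have "U \<subseteq> \<Gamma>" using assms(1) openin_imp_subset by blast
  then have "closedin (top_of_set \<Gamma>) U"
    using \<open>finite U\<close> by (meson closed_subset finite_imp_closed)
  then have "U = \<Gamma>" using connected assms connected_clopen by blast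
  then have "\<exists>a. \<Gamma> = {a}"
    using \<open>finite U\<close> connected connected_finite_iff_sing assms(2) by blast
  then show False using nontrivial by auto
qed

lemma pl_div_local:
  assumes "epl \<phi>" "epl \<psi>" "openin (top_of_set \<Gamma>) U" "p \<in> U" "\<And>x. x \<in> U \<Longrightarrow> \<phi> x = \<psi> x + c"
  shows "Poly_Mapping.lookup (pl_div \<Gamma> \<phi>) p = Poly_Mapping.lookup (pl_div \<Gamma> \<psi>) p"
proof -
  obtain r where r: "r > 0" "ball p r \<inter> \<Gamma> \<subseteq> U"
    using assms(3,4) openin_contains_ball by metis
  have "dslope \<phi> d = dslope \<psi> d" if d: "d \<in> dirs p" for d
  proof -
    obtain \<epsilon> where \<epsilon>: "\<epsilon> > 0" "isometric_segment \<Gamma> \<epsilon> (ray d)" and r0: "ray d 0 = p"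
      using ray_germ[OF d] by (auto simp: germs_at_def)
    have "ray d s \<in> U" if "0 < s" "s < min \<epsilon> r" for s
    proof -
      have "dist (ray d 0) (ray d s) = \<bar>0 - s\<bar>" "ray d s \<in> \<Gamma>"
        using \<epsilon>(2) that unfolding isometric_segment_def by auto
      then show ?thesis using r that r0 by auto
    qed
    then have ev: "\<forall>\<^sub>F s in at_right 0. ray d s \<in> U"
      unfolding eventually_at_right_field using \<epsilon>(1) r(1) by (intro exI[of _ "min \<epsilon> r"]) auto
    have "(\<forall>\<^sub>F s in at_right 0. \<phi> (ray d s) = \<phi> (ray d 0) + of_int m * s) \<longleftrightarrow>
      (\<forall>\<^sub>F s in at_right 0. \<psi> (ray d s) = \<psi> (ray d 0) + of_int m * s)" for m :: int
    proof (rule eventually_cong[OF ev])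
      fix s assume "ray d s \<in> U"
      then have "\<phi> (ray d s) = \<psi> (ray d s) + c" "\<phi> (ray d 0) = \<psi> (ray d 0) + c"
        using assms(4) r0 by (auto intro: assms(5))
      then show "\<phi> (ray d s) = \<phi> (ray d 0) + of_int m * s \<longleftrightarrow> \<psi> (ray d s) = \<psi> (ray d 0) + of_int m * s"
        by linarith
    qed
    then show ?thesis by (simp add: dslope_def)
  qed
  then show ?thesis by (simp add: lookup_pl_div assms(1,2))
qed

section \<open>Approximation by irredundant minima with many terms\<close>

definition region :: "('a \<Rightarrow> real) set \<Rightarrow> (('a \<Rightarrow> real) \<Rightarrow> real) \<Rightarrow> ('a \<Rightarrow> real) \<Rightarrow> 'a set" where
  "region H a i = {x \<in> \<Gamma>. \<forall>k\<in>H. k \<noteq> i \<longrightarrow> i x + a i < k x + a k}"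

lemma region_open:
  assumes "H \<subseteq> G" "i \<in> H"
  shows "openin (top_of_set \<Gamma>) (region H a i)"
proof -
  have "openin (top_of_set \<Gamma>) ((\<Inter>k\<in>H - {i}. \<Gamma> \<inter> (\<lambda>x. (k x + a k) - (i x + a i)) -` {0<..}) \<inter> topspace (top_of_set \<Gamma>))"
  proof (rule openin_INT)
    show "finite (H - {i})" using finite_sub_G[OF assms(1)] by simp
    fix k assume "k \<in> H - {i}"
    then have "continuous_on \<Gamma> k" "continuous_on \<Gamma> i"
      using assms G(2) by (auto intro: \<Sigma>_continuous)
    then show "openin (top_of_set \<Gamma>) (\<Gamma> \<inter> (\<lambda>x. (k x + a k) - (i x + a i)) -` {0<..})"
      by (intro continuous_openin_preimage_gen continuous_intros open_greaterThan)
  qed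
  also have "(\<Inter>k\<in>H - {i}. \<Gamma> \<inter> (\<lambda>x. (k x + a k) - (i x + a i)) -` {0<..}) \<inter> topspace (top_of_set \<Gamma>) = region H a i"
    by (auto simp: region_def)
  finally show ?thesis .
qed

lemma region_tcomb:
  assumes "H \<subseteq> G" "i \<in> H" "x \<in> region H a i"
  shows "tcomb \<Gamma> H a x = i x + a i"
proof -
  have "x \<in> \<Gamma>" using assms(3) by (simp add: region_def)
  have "tmin H a x = i x + a i"
  proof (rule tmin_eqI[OF finite_sub_G[OF assms(1)] assms(2)])
    fix k assume "k \<in> H"
    then show "i x + a i \<le> k x + a k" using assms(3) by (cases "k = i") (auto simp: region_def less_imp_le)
  qed
  then show ?thesis using \<open>x \<in> \<Gamma>\<close> by (simp add: tcomb_apply)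
qed

definition BN :: "nat \<Rightarrow> bool" where
  "BN r \<longleftrightarrow> (\<forall>D'. divisor_on \<Gamma> D' \<and> effective D' \<and> divisor_degree D' = int r \<longrightarrow>
        (\<exists>\<phi>\<in>\<Sigma>. effective (D - D' + pl_div \<Gamma> \<phi>)))"

text \<open>A function \<open>\<psi>\<close> of the module that bends inside each region of \<open>\<theta>\<close> can replace \<open>\<theta>\<close> on a
  small set, near the maximum of \<open>\<theta> - \<psi>\<close>, that contains none of the regions.\<close>

lemma extend_irredundant:
  assumes H: "H \<subseteq> G" "H \<noteq> {}" "irredundant \<Gamma> H a" and r: "BN r" "card H \<le> r" and "\<eta> > 0"
  shows "\<exists>H' b. H \<subset> H' \<and> H' \<subseteq> G \<and> irredundant \<Gamma> H' b \<and>
    (\<forall>x\<in>\<Gamma>. \<bar>tcomb \<Gamma> H' b x - tcomb \<Gamma> H a x\<bar> \<le> \<eta>)"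
proof -
  define \<theta> where "\<theta> = tcomb \<Gamma> H a"
  have "finite H" using finite_sub_G[OF H(1)] .
  have H\<Sigma>: "i \<in> \<Sigma>" if "i \<in> H" for i using H(1) G(2) that by blast
  \<comment> \<open>Off \<open>K0\<close> neither D nor any generator has mass, so a bend of \<psi>
    that is forced at such a point cannot be inherited from them.\<close>
  define K0 where "K0 = Poly_Mapping.keys D \<union> (\<Union>g\<in>G. Poly_Mapping.keys (pl_div \<Gamma> g))"
  have "\<exists>p. p \<in> region H a i \<and> p \<notin> K0" if i: "i \<in> H" for i
  proof -
    have "region H a i \<noteq> {}" using H(3) i unfolding irredundant_def region_def by blast
    then have "infinite (region H a i)" using infinite_open region_open[OF H(1) i] by blast
    moreover have "finite K0" using G(1) by (simp add: K0_def)
    ultimately have "\<not> region H a i \<subseteq> K0" using finite_subset by blast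
    then show ?thesis by blast
  qed
  then obtain p where p: "\<And>i. i \<in> H \<Longrightarrow> p i \<in> region H a i \<and> p i \<notin> K0" by metis
  have p\<Gamma>: "p i \<in> \<Gamma>" if "i \<in> H" for i using p[OF that] by (simp add: region_def)
  obtain i0 where i0: "i0 \<in> H" using H(2) by blast
  \<comment> \<open>The rank condition asks for degree exactly r; the r - card H points left over
    are put on p i0.\<close>
  define D' where "D' = (\<Sum>i\<in>H. Poly_Mapping.single (p i) 1) + Poly_Mapping.single (p i0) (int (r - card H))"
  have lD': "Poly_Mapping.lookup D' x = (\<Sum>i\<in>H. if p i = x then 1 else 0) + (if p i0 = x then int (r - card H) else 0)" for x
    by (simp only: D'_def lookup_add lookup_sum lookup_single when_def)
  have "divisor_on \<Gamma> D'"
    unfolding divisor_on_def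
  proof
    fix x assume "x \<in> Poly_Mapping.keys D'"
    moreover have "Poly_Mapping.lookup D' x = 0" if no: "\<not> (\<exists>i\<in>H. p i = x)"
    proof -
      have "(\<Sum>i\<in>H. if p i = x then 1 else (0::int)) = 0" by (rule sum.neutral) (use no in auto)
      moreover have "p i0 \<noteq> x" using no i0 by blast
      ultimately show ?thesis by (simp only: lD') simp
    qed
    ultimately have "\<exists>i\<in>H. p i = x" by (auto simp: in_keys_iff)
    then show "x \<in> \<Gamma>" using p\<Gamma> by blast
  qed
  moreover have "effective D'" by (simp add: effective_def lD' sum_nonneg)
  moreover have "divisor_degree D' = int r"
    using r(2) by (simp add: D'_def divisor_degree_add divisor_degree_sum divisor_degree_single)
  ultimately obtain \<psi> where \<psi>: "\<psi> \<in> \<Sigma>" "effective (D - D' + pl_div \<Gamma> \<psi>)"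
    using r(1) unfolding BN_def by blast
  have bend: "Poly_Mapping.lookup (pl_div \<Gamma> \<psi>) (p i) \<ge> 1" if i: "i \<in> H" for i
  proof -
    have "Poly_Mapping.lookup D (p i) = 0" using p[OF i] by (auto simp: K0_def in_keys_iff)
    moreover have "(1::int) \<le> (\<Sum>j\<in>H. if p j = p i then 1 else 0)"
      using member_le_sum[OF i, of "\<lambda>j. if p j = p i then 1 else (0::int)"] \<open>finite H\<close> by simp
    then have "Poly_Mapping.lookup D' (p i) \<ge> 1" unfolding lD' by simp
    moreover have "0 \<le> Poly_Mapping.lookup (D - D' + pl_div \<Gamma> \<psi>) (p i)" using \<psi>(2) unfolding effective_def by blast
    ultimately show ?thesis by (simp add: lookup_add lookup_minus)
  qed
  have "\<theta> \<in> \<Sigma>" unfolding \<theta>_def by (rule tcomb_in[OF H(1,2)])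
  have "continuous_on \<Gamma> (\<lambda>x. \<theta> x - \<psi> x)"
    using \<Sigma>_continuous \<open>\<theta> \<in> \<Sigma>\<close> \<psi>(1) by (intro continuous_intros)
  then obtain x0 where x0: "x0 \<in> \<Gamma>" "\<And>x. x \<in> \<Gamma> \<Longrightarrow> \<theta> x - \<psi> x \<le> \<theta> x0 - \<psi> x0"
    using continuous_attains_sup[OF compact \<Gamma>_ne] by blast
  define c0 where "c0 = \<theta> x0 - \<psi> x0"
  \<comment> \<open>If \<theta> - \<psi> were maximal throughout the region, \<psi> would be the
    generator i up to a constant there and could not bend at p i.\<close>
  have "\<exists>q. q \<in> region H a i \<and> \<theta> q - \<psi> q < c0" if i: "i \<in> H" for i
  proof (rule ccontr)
    assume no: "\<not> ?thesis"
    have eq: "\<psi> x = i x + (a i - c0)" if x: "x \<in> region H a i" for x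
    proof -
      have "x \<in> \<Gamma>" using x by (simp add: region_def)
      then have "\<theta> x - \<psi> x = c0" using no x x0(2)[of x] by (force simp: c0_def)
      then show ?thesis using region_tcomb[OF H(1) i x] by (simp add: \<theta>_def)
    qed
    have "Poly_Mapping.lookup (pl_div \<Gamma> \<psi>) (p i) = Poly_Mapping.lookup (pl_div \<Gamma> i) (p i)"
      using p[OF i] by (intro pl_div_local[OF \<Sigma>_epl[OF \<psi>(1)] \<Sigma>_epl[OF H\<Sigma>[OF i]] region_open[OF H(1) i] _ eq]) auto
    moreover have "Poly_Mapping.lookup (pl_div \<Gamma> i) (p i) = 0"
      using p[OF i] i H(1) by (auto simp: K0_def in_keys_iff)
    ultimately show False using bend[OF i] by simp
  qed
  then obtain q where q: "\<And>i. i \<in> H \<Longrightarrow> q i \<in> region H a i \<and> \<theta> (q i) - \<psi> (q i) < c0" by metis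
  have "\<exists>\<delta>>0. \<forall>\<epsilon>. 0 < \<epsilon> \<and> \<epsilon> \<le> \<delta> \<longrightarrow> (\<forall>i\<in>H. \<theta> (q i) - \<psi> (q i) < c0 - \<epsilon>)"
  proof (rule uniform_small[OF \<open>finite H\<close>])
    fix i assume "i \<in> H"
    then show "\<exists>\<delta>>0. \<forall>\<epsilon>. 0 < \<epsilon> \<and> \<epsilon> \<le> \<delta> \<longrightarrow> \<theta> (q i) - \<psi> (q i) < c0 - \<epsilon>"
      using q[of i] by (intro exI[of _ "(c0 - (\<theta> (q i) - \<psi> (q i))) / 2"]) auto
  qed
  then obtain \<delta>0 where \<delta>0: "\<delta>0 > 0" "\<And>\<epsilon>. 0 < \<epsilon> \<Longrightarrow> \<epsilon> \<le> \<delta>0 \<Longrightarrow> \<forall>i\<in>H. \<theta> (q i) - \<psi> (q i) < c0 - \<epsilon>" by blast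
  define \<delta> where "\<delta> = min \<delta>0 \<eta>"
  have \<delta>: "\<delta> > 0" "\<delta> \<le> \<eta>" "\<And>i. i \<in> H \<Longrightarrow> \<theta> (q i) < \<psi> (q i) + (c0 - \<delta>)"
    using \<delta>0(1) \<delta>0(2)[of \<delta>] \<open>\<eta> > 0\<close> by (auto simp: \<delta>_def algebra_simps)
  define c where "c = c0 - \<delta>"
  obtain K b where K: "K \<subseteq> G" "K \<noteq> {}" "\<psi> = tcomb \<Gamma> K b" using tcomb_exists[OF \<psi>(1)] .
  have "finite K" using finite_sub_G[OF K(1)] .
  \<comment> \<open>Coefficients of min \<theta> (\<psi> + c) over H \<union> K; a generator in both
    takes the smaller of its two.\<close>
  define e where "e k = (if k \<in> H then if k \<in> K then min (a k) (b k + c) else a k else b k + c)" for k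
  have HK: "H \<union> K \<subseteq> G" "H \<union> K \<noteq> {}" "finite (H \<union> K)" using H K \<open>finite H\<close> \<open>finite K\<close> by auto
  have tm: "tmin (H \<union> K) e x = min (\<theta> x) (\<psi> x + c)" if x: "x \<in> \<Gamma>" for x
  proof (rule antisym)
    have \<theta>x: "\<theta> x = tmin H a x" and \<psi>x: "\<psi> x = tmin K b x" by (simp_all add: \<theta>_def K(3) tcomb_apply x)
    obtain i where i: "i \<in> H" "tmin H a x = i x + a i" using tmin_attained[OF \<open>finite H\<close> H(2)] .
    obtain k where k: "k \<in> K" "tmin K b x = k x + b k" using tmin_attained[OF \<open>finite K\<close> K(2)] .
    have "tmin (H \<union> K) e x \<le> i x + e i" "tmin (H \<union> K) e x \<le> k x + e k"
      using HK(3) i(1) k(1) by (auto intro: tmin_le)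
    moreover have "e i \<le> a i" "e k \<le> b k + c" using i(1) k(1) by (auto simp: e_def)
    ultimately show "tmin (H \<union> K) e x \<le> min (\<theta> x) (\<psi> x + c)" using i(2) k(2) \<theta>x \<psi>x by simp
    show "min (\<theta> x) (\<psi> x + c) \<le> tmin (H \<union> K) e x"
    proof (rule tmin_ge[OF HK(3,2)])
      fix g assume "g \<in> H \<union> K"
      then show "min (\<theta> x) (\<psi> x + c) \<le> g x + e g"
        unfolding \<theta>x \<psi>x e_def
        using tmin_le[OF \<open>finite H\<close>, of g a x] tmin_le[OF \<open>finite K\<close>, of g b x] by auto
    qed
  qed
  obtain H' where H': "H' \<subseteq> H \<union> K" "H' \<noteq> {}" "irredundant \<Gamma> H' e" "tcomb \<Gamma> H' e = tcomb \<Gamma> (H \<union> K) e"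
    using tcomb_reduce[OF HK(1,2)] .
  have "finite H'" using H'(1) HK(3) finite_subset by blast
  have tm': "tmin H' e x = min (\<theta> x) (\<psi> x + c)" if "x \<in> \<Gamma>" for x
    using fun_cong[OF H'(4), of x] tm[OF that] by (simp add: tcomb_apply that)
  have q\<Gamma>: "q i \<in> \<Gamma>" if "i \<in> H" for i using q[OF that] by (simp add: region_def)
  have \<theta>q: "\<theta> (q i) = i (q i) + a i" if "i \<in> H" for i
    unfolding \<theta>_def using q[OF that] by (intro region_tcomb[OF H(1) that]) auto
  have \<psi>q: "\<theta> (q i) < k (q i) + (b k + c)" if "i \<in> H" "k \<in> K" for i k
  proof -
    have "\<psi> (q i) \<le> k (q i) + b k"
      using tmin_le[OF \<open>finite K\<close> that(2), of b "q i"] by (simp add: K(3) tcomb_apply q\<Gamma>[OF that(1)])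
    then show ?thesis using \<delta>(3)[OF that(1)] by (simp add: c_def)
  qed
  \<comment> \<open>At q i the function \<theta> is strictly below \<psi> + c and only i attains it,
    so no minimum without i has this value there.\<close>
  have sub: "H \<subseteq> H'"
  proof
    fix i assume i: "i \<in> H"
    show "i \<in> H'"
    proof (rule ccontr)
      assume "i \<notin> H'"
      obtain k where k: "k \<in> H'" "tmin H' e (q i) = k (q i) + e k" using tmin_attained[OF \<open>finite H'\<close> H'(2)] .
      have "k \<noteq> i" using k(1) \<open>i \<notin> H'\<close> by auto
      have 1: "\<theta> (q i) < k (q i) + a k" if "k \<in> H"
        using q[OF i] that \<open>k \<noteq> i\<close> unfolding \<theta>q[OF i] by (simp add: region_def)
      have 2: "\<theta> (q i) < k (q i) + (b k + c)" if "k \<in> K" using \<psi>q[OF i that] .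
      have "k \<in> H \<union> K" using k(1) H'(1) by blast
      then have "\<theta> (q i) < k (q i) + e k"
        using 1 2 by (auto simp: e_def min_def)
      moreover have "k (q i) + e k \<le> \<theta> (q i)" using tm'[OF q\<Gamma>[OF i]] k(2) by simp
      ultimately show False by simp
    qed
  qed
  \<comment> \<open>Without a new term the coefficients would be those of \<theta>, since the terms
    of \<psi> + c are too high at the points q i; but at x0 the function \<psi> + c lies \<delta>
    below \<theta>.\<close>
  have "H' \<noteq> H"
  proof
    assume "H' = H"
    have ea: "e i = a i" if i: "i \<in> H" for i
      using \<psi>q[OF i, of i] \<theta>q[OF i] i by (auto simp: e_def)
    have "tmin H e x0 = tmin H a x0"
      unfolding tmin_def by (intro arg_cong[where f = Min] image_cong refl) (simp add: ea)
    then have "min (\<theta> x0) (\<psi> x0 + c) = \<theta> x0"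
      using tm'[OF x0(1)] by (simp add: \<open>H' = H\<close> \<theta>_def tcomb_apply x0(1))
    then show False using \<delta>(1) by (simp add: c_def c0_def)
  qed
  have "\<bar>tcomb \<Gamma> H' e x - tcomb \<Gamma> H a x\<bar> \<le> \<eta>" if x: "x \<in> \<Gamma>" for x
  proof -
    have "tcomb \<Gamma> H' e x = min (\<theta> x) (\<psi> x + c)" using tm'[OF x] by (simp add: tcomb_apply x)
    then show ?thesis
      using x0(2)[OF x] \<delta>(1,2) unfolding \<theta>_def[symmetric] c_def c0_def by (simp add: min_def)
  qed
  then show ?thesis using sub \<open>H' \<noteq> H\<close> H' HK(1) by (intro exI[of _ H'] exI[of _ e]) blast
qed

text \<open>An approximating H of greatest size is taken; with at most r terms it could be enlarged
  by \<open>extend_irredundant\<close>. The error is kept at some \<kappa> < \<eta>, so that the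
  slack \<eta> - \<kappa> pays for the extension.\<close>

lemma large_irredundant:
  assumes "\<phi> \<in> \<Sigma>" "BN r" "\<eta> > 0"
  obtains H a where "H \<subseteq> G" "H \<noteq> {}" "irredundant \<Gamma> H a" "r + 1 \<le> card H" "\<And>x. x \<in> \<Gamma> \<Longrightarrow> \<bar>tcomb \<Gamma> H a x - \<phi> x\<bar> < \<eta>"
proof -
  define P where "P H \<longleftrightarrow> H \<subseteq> G \<and> H \<noteq> {} \<and> (\<exists>a. irredundant \<Gamma> H a \<and> (\<exists>\<kappa><\<eta>. \<forall>x\<in>\<Gamma>. \<bar>tcomb \<Gamma> H a x - \<phi> x\<bar> \<le> \<kappa>))" for H
  obtain H0 a0 where H0: "H0 \<subseteq> G" "H0 \<noteq> {}" "irredundant \<Gamma> H0 a0" "\<phi> = tcomb \<Gamma> H0 a0" using irredundant_exists[OF assms(1)] .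
  have "P H0" unfolding P_def
    by (intro conjI H0(1,2) exI[of _ a0] H0(3) exI[of _ 0]) (simp_all add: assms(3) H0(4))
  moreover have "\<forall>H. P H \<longrightarrow> card H < card G + 1"
    using G(1) by (auto simp: P_def less_Suc_eq_le intro: card_mono)
  ultimately obtain H where H: "P H" "\<And>H'. P H' \<Longrightarrow> card H' \<le> card H"
    using ex_has_greatest_nat[of P H0 card "card G + 1"] by blast
  obtain a \<kappa> where a: "H \<subseteq> G" "H \<noteq> {}" "irredundant \<Gamma> H a" "\<kappa> < \<eta>" "\<forall>x\<in>\<Gamma>. \<bar>tcomb \<Gamma> H a x - \<phi> x\<bar> \<le> \<kappa>"
    using H(1) unfolding P_def by blast
  have "r + 1 \<le> card H"
  proof (rule ccontr)
    assume "\<not> ?thesis"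
    then have le: "card H \<le> r" by simp
    have pos: "(\<eta> - \<kappa>) / 2 > 0" using a(4) by simp
    obtain H' b where H': "H \<subset> H'" "H' \<subseteq> G" "irredundant \<Gamma> H' b"
      "\<forall>x\<in>\<Gamma>. \<bar>tcomb \<Gamma> H' b x - tcomb \<Gamma> H a x\<bar> \<le> (\<eta> - \<kappa>) / 2"
      using extend_irredundant[OF a(1-3) assms(2) le pos] by (elim exE conjE)
    have "\<forall>x\<in>\<Gamma>. \<bar>tcomb \<Gamma> H' b x - \<phi> x\<bar> \<le> (\<eta> + \<kappa>) / 2"
    proof
      fix x assume x: "x \<in> \<Gamma>"
      show "\<bar>tcomb \<Gamma> H' b x - \<phi> x\<bar> \<le> (\<eta> + \<kappa>) / 2"
      proof -
        have "\<bar>tcomb \<Gamma> H' b x - \<phi> x\<bar> \<le> (\<eta> - \<kappa>) / 2 + \<kappa>"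
          using bspec[OF H'(4) x] bspec[OF a(5) x]
          by (rule order_trans[OF abs_triangle_ineq[of "tcomb \<Gamma> H' b x - tcomb \<Gamma> H a x" "tcomb \<Gamma> H a x - \<phi> x", simplified] add_mono])
        then show ?thesis by (simp add: field_simps)
      qed
    qed
    moreover have "(\<eta> + \<kappa>) / 2 < \<eta>" using a(4) by simp
    ultimately have "\<exists>\<kappa><\<eta>. \<forall>x\<in>\<Gamma>. \<bar>tcomb \<Gamma> H' b x - \<phi> x\<bar> \<le> \<kappa>" by (intro exI[of _ "(\<eta> + \<kappa>) / 2"] conjI)
    then have "P H'" unfolding P_def using H'(1-3) a(2) by (intro conjI exI[of _ b]) auto
    then have "card H' \<le> card H" by (rule H(2))
    moreover have "card H < card H'" using H'(1,2) finite_sub_G by (intro psubset_card_mono)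
    ultimately show False by simp
  qed
  moreover have "\<bar>tcomb \<Gamma> H a x - \<phi> x\<bar> < \<eta>" if "x \<in> \<Gamma>" for x
    using bspec[OF a(5) that] a(4) by linarith
  ultimately show ?thesis by (rule that[OF a(1-3)])
qed

end

section \<open>Generic coefficients\<close>

text \<open>By \<open>refine\<close> v0 is a function h of v1, so v1 has at least as many values. If
  it has no more, h is injective and both have the same fibres.\<close>

lemma values_refine:
  fixes v0 v1 :: "'f \<Rightarrow> real"
  assumes "finite A" and refine: "\<And>f g. f \<in> A \<Longrightarrow> g \<in> A \<Longrightarrow> v1 f = v1 g \<Longrightarrow> v0 f = v0 g"
  shows "card (v0 ` A) \<le> card (v1 ` A)"
    and "card (v1 ` A) \<le> card (v0 ` A) \<Longrightarrow> f \<in> A \<Longrightarrow> g \<in> A \<Longrightarrow> v0 f = v0 g \<Longrightarrow> v1 f = v1 g"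
proof -
  define h where "h y = v0 (SOME f. f \<in> A \<and> v1 f = y)" for y
  have h: "h (v1 f) = v0 f" if "f \<in> A" for f
  proof -
    have "\<exists>g. g \<in> A \<and> v1 g = v1 f" using that by blast
    from someI_ex[OF this] show ?thesis unfolding h_def using that by (intro refine) auto
  qed
  have "v0 ` A = h ` (v1 ` A)"
    unfolding image_image by (rule image_cong) (simp_all add: h)
  then show le: "card (v0 ` A) \<le> card (v1 ` A)"
    using assms(1) by (simp add: card_image_le)
  show "v1 f = v1 g" if "card (v1 ` A) \<le> card (v0 ` A)" "f \<in> A" "g \<in> A" "v0 f = v0 g"
  proof -
    have "card (h ` (v1 ` A)) = card (v1 ` A)"
      using that(1) le \<open>v0 ` A = h ` (v1 ` A)\<close> by simp
    then have "inj_on h (v1 ` A)" using assms(1) by (intro eq_card_imp_inj_on) auto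
    moreover have "h (v1 f) = h (v1 g)" using h that by simp
    ultimately show ?thesis using that(2,3) by (auto dest: inj_onD)
  qed
qed

text \<open>A Lipschitz constant of \<open>val f\<close> for the maximum norm; the factor 2 is there
  because two coefficients move.\<close>

definition weight :: "'a functional \<Rightarrow> real" where
  "weight f = 2 * \<bar>fst (snd f)\<bar>"

lemma weight_nonneg: "0 \<le> weight f"
  by (simp add: weight_def)

lemma val_lipschitz:
  assumes "f \<in> UNIV \<times> UNIV \<times> H \<times> H" "\<And>g. g \<in> H \<Longrightarrow> \<bar>a g - b g\<bar> \<le> \<rho>"
  shows "\<bar>val f a - val f b\<bar> \<le> weight f * \<rho>"
proof -
  obtain c q i k where f: "f = (c, q, i, k)" "i \<in> H" "k \<in> H" using assms(1) by auto
  have "val f a - val f b = q * ((a i - b i) - (a k - b k))"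
    by (simp add: f val_def algebra_simps)
  then have "\<bar>val f a - val f b\<bar> = \<bar>q\<bar> * \<bar>(a i - b i) - (a k - b k)\<bar>" by (simp add: abs_mult)
  also have "\<dots> \<le> \<bar>q\<bar> * (2 * \<rho>)"
    using assms(2)[OF f(2)] assms(2)[OF f(3)] by (intro mult_left_mono) auto
  finally show ?thesis by (simp add: f weight_def mult_ac)
qed

lemma small_multiple:
  fixes w d :: real
  assumes "0 \<le> w" "0 < d"
  shows "\<exists>\<delta>>0. \<forall>\<epsilon>. 0 < \<epsilon> \<and> \<epsilon> \<le> \<delta> \<longrightarrow> w * \<epsilon> < d"
proof (intro exI[of _ "d / (w + 1)"] conjI allI impI)
  fix \<epsilon> assume "0 < \<epsilon> \<and> \<epsilon> \<le> d / (w + 1)"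
  then have "w * \<epsilon> < (w + 1) * \<epsilon>" "(w + 1) * \<epsilon> \<le> d" using assms by (auto simp: field_simps)
  then show "w * \<epsilon> < d" by linarith
qed (use assms in simp)

text \<open>The coefficients \<open>a0\<close> are chosen such that the functionals take as many distinct values as
  possible; then two functionals that agree at \<open>a0\<close> cannot separate nearby.\<close>

lemma (in graph_model) generic_coefficients:
  fixes Fn :: "'a edge \<Rightarrow> 'a functional set"
  assumes H: "finite H" and Fn: "\<And>e. e \<in> \<E> \<Longrightarrow> finite (Fn e) \<and> Fn e \<subseteq> UNIV \<times> UNIV \<times> H \<times> H" and "\<rho> > 0"
  obtains a0 \<rho>' where "\<rho>' > 0" "\<And>g. g \<in> H \<Longrightarrow> \<bar>a0 g - a g\<bar> + \<rho>' < \<rho>"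
    "\<And>a1 e f f'. (\<And>g. g \<in> H \<Longrightarrow> \<bar>a1 g - a0 g\<bar> \<le> \<rho>') \<Longrightarrow> e \<in> \<E> \<Longrightarrow> f \<in> Fn e \<Longrightarrow> f' \<in> Fn e \<Longrightarrow>
       val f a0 = val f' a0 \<Longrightarrow> val f a1 = val f' a1"
proof -
  define P where "P b \<longleftrightarrow> (\<forall>g\<in>H. \<bar>b g - a g\<bar> < \<rho>)" for b
  define N where "N b = (\<Sum>e\<in>\<E>. card ((\<lambda>f. val f b) ` Fn e))" for b
  have "P a" using \<open>\<rho> > 0\<close> by (simp add: P_def)
  moreover have "\<forall>b. P b \<longrightarrow> N b < (\<Sum>e\<in>\<E>. card (Fn e)) + 1"
    unfolding N_def using Fn by (auto simp: less_Suc_eq_le intro!: sum_mono card_image_le)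
  ultimately obtain a0 where a0: "P a0" "\<And>b. P b \<Longrightarrow> N b \<le> N a0"
    using ex_has_greatest_nat[of P a N "(\<Sum>e\<in>\<E>. card (Fn e)) + 1"] by blast
  have "\<exists>\<delta>>0. \<forall>\<epsilon>. 0 < \<epsilon> \<and> \<epsilon> \<le> \<delta> \<longrightarrow> (\<forall>g\<in>H. \<bar>a0 g - a g\<bar> + \<epsilon> < \<rho>)"
  proof (rule uniform_small[OF H])
    fix g assume "g \<in> H"
    then have "0 < (\<rho> - \<bar>a0 g - a g\<bar>) / 2" using a0(1) by (simp add: P_def)
    then show "\<exists>\<delta>>0. \<forall>\<epsilon>. 0 < \<epsilon> \<and> \<epsilon> \<le> \<delta> \<longrightarrow> \<bar>a0 g - a g\<bar> + \<epsilon> < \<rho>"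
      by (intro exI[of _ "(\<rho> - \<bar>a0 g - a g\<bar>) / 2"]) (auto simp: field_simps)
  qed
  then obtain \<delta>1 where \<delta>1: "\<delta>1 > 0" "\<And>\<epsilon>. 0 < \<epsilon> \<Longrightarrow> \<epsilon> \<le> \<delta>1 \<Longrightarrow> \<forall>g\<in>H. \<bar>a0 g - a g\<bar> + \<epsilon> < \<rho>" by blast
  define Q where "Q = (\<lambda>(e :: 'a edge, f :: 'a functional, f' :: 'a functional) \<epsilon>. val f a0 \<noteq> val f' a0 \<longrightarrow> (weight f + weight f') * \<epsilon> < \<bar>val f a0 - val f' a0\<bar>)"
  have "\<exists>\<delta>>0. \<forall>\<epsilon>. 0 < \<epsilon> \<and> \<epsilon> \<le> \<delta> \<longrightarrow> (\<forall>u\<in>Sigma \<E> (\<lambda>e. Fn e \<times> Fn e). Q u \<epsilon>)"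
  proof (rule uniform_small)
    show "finite (Sigma \<E> (\<lambda>e. Fn e \<times> Fn e))" using finite_E Fn by auto
    fix u :: "'a edge \<times> 'a functional \<times> 'a functional"
    obtain e f f' where u: "u = (e, f, f')" by (cases u)
    show "\<exists>\<delta>>0. \<forall>\<epsilon>. 0 < \<epsilon> \<and> \<epsilon> \<le> \<delta> \<longrightarrow> Q u \<epsilon>"
    proof (cases "val f a0 = val f' a0")
      case False
      then show ?thesis
        using small_multiple[of "weight f + weight f'" "\<bar>val f a0 - val f' a0\<bar>"] weight_nonneg[of f] weight_nonneg[of f']
        unfolding Q_def u by simp
    qed (auto simp: Q_def u intro: exI[of _ 1])
  qed
  then obtain \<delta>2 where \<delta>2: "\<delta>2 > 0" "\<And>\<epsilon>. 0 < \<epsilon> \<Longrightarrow> \<epsilon> \<le> \<delta>2 \<Longrightarrow> \<forall>u\<in>Sigma \<E> (\<lambda>e. Fn e \<times> Fn e). Q u \<epsilon>" by blast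
  define \<rho>' where "\<rho>' = min \<delta>1 \<delta>2"
  have \<rho>': "\<rho>' > 0" "\<rho>' \<le> \<delta>1" "\<rho>' \<le> \<delta>2" using \<delta>1(1) \<delta>2(1) by (auto simp: \<rho>'_def)
  have box: "\<bar>a0 g - a g\<bar> + \<rho>' < \<rho>" if "g \<in> H" for g using \<delta>1(2)[OF \<rho>'(1,2)] that by blast
  show ?thesis
  proof (rule that)
    show "\<rho>' > 0" by (rule \<rho>'(1))
    show "\<bar>a0 g - a g\<bar> + \<rho>' < \<rho>" if "g \<in> H" for g using that by (rule box)
    fix a1 e f f' assume a1: "\<And>g. g \<in> H \<Longrightarrow> \<bar>a1 g - a0 g\<bar> \<le> \<rho>'" and e: "e \<in> \<E>" "f \<in> Fn e" "f' \<in> Fn e" "val f a0 = val f' a0"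
    have "\<bar>a1 g - a g\<bar> < \<rho>" if "g \<in> H" for g using a1[OF that] box[OF that] by linarith
    then have "P a1" by (simp add: P_def)
    \<comment> \<open>In the small box values that differ at a0 stay different, so equality at a1
      implies equality at a0, and on every edge the number of values can only grow.\<close>
    have refine: "val f a0 = val f' a0" if "e \<in> \<E>" "f \<in> Fn e" "f' \<in> Fn e" "val f a1 = val f' a1" for e f f'
    proof (rule ccontr)
      assume ne: "val f a0 \<noteq> val f' a0"
      have "Q (e, f, f') \<rho>'" using \<delta>2(2)[OF \<rho>'(1,3)] that by blast
      then have "(weight f + weight f') * \<rho>' < \<bar>val f a0 - val f' a0\<bar>" using ne by (simp add: Q_def)
      moreover have "\<bar>val f a1 - val f a0\<bar> \<le> weight f * \<rho>'" "\<bar>val f' a1 - val f' a0\<bar> \<le> weight f' * \<rho>'"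
        using Fn[OF that(1)] that(2,3) a1 by (auto intro!: val_lipschitz[of _ H])
      ultimately show False using that(4) by (simp add: distrib_right)
    qed
    have "card ((\<lambda>f. val f a1) ` Fn e) \<le> card ((\<lambda>f. val f a0) ` Fn e)"
    proof (rule ccontr)
      assume less: "\<not> ?thesis"
      \<comment> \<open>No edge loses values and this one gains some, against the maximality of N at
        a0.\<close>
      have "N a0 < N a1"
        unfolding N_def
      proof (rule sum_strict_mono_ex1[OF finite_E])
        show "\<forall>x\<in>\<E>. card ((\<lambda>f. val f a0) ` Fn x) \<le> card ((\<lambda>f. val f a1) ` Fn x)"
        proof
          fix x assume x: "x \<in> \<E>"
          show "card ((\<lambda>f. val f a0) ` Fn x) \<le> card ((\<lambda>f. val f a1) ` Fn x)"
          proof (rule values_refine(1)[of "Fn x" "\<lambda>f. val f a1" "\<lambda>f. val f a0"])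
            show "finite (Fn x)" using Fn[OF x] by (rule conjunct1)
          qed (rule refine[OF x])
        qed
        show "\<exists>x\<in>\<E>. card ((\<lambda>f. val f a0) ` Fn x) < card ((\<lambda>f. val f a1) ` Fn x)"
          using e(1) less by (intro bexI[of _ e]) auto
      qed
      then show False using a0(2)[OF \<open>P a1\<close>] by simp
    qed
    note le = this
    show "val f a1 = val f' a1"
    proof (rule values_refine(2)[of "Fn e" "\<lambda>f. val f a1" "\<lambda>f. val f a0" f f'])
      show "finite (Fn e)" using Fn[OF e(1)] by (rule conjunct1)
    qed (rule refine[OF e(1)], assumption+, rule le, rule e(2), rule e(3), rule e(4))
  qed
qed

lemma independent_family:
  fixes v :: "'b \<Rightarrow> 'c::real_vector"
  assumes "finite H" and zero: "\<And>c g. (\<Sum>g\<in>H. c g *\<^sub>R v g) = 0 \<Longrightarrow> g \<in> H \<Longrightarrow> c g = 0"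
  shows "inj_on v H" "independent (v ` H)"
proof -
  show inj: "inj_on v H"
  proof (rule inj_onI, rule ccontr)
    fix g g' assume g: "g \<in> H" "g' \<in> H" "v g = v g'" "g \<noteq> g'"
    define c where "c k = (if k = g then 1 else 0) - (if k = g' then 1 else (0::real))" for k
    have "(\<Sum>k\<in>H. c k *\<^sub>R v k) = (\<Sum>k\<in>H. (if k = g then v k else 0) - (if k = g' then v k else 0))"
      by (intro sum.cong) (auto simp: c_def)
    also have "\<dots> = v g - v g'" using assms(1) g(1,2) by (simp add: sum_subtractf)
    finally have "(\<Sum>k\<in>H. c k *\<^sub>R v k) = 0" using g(3) by simp
    from zero[OF this g(1)] show False using g(4) by (simp add: c_def)
  qed
  show "independent (v ` H)"
  proof
    assume "dependent (v ` H)"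
    then obtain u where u: "\<exists>w\<in>v ` H. u w \<noteq> 0" "(\<Sum>w\<in>v ` H. u w *\<^sub>R w) = 0"
      using dependent_finite[of "v ` H"] assms(1) by auto
    have "(\<Sum>g\<in>H. u (v g) *\<^sub>R v g) = 0" using u(2) by (simp add: sum.reindex[OF inj])
    then have "u (v g) = 0" if "g \<in> H" for g by (rule zero[of "\<lambda>g. u (v g)", OF _ that])
    then show False using u(1) by auto
  qed
qed

text \<open>Provides one neighbourhood, so that the infimum in \<open>local_dim\<close> is not taken
  over the empty set.\<close>

lemma Sym_space_open:
  "openin (Sym \<Gamma> d) {E. divisor_on \<Gamma> E \<and> effective E \<and> divisor_degree E = int d}"
proof -
  have "(\<Sum>i<d. Poly_Mapping.single (f i) 1) \<in> {E. divisor_on \<Gamma> E \<and> effective E \<and> divisor_degree E = int d}"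
    if "f \<in> {..<d} \<rightarrow>\<^sub>E \<Gamma>" for f
  proof -
    have "divisor_on \<Gamma> (\<Sum>i<d. Poly_Mapping.single (f i) (1::int))"
      using that keys_sum[of "\<lambda>i. Poly_Mapping.single (f i) (1::int)" "{..<d}"] unfolding divisor_on_def by fastforce
    moreover have "effective (\<Sum>i<d. Poly_Mapping.single (f i) 1)"
      by (simp add: effective_def lookup_sum lookup_single when_def sum_nonneg)
    ultimately show ?thesis by (simp add: divisor_degree_sum divisor_degree_single)
  qed
  then have eq: "{f \<in> {..<d} \<rightarrow>\<^sub>E \<Gamma>. (\<Sum>i<d. Poly_Mapping.single (f i) 1) \<in> {E. divisor_on \<Gamma> E \<and> effective E \<and> divisor_degree E = int d}} =
      topspace (product_topology (\<lambda>_. top_of_set \<Gamma>) {..<d})"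
    by auto
  show ?thesis unfolding openin_Sym eq by (intro conjI subset_refl openin_topspace)
qed

section \<open>Divisors of minima with nearby coefficients\<close>

context generated_series
begin

text \<open>The witnesses q can be kept for all nearby coefficients: finitely many strict
  inequalities have a common margin 2 * \<delta>, and two coefficients move by less than \<delta>
  each.\<close>

lemma irredundant_stable:
  assumes "H \<subseteq> G" "irredundant \<Gamma> H a"
  obtains q \<rho> where "\<rho> > 0" "\<And>g. g \<in> H \<Longrightarrow> q g \<in> \<Gamma>"
    "\<And>a1 g k. (\<And>g. g \<in> H \<Longrightarrow> \<bar>a1 g - a g\<bar> < \<rho>) \<Longrightarrow> g \<in> H \<Longrightarrow> k \<in> H \<Longrightarrow> k \<noteq> g \<Longrightarrow> g (q g) + a1 g < k (q g) + a1 k"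
proof -
  have "\<forall>g\<in>H. \<exists>q\<in>\<Gamma>. \<forall>k\<in>H. k \<noteq> g \<longrightarrow> g q + a g < k q + a k" using assms(2) by (simp add: irredundant_def)
  then obtain q where q: "\<And>g. g \<in> H \<Longrightarrow> q g \<in> \<Gamma>" "\<And>g k. g \<in> H \<Longrightarrow> k \<in> H \<Longrightarrow> k \<noteq> g \<Longrightarrow> g (q g) + a g < k (q g) + a k"
    by metis
  have "\<exists>\<delta>>0. \<forall>\<epsilon>. 0 < \<epsilon> \<and> \<epsilon> \<le> \<delta> \<longrightarrow> (\<forall>u\<in>H \<times> H. snd u \<noteq> fst u \<longrightarrow>
      fst u (q (fst u)) + a (fst u) + 2 * \<epsilon> \<le> snd u (q (fst u)) + a (snd u))"
  proof (rule uniform_small)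
    show "finite (H \<times> H)" using finite_sub_G[OF assms(1)] by simp
    fix u assume u: "u \<in> H \<times> H"
    define d where "d = (snd u (q (fst u)) + a (snd u) - (fst u (q (fst u)) + a (fst u))) / 2"
    show "\<exists>\<delta>>0. \<forall>\<epsilon>. 0 < \<epsilon> \<and> \<epsilon> \<le> \<delta> \<longrightarrow> snd u \<noteq> fst u \<longrightarrow>
      fst u (q (fst u)) + a (fst u) + 2 * \<epsilon> \<le> snd u (q (fst u)) + a (snd u)"
    proof (cases "snd u = fst u")
      case False
      then have "d > 0" using q(2)[of "fst u" "snd u"] u by (auto simp: d_def)
      then show ?thesis by (intro exI[of _ d]) (auto simp: d_def field_simps)
    qed (auto intro: exI[of _ 1])
  qed
  then obtain \<delta> where \<delta>: "\<delta> > 0" "\<forall>u\<in>H \<times> H. snd u \<noteq> fst u \<longrightarrow>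
      fst u (q (fst u)) + a (fst u) + 2 * \<delta> \<le> snd u (q (fst u)) + a (snd u)" by blast
  show ?thesis
  proof (rule that)
    show "\<delta> > 0" by (rule \<delta>(1))
    show "q g \<in> \<Gamma>" if "g \<in> H" for g using that by (rule q(1))
    fix a1 g k assume *: "\<And>g. g \<in> H \<Longrightarrow> \<bar>a1 g - a g\<bar> < \<delta>" "g \<in> H" "k \<in> H" "k \<noteq> g"
    have "g (q g) + a g + 2 * \<delta> \<le> k (q g) + a k" using bspec[OF \<delta>(2), of "(g, k)"] *(2-4) by simp
    then show "g (q g) + a1 g < k (q g) + a1 k" using *(1)[OF *(2)] *(1)[OF *(3)] by linarith
  qed
qed

text \<open>Equal divisors mean that the functions differ by a constant, by
  \<open>pl_div_inj\<close>. At q g the term g is minimal for both coefficient vectors, so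
  evaluation there compares a1 g with a2 g.\<close>

lemma coefficients_determined:
  assumes "H \<subseteq> G" "H \<noteq> {}" "pl_div \<Gamma> (tcomb \<Gamma> H a1) = pl_div \<Gamma> (tcomb \<Gamma> H a2)"
    and q: "\<And>g. g \<in> H \<Longrightarrow> q g \<in> \<Gamma>"
    "\<And>g k. g \<in> H \<Longrightarrow> k \<in> H \<Longrightarrow> k \<noteq> g \<Longrightarrow> g (q g) + a1 g < k (q g) + a1 k"
    "\<And>g k. g \<in> H \<Longrightarrow> k \<in> H \<Longrightarrow> k \<noteq> g \<Longrightarrow> g (q g) + a2 g < k (q g) + a2 k"
  obtains c where "\<And>g. g \<in> H \<Longrightarrow> a1 g = a2 g + c"
proof -
  have PL: "tcomb \<Gamma> H a \<in> PL \<Gamma>" for a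
    by (rule \<Sigma>_PL[OF tcomb_in[OF assms(1,2)]])
  obtain c where c: "\<forall>x\<in>\<Gamma>. tcomb \<Gamma> H a1 x = tcomb \<Gamma> H a2 x + c"
    using pl_div_inj[OF connected PL PL assms(3)] ..
  show ?thesis
  proof (rule that)
    fix g assume g: "g \<in> H"
    have "q g \<in> region H a1 g" "q g \<in> region H a2 g" using q g by (simp_all add: region_def)
    then have "tcomb \<Gamma> H a1 (q g) = g (q g) + a1 g" "tcomb \<Gamma> H a2 (q g) = g (q g) + a2 g"
      using region_tcomb[OF assms(1) g] by blast+
    then show "a1 g = a2 g + c" using bspec[OF c q(1)[OF g]] by linarith
  qed
qed

definition positions :: "('a \<Rightarrow>\<^sub>0 int) \<Rightarrow> ('a edge \<times> real) set" where
  "positions E = {(e, t). e \<in> \<E> \<and> 0 < t \<and> t < fst e \<and> snd e t \<in> Poly_Mapping.keys E}"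

lemma positions_inj: "inj_on (\<lambda>(e, t). snd e t) (positions E)"
proof (rule inj_onI)
  fix u w assume *: "u \<in> positions E" "w \<in> positions E" "(\<lambda>(e, t). snd e t) u = (\<lambda>(e, t). snd e t) w"
  obtain e t e' t' where uw: "u = (e, t)" "w = (e', t')" by (cases u, cases w)
  have "e = e' \<and> t = t'"
    by (rule edge_point_unique) (use * in \<open>simp_all add: uw positions_def\<close>)
  then show "u = w" by (simp add: uw)
qed

lemma positions_image:
  assumes "Poly_Mapping.keys E \<subseteq> \<Gamma>"
  shows "(\<lambda>(e, t). snd e t) ` positions E = Poly_Mapping.keys E - V"
proof (intro equalityI subsetI)
  fix p assume p: "p \<in> Poly_Mapping.keys E - V"
  then have "p \<in> \<Gamma>" using assms by blast
  then show "p \<in> (\<lambda>(e, t). snd e t) ` positions E"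
  proof (cases rule: point_cases)
    case (2 e t)
    then have "(e, t) \<in> positions E" using p by (simp add: positions_def)
    then show ?thesis using 2(4) by (intro image_eqI[of _ _ "(e, t)"]) simp_all
  qed (use p in simp)
qed (auto simp: positions_def dest: edge_interior_not_V)

lemma keys_in: "\<theta> \<in> \<Sigma> \<Longrightarrow> Poly_Mapping.keys (D + pl_div \<Gamma> \<theta>) \<subseteq> \<Gamma>"
  using D_on pl_div_support[OF \<Sigma>_epl, of \<theta>] Poly_Mapping.keys_add[of D "pl_div \<Gamma> \<theta>"]
  unfolding divisor_on_def by blast

text \<open>Near generic coefficients the combinatorial type of the divisor is constant. A support
  point of E a1 inside an edge is the value at a1 of some functional f and lies close to a support
  point of E a0. Since distinct values at a0 are far apart, f had exactly the old position as its
  value at a0, and by \<open>stable\<close> it agrees with the functional chosen for that position.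
  So each support point of E a0 has a single successor, which inherits its multiplicity because the
  mass in the ball is conserved.\<close>

lemma moving_divisor:
  fixes Fn :: "'a edge \<Rightarrow> 'a functional set"
  assumes H: "H \<subseteq> G" "H \<noteq> {}" and "\<rho>' > 0"
    and Fn: "\<And>e. e \<in> \<E> \<Longrightarrow> finite (Fn e) \<and> Fn e \<subseteq> UNIV \<times> UNIV \<times> H \<times> H"
    and brk: "\<And>e a. e \<in> \<E> \<Longrightarrow> paffine (tcomb \<Gamma> H a) e ((\<lambda>f. val f a) ` Fn e)"
    and const: "\<And>e z. e \<in> \<E> \<Longrightarrow> z \<in> {0, fst e} \<union> {t \<in> {0..fst e}. snd e t \<in> Poly_Mapping.keys D} \<Longrightarrow> \<exists>f\<in>Fn e. \<forall>a. val f a = z"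
    and stable: "\<And>a1 e f f'. (\<And>g. g \<in> H \<Longrightarrow> \<bar>a1 g - a0 g\<bar> \<le> \<rho>') \<Longrightarrow> e \<in> \<E> \<Longrightarrow> f \<in> Fn e \<Longrightarrow> f' \<in> Fn e \<Longrightarrow>
       val f a0 = val f' a0 \<Longrightarrow> val f a1 = val f' a1"
  defines "E \<equiv> \<lambda>a. D + pl_div \<Gamma> (tcomb \<Gamma> H a)"
  obtains \<rho> sel where "\<rho> > 0" "\<rho> \<le> \<rho>'"
    "\<And>e t. (e, t) \<in> positions (E a0) \<Longrightarrow> sel e t \<in> Fn e"
    "\<And>a1 e t. (\<And>g. g \<in> H \<Longrightarrow> \<bar>a1 g - a0 g\<bar> \<le> \<rho>) \<Longrightarrow> (e, t) \<in> positions (E a0) \<Longrightarrow>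
       0 < val (sel e t) a1 \<and> val (sel e t) a1 < fst e"
    "\<And>a1 e t t'. (\<And>g. g \<in> H \<Longrightarrow> \<bar>a1 g - a0 g\<bar> \<le> \<rho>) \<Longrightarrow> (e, t) \<in> positions (E a0) \<Longrightarrow> (e, t') \<in> positions (E a0) \<Longrightarrow> t < t' \<Longrightarrow>
       val (sel e t) a1 < val (sel e t') a1"
    "\<And>a1. (\<And>g. g \<in> H \<Longrightarrow> \<bar>a1 g - a0 g\<bar> \<le> \<rho>) \<Longrightarrow>
       E a1 = (\<Sum>p\<in>V. Poly_Mapping.single p (Poly_Mapping.lookup (E a0) p)) +
         (\<Sum>(e, t)\<in>positions (E a0). Poly_Mapping.single (snd e (val (sel e t) a1)) (Poly_Mapping.lookup (E a0) (snd e t)))"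
proof -
  let ?K = "Poly_Mapping.keys (E a0)" and ?pos = "positions (E a0)"
  have in\<Sigma>: "tcomb \<Gamma> H a \<in> \<Sigma>" for a by (rule tcomb_in[OF H])
  have "finite H" by (rule finite_sub_G[OF H(1)])
  have K\<Gamma>: "Poly_Mapping.keys (E a) \<subseteq> \<Gamma>" for a unfolding E_def by (rule keys_in[OF in\<Sigma>])
  have hit: "\<exists>f\<in>Fn e. val f a = t" if e: "e \<in> \<E>" "0 < t" "t < fst e" "snd e t \<in> Poly_Mapping.keys (E a)" for e t a
  proof -
    have "snd e t \<in> Poly_Mapping.keys D \<or> t \<in> (\<lambda>f. val f a) ` Fn e"
      using Fn[OF e(1)] e(4) brk[OF e(1)]
      by (intro support_in_breaks[OF \<Sigma>_epl[OF in\<Sigma>] e(1-3)]) (auto simp: E_def in_keys_iff)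
    then show ?thesis
    proof
      assume "snd e t \<in> Poly_Mapping.keys D"
      then have "t \<in> {0, fst e} \<union> {t \<in> {0..fst e}. snd e t \<in> Poly_Mapping.keys D}" using e by simp
      from const[OF e(1) this] show ?thesis by blast
    qed blast
  qed
  \<comment> \<open>Any choice is as good: by \<open>stable\<close>, functionals with a common value
    at a0 agree in the whole box.\<close>
  define sel where "sel e t = (SOME f. f \<in> Fn e \<and> val f a0 = t)" for e t
  have sel: "sel e t \<in> Fn e" "val (sel e t) a0 = t" if "(e, t) \<in> ?pos" for e t
  proof -
    have "\<exists>f. f \<in> Fn e \<and> val f a0 = t" using hit[of e t a0] that by (auto simp: positions_def)
    from someI_ex[OF this] show "sel e t \<in> Fn e" "val (sel e t) a0 = t" by (auto simp: sel_def)
  qed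
  have window_small: "\<exists>\<delta>>0. \<forall>\<epsilon>. 0 < \<epsilon> \<and> \<epsilon> \<le> \<delta> \<longrightarrow> (\<exists>\<eta>>0. \<forall>\<theta>\<in>R \<Gamma> D. (\<forall>x\<in>\<Gamma>. \<bar>\<theta> x - tcomb \<Gamma> H a0 x\<bar> < \<eta>) \<longrightarrow>
    window (E a0) (D + pl_div \<Gamma> \<theta>) \<epsilon>)"
    unfolding E_def using \<Sigma>_R in\<Sigma> by (intro window_stable D_on) blast
  have near_all: "\<exists>\<delta>>0. \<forall>\<epsilon>. 0 < \<epsilon> \<and> \<epsilon> \<le> \<delta> \<longrightarrow> (\<forall>p\<in>?K. \<forall>e\<in>\<E>. near p e \<epsilon>)"
    by (rule uniform_small) (simp, rule near_small)
  have vertex_far: "\<exists>\<delta>>0. \<forall>\<epsilon>. 0 < \<epsilon> \<and> \<epsilon> \<le> \<delta> \<longrightarrow> (\<forall>u\<in>?K \<times> V. fst u \<noteq> snd u \<longrightarrow> \<epsilon> \<le> dist (fst u) (snd u))"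
  proof (rule uniform_small)
    show "finite (?K \<times> V)" using finite_V by simp
    fix u :: "'a \<times> 'a"
    show "\<exists>\<delta>>0. \<forall>\<epsilon>. 0 < \<epsilon> \<and> \<epsilon> \<le> \<delta> \<longrightarrow> fst u \<noteq> snd u \<longrightarrow> \<epsilon> \<le> dist (fst u) (snd u)"
      by (cases "fst u = snd u") (auto intro: exI[of _ 1] exI[of _ "dist (fst u) (snd u)"])
  qed
  define Q where "Q = (\<lambda>(e :: 'a edge, f :: 'a functional, f' :: 'a functional) \<epsilon>.
      val f a0 \<noteq> val f' a0 \<longrightarrow> 2 * \<epsilon> \<le> \<bar>val f a0 - val f' a0\<bar>)"
  have "\<exists>\<delta>>0. \<forall>\<epsilon>. 0 < \<epsilon> \<and> \<epsilon> \<le> \<delta> \<longrightarrow> (\<forall>u\<in>Sigma \<E> (\<lambda>e. Fn e \<times> Fn e). Q u \<epsilon>)"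
  proof (rule uniform_small)
    show "finite (Sigma \<E> (\<lambda>e. Fn e \<times> Fn e))" using finite_E Fn by auto
    fix u :: "'a edge \<times> 'a functional \<times> 'a functional"
    obtain e f f' where u: "u = (e, f, f')" by (cases u)
    show "\<exists>\<delta>>0. \<forall>\<epsilon>. 0 < \<epsilon> \<and> \<epsilon> \<le> \<delta> \<longrightarrow> Q u \<epsilon>"
    proof (cases "val f a0 = val f' a0")
      case False
      then show ?thesis
        unfolding Q_def u by (intro exI[of _ "\<bar>val f a0 - val f' a0\<bar> / 2"]) auto
    qed (auto simp: Q_def u intro: exI[of _ 1])
  qed
  then obtain \<delta>5 where \<delta>5: "\<delta>5 > 0" "\<And>\<epsilon>. 0 < \<epsilon> \<and> \<epsilon> \<le> \<delta>5 \<Longrightarrow> (\<forall>u\<in>Sigma \<E> (\<lambda>e. Fn e \<times> Fn e). Q u \<epsilon>)" by blast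
  obtain \<delta>1 where \<delta>1: "\<delta>1 > 0" "\<And>\<epsilon>. 0 < \<epsilon> \<and> \<epsilon> \<le> \<delta>1 \<Longrightarrow> (\<exists>\<eta>>0. \<forall>\<theta>\<in>R \<Gamma> D. (\<forall>x\<in>\<Gamma>. \<bar>\<theta> x - tcomb \<Gamma> H a0 x\<bar> < \<eta>) \<longrightarrow>
      window (E a0) (D + pl_div \<Gamma> \<theta>) \<epsilon>)" using window_small by blast
  obtain \<delta>2 where \<delta>2: "\<delta>2 > 0" "\<And>\<epsilon>. 0 < \<epsilon> \<and> \<epsilon> \<le> \<delta>2 \<Longrightarrow> (\<forall>p\<in>?K. \<forall>e\<in>\<E>. near p e \<epsilon>)" using near_all by blast
  obtain \<delta>3 where \<delta>3: "\<delta>3 > 0" "\<And>\<epsilon>. 0 < \<epsilon> \<and> \<epsilon> \<le> \<delta>3 \<Longrightarrow> (\<forall>u\<in>?K \<times> V. fst u \<noteq> snd u \<longrightarrow> \<epsilon> \<le> dist (fst u) (snd u))"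
    using vertex_far by blast
  obtain \<delta>4 where \<delta>4: "\<delta>4 > 0" "\<And>\<epsilon>. 0 < \<epsilon> \<and> \<epsilon> \<le> \<delta>4 \<Longrightarrow> (\<forall>p\<in>?K. \<forall>q\<in>?K. p \<noteq> q \<longrightarrow> 2 * \<epsilon> \<le> dist p q)"
    using keys_separated[of "E a0"] by blast
  \<comment> \<open>The five scales are, in this order, for conservation of mass, edges near support
    points, distance of the support to other vertices, disjoint balls, and separation of functional
    values.\<close>
  define \<epsilon> where "\<epsilon> = min \<delta>1 (min \<delta>2 (min \<delta>3 (min \<delta>4 \<delta>5)))"
  have \<epsilon>: "0 < \<epsilon>" "0 < \<epsilon> \<and> \<epsilon> \<le> \<delta>1" "0 < \<epsilon> \<and> \<epsilon> \<le> \<delta>2" "0 < \<epsilon> \<and> \<epsilon> \<le> \<delta>3" "0 < \<epsilon> \<and> \<epsilon> \<le> \<delta>4" "0 < \<epsilon> \<and> \<epsilon> \<le> \<delta>5"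
    using \<delta>1(1) \<delta>2(1) \<delta>3(1) \<delta>4(1) \<delta>5(1) by (auto simp: \<epsilon>_def)
  obtain \<eta> where \<eta>: "\<eta> > 0" "\<And>\<theta>. \<theta> \<in> R \<Gamma> D \<Longrightarrow> (\<And>x. x \<in> \<Gamma> \<Longrightarrow> \<bar>\<theta> x - tcomb \<Gamma> H a0 x\<bar> < \<eta>) \<Longrightarrow>
      window (E a0) (D + pl_div \<Gamma> \<theta>) \<epsilon>"
    using \<delta>1(2)[OF \<epsilon>(2)] by blast
  have apart: "2 * \<epsilon> \<le> \<bar>val f a0 - val f' a0\<bar>" if "e \<in> \<E>" "f \<in> Fn e" "f' \<in> Fn e" "val f a0 \<noteq> val f' a0" for e f f'
  proof -
    have "Q (e, f, f') \<epsilon>" using \<delta>5(2)[OF \<epsilon>(6)] that(1-3) by blast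
    then show ?thesis using that(4) by (simp add: Q_def)
  qed
  have "\<exists>\<delta>>0. \<forall>\<rho>. 0 < \<rho> \<and> \<rho> \<le> \<delta> \<longrightarrow> (\<forall>u\<in>Sigma \<E> Fn. weight (snd u) * \<rho> < \<epsilon>)"
    using finite_E Fn by (intro uniform_small small_multiple weight_nonneg \<epsilon>(1)) auto
  then obtain \<delta>6 where \<delta>6: "\<delta>6 > 0" "\<And>\<rho>. 0 < \<rho> \<and> \<rho> \<le> \<delta>6 \<Longrightarrow> (\<forall>u\<in>Sigma \<E> Fn. weight (snd u) * \<rho> < \<epsilon>)"
    by blast
  define \<rho> where "\<rho> = min \<rho>' (min \<delta>6 (\<eta> / 2))"
  have \<rho>: "\<rho> > 0" "\<rho> \<le> \<rho>'" "0 < \<rho> \<and> \<rho> \<le> \<delta>6" "\<rho> < \<eta>" using \<open>\<rho>' > 0\<close> \<delta>6(1) \<eta>(1) by (auto simp: \<rho>_def)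
  have move: "\<bar>val f a1 - val f a0\<bar> < \<epsilon>"
    if "\<And>g. g \<in> H \<Longrightarrow> \<bar>a1 g - a0 g\<bar> \<le> \<rho>" "e \<in> \<E>" "f \<in> Fn e" for a1 e f
  proof -
    have "\<bar>val f a1 - val f a0\<bar> \<le> weight f * \<rho>"
      by (rule val_lipschitz[of _ H]) (use Fn[OF that(2)] that in auto)
    moreover have "weight f * \<rho> < \<epsilon>" using \<delta>6(2)[OF \<rho>(3)] that(2,3) by force
    ultimately show ?thesis by simp
  qed
  have box': "\<bar>a1 g - a0 g\<bar> \<le> \<rho>'" if "\<And>g. g \<in> H \<Longrightarrow> \<bar>a1 g - a0 g\<bar> \<le> \<rho>" "g \<in> H" for a1 g
    using that(1)[OF that(2)] \<rho>(2) by linarith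
  have claim: "(p \<in> V \<and> x = p) \<or> (\<exists>e t. (e, t) \<in> ?pos \<and> p = snd e t \<and> x = snd e (val (sel e t) a1) \<and>
      0 < val (sel e t) a1 \<and> val (sel e t) a1 < fst e)"
    if a1: "\<And>g. g \<in> H \<Longrightarrow> \<bar>a1 g - a0 g\<bar> \<le> \<rho>" and x: "x \<in> Poly_Mapping.keys (E a1)" and p: "p \<in> ?K" "dist p x < \<epsilon>" for a1 x p
  proof -
    have "x \<in> \<Gamma>" using x K\<Gamma> by blast
    then show ?thesis
    proof (cases rule: point_cases)
      case 1
      have "p = x"
      proof (rule ccontr)
        assume "p \<noteq> x"
        then have "\<epsilon> \<le> dist p x" using bspec[OF \<delta>3(2)[OF \<epsilon>(4)], of "(p, x)"] p(1) 1 by simp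
        then show False using p(2) by simp
      qed
      then show ?thesis using 1 by simp
    next
      case (2 e t)
      obtain f where f: "f \<in> Fn e" "val f a1 = t" using hit[OF 2(1-3), of a1] x 2(4) by blast
      have "near p e \<epsilon>" using \<delta>2(2)[OF \<epsilon>(3)] p(1) 2(1) by blast
      moreover have "\<not> (\<forall>t\<in>{0..fst e}. \<epsilon> \<le> dist p (snd e t))"
        using p(2) 2 by (auto simp: not_le intro!: bexI[of _ t])
      ultimately obtain t0 where t0: "t0 \<in> {0..fst e}" "snd e t0 = p"
        "\<And>t. t \<in> {0..fst e} \<Longrightarrow> dist p (snd e t) < \<epsilon> \<Longrightarrow> dist p (snd e t) = \<bar>t - t0\<bar>"
        unfolding near_def by blast
      have "dist p (snd e t) = \<bar>t - t0\<bar>" using 2 p(2) by (intro t0(3)) auto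
      then have d: "\<bar>t - t0\<bar> < \<epsilon>" using p(2) 2(4) by simp
      \<comment> \<open>f moves by less than \<epsilon> between a0 and a1, and t is within
        \<epsilon> of t0; so \<open>val f a0\<close> is within 2 * \<epsilon> of t0 and must equal
        it.\<close>
      have near0: "val f a1 = val f0 a1" if f0: "f0 \<in> Fn e" "val f0 a0 = t0" for f0
      proof (rule stable[OF box'[OF a1] 2(1) f(1) f0(1)])
        show "val f a0 = val f0 a0"
        proof (rule ccontr)
          assume "val f a0 \<noteq> val f0 a0"
          then have "2 * \<epsilon> \<le> \<bar>val f a0 - t0\<bar>" using apart[OF 2(1) f(1) f0(1)] f0(2) by simp
          moreover have "\<bar>t - val f a0\<bar> < \<epsilon>" using move[OF a1 2(1) f(1)] f(2) by simp
          ultimately show False using d by linarith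
        qed
      qed
      \<comment> \<open>No point leaves a vertex: an end of e is the value of a constant functional,
        with which f would agree, putting t at that end.\<close>
      have "t0 \<noteq> 0 \<and> t0 \<noteq> fst e"
      proof (rule ccontr)
        assume "\<not> ?thesis"
        then have "t0 \<in> {0, fst e} \<union> {t \<in> {0..fst e}. snd e t \<in> Poly_Mapping.keys D}" by blast
        from const[OF 2(1) this] obtain f0 where f0: "f0 \<in> Fn e" "\<forall>a. val f0 a = t0" ..
        then have "t = t0" using near0[of f0] f(2) by simp
        then show False using \<open>\<not> (t0 \<noteq> 0 \<and> t0 \<noteq> fst e)\<close> 2(2,3) by auto
      qed
      then have pos: "(e, t0) \<in> ?pos" using t0(1,2) p(1) 2(1) by (simp add: positions_def)
      have "t = val (sel e t0) a1" using near0[OF sel[OF pos]] f(2) by simp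
      then show ?thesis using pos t0(2) 2(2-4) by blast
    qed
  qed
  \<comment> \<open>The successor of p: vertices stay, points inside edges follow their
    functional.\<close>
  define mv where "mv a1 p = (if p \<in> V then p else
      (case the_inv_into ?pos (\<lambda>(e, t). snd e t) p of (e, t) \<Rightarrow> snd e (val (sel e t) a1)))" for a1 p
  have mv_pos: "mv a1 (snd e t) = snd e (val (sel e t) a1)" if "(e, t) \<in> ?pos" for a1 e t
  proof -
    have "snd e t \<notin> V" using that edge_interior_not_V by (simp add: positions_def)
    moreover have "the_inv_into ?pos (\<lambda>(e, t). snd e t) (snd e t) = (e, t)"
      using the_inv_into_f_f[OF positions_inj that] by simp
    ultimately show ?thesis by (simp add: mv_def)
  qed
  have mv_eq: "x = mv a1 p"
    if "\<And>g. g \<in> H \<Longrightarrow> \<bar>a1 g - a0 g\<bar> \<le> \<rho>" "x \<in> Poly_Mapping.keys (E a1)" "p \<in> ?K" "dist p x < \<epsilon>" for a1 x p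
    using claim[OF that]
  proof
    assume "p \<in> V \<and> x = p" then show ?thesis by (simp add: mv_def)
  next
    assume "\<exists>e t. (e, t) \<in> ?pos \<and> p = snd e t \<and> x = snd e (val (sel e t) a1) \<and>
      0 < val (sel e t) a1 \<and> val (sel e t) a1 < fst e"
    then obtain e t where "(e, t) \<in> ?pos" "p = snd e t" "x = snd e (val (sel e t) a1)" by blast
    then show ?thesis by (simp only: mv_pos)
  qed
  have win: "window (E a0) (E a1) \<epsilon>" if a1: "\<And>g. g \<in> H \<Longrightarrow> \<bar>a1 g - a0 g\<bar> \<le> \<rho>" for a1
  proof -
    have "\<bar>tcomb \<Gamma> H a1 x - tcomb \<Gamma> H a0 x\<bar> < \<eta>" if "x \<in> \<Gamma>" for x
    proof -
      have "\<bar>tmin H a1 x - tmin H a0 x\<bar> \<le> \<rho>"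
        by (rule tmin_perturb[OF \<open>finite H\<close> H(2)]) (rule a1)
      then show ?thesis using \<rho>(4) by (simp add: tcomb_apply that)
    qed
    moreover have "tcomb \<Gamma> H a1 \<in> R \<Gamma> D" using \<Sigma>_R in\<Sigma> by blast
    ultimately show ?thesis using \<eta>(2)[of "tcomb \<Gamma> H a1"] by (simp add: E_def)
  qed
  have mv_val: "mv a1 p \<in> Poly_Mapping.keys (E a1) \<and> dist p (mv a1 p) < \<epsilon> \<and>
      Poly_Mapping.lookup (E a1) (mv a1 p) = Poly_Mapping.lookup (E a0) p"
    if a1: "\<And>g. g \<in> H \<Longrightarrow> \<bar>a1 g - a0 g\<bar> \<le> \<rho>" and p: "p \<in> ?K" for a1 p
  proof -
    let ?B = "Poly_Mapping.keys (E a1) \<inter> ball p \<epsilon>"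
    have sum: "(\<Sum>x\<in>?B. Poly_Mapping.lookup (E a1) x) = Poly_Mapping.lookup (E a0) p"
      using win[OF a1] p unfolding window_def by blast
    have "Poly_Mapping.lookup (E a0) p \<noteq> 0" using p by (simp add: in_keys_iff)
    then have "?B \<noteq> {}" using sum by auto
    moreover have "?B \<subseteq> {mv a1 p}" using mv_eq[OF a1 _ p] by auto
    ultimately have B: "?B = {mv a1 p}" by blast
    then have "Poly_Mapping.lookup (E a1) (mv a1 p) = Poly_Mapping.lookup (E a0) p" using sum by simp
    moreover have "mv a1 p \<in> ?B" using B by blast
    ultimately show ?thesis by simp
  qed
  have interior: "0 < val (sel e t) a1 \<and> val (sel e t) a1 < fst e"
    if a1: "\<And>g. g \<in> H \<Longrightarrow> \<bar>a1 g - a0 g\<bar> \<le> \<rho>" and pos: "(e, t) \<in> ?pos" for a1 e t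
  proof -
    have p: "snd e t \<in> ?K" "snd e t \<notin> V" using pos edge_interior_not_V by (simp_all add: positions_def)
    obtain e' t' where e': "(e', t') \<in> ?pos" "snd e t = snd e' t'" "0 < val (sel e' t') a1" "val (sel e' t') a1 < fst e'"
      using claim[OF a1, of "mv a1 (snd e t)" "snd e t"] mv_val[OF a1 p(1)] p by blast
    have "(e, t) = (e', t')" by (rule inj_onD[OF positions_inj _ pos e'(1)]) (use e'(2) in simp)
    then show ?thesis using e'(3,4) by simp
  qed
  have order: "val (sel e t) a1 < val (sel e t') a1"
    if a1: "\<And>g. g \<in> H \<Longrightarrow> \<bar>a1 g - a0 g\<bar> \<le> \<rho>" and pos: "(e, t) \<in> ?pos" "(e, t') \<in> ?pos" "t < t'" for a1 e t t'
  proof -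
    have e: "e \<in> \<E>" using pos(1) by (simp add: positions_def)
    have "2 * \<epsilon> \<le> \<bar>t - t'\<bar>"
      using apart[OF e sel(1)[OF pos(1)] sel(1)[OF pos(2)]] sel(2)[OF pos(1)] sel(2)[OF pos(2)] pos(3) by simp
    moreover have "\<bar>val (sel e t) a1 - t\<bar> < \<epsilon>" "\<bar>val (sel e t') a1 - t'\<bar> < \<epsilon>"
      using move[OF a1 e sel(1)[OF pos(1)]] move[OF a1 e sel(1)[OF pos(2)]] sel(2)[OF pos(1)] sel(2)[OF pos(2)] by simp_all
    ultimately show ?thesis using pos(3) by linarith
  qed
  have expand: "E a1 = (\<Sum>p\<in>V. Poly_Mapping.single p (Poly_Mapping.lookup (E a0) p)) +
         (\<Sum>(e, t)\<in>?pos. Poly_Mapping.single (snd e (val (sel e t) a1)) (Poly_Mapping.lookup (E a0) (snd e t)))"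
    if a1: "\<And>g. g \<in> H \<Longrightarrow> \<bar>a1 g - a0 g\<bar> \<le> \<rho>" for a1
  proof -
    have "E a1 = (\<Sum>p\<in>?K. Poly_Mapping.single (mv a1 p) (Poly_Mapping.lookup (E a0) p))"
    proof (rule poly_mapping_eqI)
      fix x
      have l: "Poly_Mapping.lookup (\<Sum>p\<in>?K. Poly_Mapping.single (mv a1 p) (Poly_Mapping.lookup (E a0) p)) x =
          (\<Sum>p\<in>?K. if mv a1 p = x then Poly_Mapping.lookup (E a0) p else 0)"
        by (simp only: lookup_sum lookup_single when_def)
      show "Poly_Mapping.lookup (E a1) x =
          Poly_Mapping.lookup (\<Sum>p\<in>?K. Poly_Mapping.single (mv a1 p) (Poly_Mapping.lookup (E a0) p)) x"
      proof (cases "x \<in> Poly_Mapping.keys (E a1)")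
        case True
        then obtain p where p: "p \<in> ?K" "dist p x < \<epsilon>"
          using win[OF a1] unfolding window_def by auto
        have "(\<Sum>p\<in>?K. if mv a1 p = x then Poly_Mapping.lookup (E a0) p else 0) =
            (\<Sum>p\<in>{p}. if mv a1 p = x then Poly_Mapping.lookup (E a0) p else 0)"
        proof (rule sum.mono_neutral_right)
          show "\<forall>q\<in>?K - {p}. (if mv a1 q = x then Poly_Mapping.lookup (E a0) q else 0) = 0"
          proof
            fix q assume q: "q \<in> ?K - {p}"
            have "mv a1 q \<noteq> x"
            proof
              assume "mv a1 q = x"
              then have "dist q x < \<epsilon>" using mv_val[OF a1, of q] q by simp
              then have "dist p q < 2 * \<epsilon>" using p(2) dist_triangle_half_l[of p x "2 * \<epsilon>" q] by simp
              moreover have "2 * \<epsilon> \<le> dist p q"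
                using bspec[OF bspec[OF \<delta>4(2)[OF \<epsilon>(5)] p(1)], of q] q by auto
              ultimately show False by simp
            qed
            then show "(if mv a1 q = x then Poly_Mapping.lookup (E a0) q else 0) = 0" by simp
          qed
        qed (use p(1) in auto)
        also have "\<dots> = Poly_Mapping.lookup (E a1) x"
          using mv_eq[OF a1 True p] mv_val[OF a1 p(1)] by simp
        finally show ?thesis unfolding l by simp
      next
        case False
        have "(\<Sum>p\<in>?K. if mv a1 p = x then Poly_Mapping.lookup (E a0) p else 0) = 0"
        proof (rule sum.neutral, rule ballI)
          fix p assume "p \<in> ?K"
          then have "mv a1 p \<noteq> x" using mv_val[OF a1, of p] False by blast
          then show "(if mv a1 p = x then Poly_Mapping.lookup (E a0) p else 0) = 0" by simp
        qed
        then show ?thesis unfolding l using False by (simp add: in_keys_iff)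
      qed
    qed
    also have "\<dots> = (\<Sum>p\<in>?K \<inter> V. Poly_Mapping.single (mv a1 p) (Poly_Mapping.lookup (E a0) p)) +
        (\<Sum>p\<in>?K - V. Poly_Mapping.single (mv a1 p) (Poly_Mapping.lookup (E a0) p))"
      by (rule sum.Int_Diff) simp
    also have "(\<Sum>p\<in>?K \<inter> V. Poly_Mapping.single (mv a1 p) (Poly_Mapping.lookup (E a0) p)) =
        (\<Sum>p\<in>V. Poly_Mapping.single p (Poly_Mapping.lookup (E a0) p))"
      using finite_V by (intro sum.mono_neutral_cong_left) (auto simp: mv_def in_keys_iff)
    also have "(\<Sum>p\<in>?K - V. Poly_Mapping.single (mv a1 p) (Poly_Mapping.lookup (E a0) p)) =
        (\<Sum>u\<in>?pos. Poly_Mapping.single (mv a1 (case u of (e, t) \<Rightarrow> snd e t)) (Poly_Mapping.lookup (E a0) (case u of (e, t) \<Rightarrow> snd e t)))"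
      unfolding positions_image[OF K\<Gamma>, symmetric] by (subst sum.reindex[OF positions_inj]) (simp add: comp_def)
    also have "\<dots> = (\<Sum>(e, t)\<in>?pos. Poly_Mapping.single (snd e (val (sel e t) a1)) (Poly_Mapping.lookup (E a0) (snd e t)))"
    proof (intro sum.cong refl)
      fix u assume u: "u \<in> ?pos"
      obtain e t where et: "u = (e, t)" by (cases u)
      show "Poly_Mapping.single (mv a1 (case u of (e, t) \<Rightarrow> snd e t)) (Poly_Mapping.lookup (E a0) (case u of (e, t) \<Rightarrow> snd e t)) =
          (case u of (e, t) \<Rightarrow> Poly_Mapping.single (snd e (val (sel e t) a1)) (Poly_Mapping.lookup (E a0) (snd e t)))"
        using u unfolding et prod.case by (simp only: mv_pos)
    qed
    finally show ?thesis .
  qed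
  show ?thesis
    by (rule that[of \<rho> sel]) (fact \<rho>(1), fact \<rho>(2), fact sel(1), fact interior, fact order, fact expand)
qed

section \<open>The local dimension\<close>

text \<open>Near generic coefficients the face coordinates X are affine in the coefficients, so the
  image C of a box is convex and lies in one face, over divisors in S. Moving each coefficient but
  that of i0 gives card H - 1 directions. A linear relation between them would yield two coefficient
  vectors that agree at i0 and have the same divisor, and by \<open>coefficients_determined\<close>
  these are equal. So C contains a simplex with card H vertices.\<close>

lemma local_simplex:
  assumes H: "H \<subseteq> G" "H \<noteq> {}" "irredundant \<Gamma> H a"
    and near: "\<eta> > 0" "\<And>x. x \<in> \<Gamma> \<Longrightarrow> \<bar>tcomb \<Gamma> H a x - \<phi> x\<bar> < \<eta> / 2"
    and S: "\<And>\<theta>. \<theta> \<in> \<Sigma> \<Longrightarrow> (\<And>x. x \<in> \<Gamma> \<Longrightarrow> \<bar>\<theta> x - \<phi> x\<bar> < \<eta>) \<Longrightarrow> D + pl_div \<Gamma> \<theta> \<in> S"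
  shows "\<exists>m \<mu> W. (\<forall>e\<in>\<E>. 0 \<notin> set (\<mu> e)) \<and> finite W \<and> card W = card H \<and> \<not> affine_dependent W \<and>
    convex hull W \<subseteq> face_coords \<E> \<mu> \<and> face_point V \<E> m \<mu> ` (convex hull W) \<subseteq> S"
proof -
  have "finite H" by (rule finite_sub_G[OF H(1)])
  obtain q \<rho>1 where q: "\<rho>1 > 0" "\<And>g. g \<in> H \<Longrightarrow> q g \<in> \<Gamma>"
    "\<And>a1 g k. (\<And>g. g \<in> H \<Longrightarrow> \<bar>a1 g - a g\<bar> < \<rho>1) \<Longrightarrow> g \<in> H \<Longrightarrow> k \<in> H \<Longrightarrow> k \<noteq> g \<Longrightarrow> g (q g) + a1 g < k (q g) + a1 k"
    using irredundant_stable[OF H(1,3)] by metis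
  \<comment> \<open>\<rho>1 keeps the witnesses q valid, and \<eta> / 2 keeps the function within
    \<eta> of \<phi>.\<close>
  define \<rho>0 where "\<rho>0 = min \<rho>1 (\<eta> / 2)"
  have \<rho>0: "\<rho>0 > 0" "\<rho>0 \<le> \<rho>1" "\<rho>0 \<le> \<eta> / 2" using q(1) near(1) by (auto simp: \<rho>0_def)
  define Z where "Z e = {0, fst e} \<union> {t \<in> {0..fst e}. snd e t \<in> Poly_Mapping.keys D}" for e :: "'a edge"
  have finZ: "finite (Z e)" if "e \<in> \<E>" for e
    unfolding Z_def using finite_edge_preimage[OF that, of "Poly_Mapping.keys D"] by simp
  have Hepl: "epl g" if "g \<in> H" for g using H(1) G(2) that \<Sigma>_epl by blast
  obtain Fn :: "'a edge \<Rightarrow> 'a functional set" where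
    Fn: "\<And>e. e \<in> \<E> \<Longrightarrow> finite (Fn e) \<and> Fn e \<subseteq> UNIV \<times> UNIV \<times> H \<times> H"
    and brk: "\<And>e a. e \<in> \<E> \<Longrightarrow> paffine (tcomb \<Gamma> H a) e ((\<lambda>f. val f a) ` Fn e)"
    and const: "\<And>e z. e \<in> \<E> \<Longrightarrow> z \<in> Z e \<Longrightarrow> \<exists>f\<in>Fn e. \<forall>a. val f a = z"
    by (rule break_functionals[OF \<open>finite H\<close> H(2) Hepl finZ]) (assumption | blast)+
  obtain a0 \<rho>' where \<rho>': "\<rho>' > 0" "\<And>g. g \<in> H \<Longrightarrow> \<bar>a0 g - a g\<bar> + \<rho>' < \<rho>0"
    and stable: "\<And>a1 e f f'. (\<And>g. g \<in> H \<Longrightarrow> \<bar>a1 g - a0 g\<bar> \<le> \<rho>') \<Longrightarrow> e \<in> \<E> \<Longrightarrow> f \<in> Fn e \<Longrightarrow> f' \<in> Fn e \<Longrightarrow>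
       val f a0 = val f' a0 \<Longrightarrow> val f a1 = val f' a1"
    by (rule generic_coefficients[OF \<open>finite H\<close> Fn \<rho>0(1), where a = a]) (assumption | blast)+
  define E where "E = (\<lambda>a. D + pl_div \<Gamma> (tcomb \<Gamma> H a))"
  let ?pos = "positions (E a0)"
  obtain \<rho> sel where \<rho>: "\<rho> > 0" "\<rho> \<le> \<rho>'"
    and sel: "\<And>e t. (e, t) \<in> ?pos \<Longrightarrow> sel e t \<in> Fn e"
    and interior: "\<And>a1 e t. (\<And>g. g \<in> H \<Longrightarrow> \<bar>a1 g - a0 g\<bar> \<le> \<rho>) \<Longrightarrow> (e, t) \<in> ?pos \<Longrightarrow>
       0 < val (sel e t) a1 \<and> val (sel e t) a1 < fst e"
    and order: "\<And>a1 e t t'. (\<And>g. g \<in> H \<Longrightarrow> \<bar>a1 g - a0 g\<bar> \<le> \<rho>) \<Longrightarrow> (e, t) \<in> ?pos \<Longrightarrow> (e, t') \<in> ?pos \<Longrightarrow> t < t' \<Longrightarrow>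
       val (sel e t) a1 < val (sel e t') a1"
    and expand: "\<And>a1. (\<And>g. g \<in> H \<Longrightarrow> \<bar>a1 g - a0 g\<bar> \<le> \<rho>) \<Longrightarrow>
       E a1 = (\<Sum>p\<in>V. Poly_Mapping.single p (Poly_Mapping.lookup (E a0) p)) +
         (\<Sum>(e, t)\<in>?pos. Poly_Mapping.single (snd e (val (sel e t) a1)) (Poly_Mapping.lookup (E a0) (snd e t)))"
    unfolding E_def
    by (rule moving_divisor[OF H(1,2) \<rho>'(1) Fn brk const[unfolded Z_def] stable]) (assumption | blast)+
  define box where "box a1 \<longleftrightarrow> (\<forall>g\<in>H. \<bar>a1 g - a0 g\<bar> \<le> \<rho>)" for a1
  have boxD: "\<bar>a1 g - a0 g\<bar> \<le> \<rho>" if "box a1" "g \<in> H" for a1 g using that by (simp add: box_def)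
  have box_near: "\<bar>a1 g - a g\<bar> < \<rho>0" if "box a1" "g \<in> H" for a1 g
    using boxD[OF that] \<rho>'(2)[OF that(2)] \<rho>(2) by linarith
  have box_q: "g (q g) + a1 g < k (q g) + a1 k" if "box a1" "g \<in> H" "k \<in> H" "k \<noteq> g" for a1 g k
  proof (rule q(3)[OF _ that(2-4)])
    fix h assume "h \<in> H"
    then show "\<bar>a1 h - a h\<bar> < \<rho>1" using box_near[OF that(1)] \<rho>0(2) by fastforce
  qed
  have E_S: "E a1 \<in> S" if box: "box a1" for a1
    unfolding E_def
  proof (rule S[OF tcomb_in[OF H(1,2)]])
    fix x assume x: "x \<in> \<Gamma>"
    have "\<bar>tmin H a1 x - tmin H a x\<bar> \<le> \<eta> / 2"
      by (rule tmin_perturb[OF \<open>finite H\<close> H(2)]) (use box_near[OF box] \<rho>0(3) in fastforce)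
    moreover have "\<bar>tmin H a1 x - \<phi> x\<bar> \<le> \<bar>tmin H a1 x - tmin H a x\<bar> + \<bar>tmin H a x - \<phi> x\<bar>"
      using abs_triangle_ineq[of "tmin H a1 x - tmin H a x" "tmin H a x - \<phi> x"] by simp
    moreover have "\<bar>tmin H a x - \<phi> x\<bar> < \<eta> / 2" using near(2)[OF x] by (simp add: tcomb_apply x)
    ultimately show "\<bar>tcomb \<Gamma> H a1 x - \<phi> x\<bar> < \<eta>" unfolding tcomb_apply[OF x] by linarith
  qed
  have E_pos: "0 \<le> Poly_Mapping.lookup (E a0) p" for p
    using tcomb_in[OF H(1,2), of a0] \<Sigma>_R by (auto simp: E_def R_def effective_def)
  have finpos: "finite ?pos"
  proof (rule finite_imageD[OF _ positions_inj])
    have "Poly_Mapping.keys (E a0) \<subseteq> \<Gamma>" unfolding E_def by (rule keys_in[OF tcomb_in[OF H(1,2)]])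
    then show "finite ((\<lambda>(e, t). snd e t) ` ?pos)" by (simp add: positions_image)
  qed
  \<comment> \<open>Sorted, as \<open>face_coords\<close> wants the points of an edge in increasing
    order.\<close>
  define ts where "ts e = sorted_list_of_set {t. (e, t) \<in> ?pos}" for e
  have fints: "finite {t. (e, t) \<in> ?pos}" for e
    using finite_vimageI[OF finpos, of "Pair e"] by (simp add: inj_on_def vimage_def)
  have set_ts: "t \<in> set (ts e) \<longleftrightarrow> (e, t) \<in> ?pos" for e t using fints[of e] by (simp add: ts_def)
  have nth_ts: "(e, ts e ! j) \<in> ?pos" if "j < length (ts e)" for e j
    using nth_mem[OF that] by (simp only: set_ts)
  define \<mu> where "\<mu> e = map (\<lambda>t. nat (Poly_Mapping.lookup (E a0) (snd e t))) (ts e)" for e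
  define m where "m v = nat (Poly_Mapping.lookup (E a0) v)" for v
  define I where "I = face_index \<E> \<mu>"
  have I: "(e, j) \<in> I \<longleftrightarrow> e \<in> \<E> \<and> j < length (ts e)" for e j by (simp add: I_def face_index_def \<mu>_def)
  have "finite I" unfolding I_def by (rule finite_face_index)
  define L where "L = (\<lambda>(e, j). sel e (ts e ! j))"
  have L_in: "L i \<in> UNIV \<times> UNIV \<times> H \<times> H" if "i \<in> I" for i
  proof -
    obtain e j where i: "i = (e, j)" by (cases i)
    then have e: "e \<in> \<E>" "j < length (ts e)" using that I by auto
    have "L i \<in> Fn e" unfolding i L_def prod.case by (rule sel[OF nth_ts[OF e(2)]])
    then show ?thesis using Fn[OF e(1)] by blast
  qed
  define X where "X a1 = (\<Sum>i\<in>I. Poly_Mapping.single i (val (L i) a1))" for a1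
  have lX: "Poly_Mapping.lookup (X a1) i = (if i \<in> I then val (L i) a1 else 0)" for a1 i
  proof -
    have "Poly_Mapping.lookup (X a1) i = (\<Sum>j\<in>I. if j = i then val (L j) a1 else 0)"
      unfolding X_def lookup_sum by (intro sum.cong) (auto simp: lookup_single when_def)
    then show ?thesis using \<open>finite I\<close> by (simp add: sum.delta)
  qed
  have \<mu>0: "0 \<notin> set (\<mu> e)" for e
  proof
    assume "0 \<in> set (\<mu> e)"
    then obtain t where t: "t \<in> set (ts e)" "nat (Poly_Mapping.lookup (E a0) (snd e t)) = 0"
      unfolding \<mu>_def by auto
    have "Poly_Mapping.lookup (E a0) (snd e t) \<noteq> 0"
      using t(1) unfolding set_ts by (simp add: positions_def in_keys_iff)
    then show False using E_pos[of "snd e t"] t(2) by simp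
  qed
  have coords: "X a1 \<in> face_coords \<E> \<mu>" if box: "box a1" for a1
    unfolding face_coords_def mem_Collect_eq
  proof (intro conjI ballI allI impI)
    show "Poly_Mapping.keys (X a1) \<subseteq> face_index \<E> \<mu>"
      by (auto simp: in_keys_iff lX I_def[symmetric] split: if_splits)
  next
    fix e j assume e: "e \<in> \<E>" "j < length (\<mu> e)"
    then have "j < length (ts e)" by (simp add: \<mu>_def)
    then show "Poly_Mapping.lookup (X a1) (e, j) \<in> {0<..<fst e}"
      using interior[OF boxD[OF box] nth_ts] e(1) by (simp add: lX I L_def)
  next
    fix e i j assume e: "e \<in> \<E>" "i < j \<and> j < length (\<mu> e)"
    then have ij: "i < length (ts e)" "j < length (ts e)" "i < j" by (simp_all add: \<mu>_def)
    have "ts e ! i < ts e ! j"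
      using ij strict_sorted_list_of_set[of "{t. (e, t) \<in> ?pos}"] unfolding ts_def by (simp add: sorted_wrt_iff_nth_less)
    then show "Poly_Mapping.lookup (X a1) (e, i) < Poly_Mapping.lookup (X a1) (e, j)"
      using order[OF boxD[OF box] nth_ts[OF ij(1)] nth_ts[OF ij(2)]] e(1) ij by (simp add: lX I L_def)
  qed
  have bij: "bij_betw (\<lambda>(e, j). (e, ts e ! j)) I ?pos"
    unfolding bij_betw_def
  proof
    show "inj_on (\<lambda>(e, j). (e, ts e ! j)) I"
      by (rule inj_onI) (auto simp: I ts_def nth_eq_iff_index_eq)
    show "(\<lambda>(e, j). (e, ts e ! j)) ` I = ?pos"
    proof (intro equalityI subsetI)
      fix u assume u: "u \<in> ?pos"
      obtain e t where et: "u = (e, t)" by (cases u)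
      then have "t \<in> set (ts e)" "e \<in> \<E>" using u set_ts by (auto simp: positions_def)
      then obtain j where "j < length (ts e)" "ts e ! j = t" by (auto simp: in_set_conv_nth)
      then show "u \<in> (\<lambda>(e, j). (e, ts e ! j)) ` I"
        using \<open>e \<in> \<E>\<close> by (intro image_eqI[of _ _ "(e, j)"]) (simp_all add: I et)
    qed (auto simp: I nth_ts)
  qed
  have point: "face_point V \<E> m \<mu> (X a1) = E a1" if box: "box a1" for a1
  proof -
    have "(\<Sum>(e, j)\<in>I. Poly_Mapping.single (snd e (Poly_Mapping.lookup (X a1) (e, j))) (int (\<mu> e ! j))) =
        (\<Sum>i\<in>I. (\<lambda>(e, t). Poly_Mapping.single (snd e (val (sel e t) a1)) (Poly_Mapping.lookup (E a0) (snd e t)))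
           ((\<lambda>(e, j). (e, ts e ! j)) i))"
      by (intro sum.cong refl) (auto simp: lX L_def I \<mu>_def E_pos)
    also have "\<dots> = (\<Sum>(e, t)\<in>?pos. Poly_Mapping.single (snd e (val (sel e t) a1)) (Poly_Mapping.lookup (E a0) (snd e t)))"
      by (rule sum.reindex_bij_betw[OF bij])
    finally have "face_point V \<E> m \<mu> (X a1) = (\<Sum>p\<in>V. Poly_Mapping.single p (int (m p))) +
        (\<Sum>(e, t)\<in>?pos. Poly_Mapping.single (snd e (val (sel e t) a1)) (Poly_Mapping.lookup (E a0) (snd e t)))"
      unfolding face_point_def I_def by simp
    also have "(\<Sum>p\<in>V. Poly_Mapping.single p (int (m p))) = (\<Sum>p\<in>V. Poly_Mapping.single p (Poly_Mapping.lookup (E a0) p))"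
      by (simp add: m_def E_pos)
    also have "\<dots> + (\<Sum>(e, t)\<in>?pos. Poly_Mapping.single (snd e (val (sel e t) a1)) (Poly_Mapping.lookup (E a0) (snd e t))) = E a1"
      by (rule expand[symmetric]) (rule boxD[OF box])
    finally show ?thesis .
  qed
  have X_affine: "u *\<^sub>R X b + v *\<^sub>R X c = X (\<lambda>g. u * b g + v * c g)" if "u + v = 1" for u v b c
    by (rule poly_mapping_eqI) (simp add: lookup_add lX val_affine[OF that])
  define C where "C = X ` {a1. box a1}"
  have "convex C"
    unfolding convex_def
  proof (intro ballI allI impI)
    fix x y and u v :: real assume xy: "x \<in> C" "y \<in> C" and uv: "0 \<le> u" "0 \<le> v" "u + v = 1"
    obtain b c where b: "box b" "x = X b" and c: "box c" "y = X c" using xy by (auto simp: C_def)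
    have "\<bar>(u * b g + v * c g) - a0 g\<bar> \<le> \<rho>" if g: "g \<in> H" for g
    proof -
      have "(u * b g + v * c g) - a0 g = u * (b g - a0 g) + v * (c g - a0 g)"
        using uv(3) by (simp add: algebra_simps) (metis distrib_right mult_1)
      also have "\<bar>\<dots>\<bar> \<le> u * \<bar>b g - a0 g\<bar> + v * \<bar>c g - a0 g\<bar>"
        using uv(1,2) by (intro order_trans[OF abs_triangle_ineq]) (simp add: abs_mult)
      also have "\<dots> \<le> u * \<rho> + v * \<rho>"
        using uv(1,2) boxD[OF b(1) g] boxD[OF c(1) g] by (intro add_mono mult_left_mono) auto
      also have "\<dots> = \<rho>" using uv(3) by (metis distrib_right mult_1)
      finally show ?thesis .
    qed
    then have "box (\<lambda>g. u * b g + v * c g)" by (simp add: box_def)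
    then show "u *\<^sub>R x + v *\<^sub>R y \<in> C" unfolding b(2) c(2) X_affine[OF uv(3)] C_def by blast
  qed
  obtain i0 where i0: "i0 \<in> H" using H(2) by blast
  define H' where "H' = H - {i0}"
  define ag where "ag g = (\<lambda>k. a0 k + (if k = g then \<rho> else 0))" for g
  define v where "v g = X (ag g) - X a0" for g
  have lv: "Poly_Mapping.lookup (v g) i = (if i \<in> I then fst (snd (L i)) * (\<rho> * ((if fst (snd (snd (L i))) = g then 1 else 0)
      - (if snd (snd (snd (L i))) = g then 1 else 0))) else 0)" for g i
    by (cases "L i") (simp add: v_def lookup_minus lX val_def ag_def algebra_simps)
  have "finite H'" using \<open>finite H\<close> by (simp add: H'_def)
  have zero: "c g = 0" if sum0: "(\<Sum>g\<in>H'. c g *\<^sub>R v g) = 0" and g: "g \<in> H'" for c g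
  proof -
    \<comment> \<open>The relation is scaled down so that a1 stays in the box; the summand 1 avoids
      division by zero.\<close>
    define M where "M = 1 + (\<Sum>g\<in>H'. \<bar>c g\<bar>)"
    have M1: "M \<ge> 1" by (simp add: M_def sum_nonneg)
    have M: "\<bar>c k\<bar> \<le> M" if "k \<in> H'" for k
      using member_le_sum[OF that, of "\<lambda>k. \<bar>c k\<bar>"] \<open>finite H'\<close> by (simp add: M_def)
    define d where "d k = (if k \<in> H' then c k / M else 0)" for k
    define a1 where "a1 k = a0 k + \<rho> * d k" for k
    have d1: "\<bar>d k\<bar> \<le> 1" for k using M[of k] M1 by (simp add: d_def field_simps)
    have box1: "box a1"
      unfolding box_def
    proof
      fix k assume "k \<in> H"
      have "\<bar>\<rho> * d k\<bar> \<le> \<rho> * 1" unfolding abs_mult using d1[of k] \<rho>(1) by (intro mult_mono) auto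
      then show "\<bar>a1 k - a0 k\<bar> \<le> \<rho>" by (simp add: a1_def)
    qed
    have box0: "box a0" using \<rho>(1) by (simp add: box_def)
    have "X a1 = X a0"
    proof (rule poly_mapping_eqI)
      fix i
      show "Poly_Mapping.lookup (X a1) i = Poly_Mapping.lookup (X a0) i"
      proof (cases "i \<in> I")
        case True
        obtain b r j k where L: "L i = (b, r, j, k)" by (cases "L i")
        have "0 = Poly_Mapping.lookup (\<Sum>g\<in>H'. c g *\<^sub>R v g) i" using sum0 by simp
        also have "\<dots> = (\<Sum>g\<in>H'. c g * (r * (\<rho> * ((if j = g then 1 else 0) - (if k = g then 1 else 0)))))"
          using True by (simp add: lookup_sum lv L)
        also have "\<dots> = (\<Sum>g\<in>H'. (if g = j then r * \<rho> * c g else 0) - (if g = k then r * \<rho> * c g else 0))"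
          by (intro sum.cong) auto
        also have "\<dots> = M * (r * (\<rho> * d j - \<rho> * d k))"
          using \<open>finite H'\<close> M1 by (simp add: sum_subtractf sum.delta d_def algebra_simps)
        finally have "r * (\<rho> * d j - \<rho> * d k) = 0" using M1 by simp
        then show ?thesis using True by (simp add: lX L val_def a1_def algebra_simps)
      qed (simp add: lX)
    qed
    then have "E a1 = E a0" using point[OF box1] point[OF box0] by simp
    then have div: "pl_div \<Gamma> (tcomb \<Gamma> H a1) = pl_div \<Gamma> (tcomb \<Gamma> H a0)" by (simp add: E_def)
    obtain s where s: "\<And>g. g \<in> H \<Longrightarrow> a1 g = a0 g + s"
      by (rule coefficients_determined[OF H(1,2) div q(2) box_q[OF box1] box_q[OF box0]]) (assumption | blast)+
    \<comment> \<open>The coefficient of i0 is the same in a1 and a0, which fixes the common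
      constant.\<close>
    have "s = 0" using s[OF i0] by (simp add: a1_def d_def H'_def)
    then have "\<rho> * d g = 0" using s[of g] g by (simp add: a1_def H'_def)
    then show ?thesis using \<rho>(1) M1 g by (simp add: d_def)
  qed
  have inj: "inj_on v H'"
    by (rule independent_family(1)[of H' v, OF \<open>finite H'\<close>]) (rule zero)
  have ind: "independent (v ` H')"
    by (rule independent_family(2)[of H' v, OF \<open>finite H'\<close>]) (rule zero)
  define W where "W = insert (X a0) ((\<lambda>g. X a0 + v g) ` H')"
  have v0: "0 \<notin> v ` H'"
    using ind by (rule contrapos_nn) (rule dependent_zero)
  have notin: "X a0 \<notin> (\<lambda>g. X a0 + v g) ` H'"
  proof
    assume "X a0 \<in> (\<lambda>g. X a0 + v g) ` H'"
    then obtain g where "g \<in> H'" "X a0 = X a0 + v g" by (rule imageE)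
    then have "v g = 0" by (simp only: add_cancel_right_right)
    then show False using v0 \<open>g \<in> H'\<close> by (metis imageI)
  qed
  have cardW: "card W = card H"
  proof -
    have "inj_on (\<lambda>g. X a0 + v g) H'" using inj by (simp add: inj_on_def)
    then have "card W = Suc (card H')"
      unfolding W_def using notin \<open>finite H'\<close> by (simp add: card_image)
    then show ?thesis using card_Suc_Diff1[OF \<open>finite H\<close> i0] by (simp add: H'_def)
  qed
  have "(\<lambda>x. - X a0 + x) ` ((\<lambda>g. X a0 + v g) ` H') = v ` H'" by (simp add: image_image)
  then have indW: "\<not> affine_dependent W"
    unfolding W_def affine_dependent_iff_dependent[OF notin] using ind by simp
  have "W \<subseteq> C"
  proof
    fix w assume "w \<in> W"
    then consider "w = X a0" | g where "w = X (ag g)" by (auto simp: W_def v_def)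
    then show "w \<in> C"
    proof cases
      case 1
      then show ?thesis using \<rho>(1) by (auto simp: C_def box_def)
    next
      case 2
      have "box (ag g)" using \<rho>(1) by (simp add: box_def ag_def)
      then show ?thesis using 2 by (auto simp: C_def)
    qed
  qed
  then have hull: "convex hull W \<subseteq> C" using \<open>convex C\<close> by (rule hull_minimal)
  show ?thesis
  proof (intro exI[of _ m] exI[of _ \<mu>] exI[of _ W] conjI ballI)
    show "0 \<notin> set (\<mu> e)" for e by (rule \<mu>0)
    show "finite W" using \<open>finite H'\<close> by (simp add: W_def)
    show "card W = card H" by (rule cardW)
    show "\<not> affine_dependent W" by (rule indW)
    show "convex hull W \<subseteq> face_coords \<E> \<mu>" using hull coords by (auto simp: C_def)
    show "face_point V \<E> m \<mu> ` (convex hull W) \<subseteq> S"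
      using hull point E_S by (auto simp: C_def image_subset_iff)
  qed
qed

section \<open>The two ranks and the dimension near a point\<close>

lemma linear_system_in_Sym:
  assumes "\<phi> \<in> \<Sigma>"
  shows "D + pl_div \<Gamma> \<phi> \<in> {E. divisor_on \<Gamma> E \<and> effective E \<and> divisor_degree E = int (nat (divisor_degree D))}"
proof -
  have eff: "effective (D + pl_div \<Gamma> \<phi>)" using assms \<Sigma>_R by (auto simp: R_def)
  have "divisor_degree (pl_div \<Gamma> \<phi>) = 0"
    unfolding divisor_degree_def by (rule sum_pl_div_zero[OF \<Sigma>_epl[OF assms]]) simp_all
  then have "divisor_degree (D + pl_div \<Gamma> \<phi>) = divisor_degree D" by (simp add: divisor_degree_add)
  moreover have "divisor_degree (D + pl_div \<Gamma> \<phi>) \<ge> 0"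
    using eff by (simp add: divisor_degree_def effective_def sum_nonneg)
  ultimately show ?thesis using eff keys_in[OF assms] by (simp add: divisor_on_def)
qed

text \<open>Approximating any element, with an arbitrary error such as 1, already produces r + 1
  different generators.\<close>

lemma BN_bound:
  assumes "\<phi> \<in> \<Sigma>" "BN r"
  shows "r + 1 \<le> card G"
proof -
  obtain H a where "H \<subseteq> G" "r + 1 \<le> card H"
    using large_irredundant[OF assms, of 1] by (metis zero_less_one)
  then show ?thesis using card_mono[OF G(1)] by (meson order_trans)
qed

lemma BN_zero:
  assumes "\<phi> \<in> \<Sigma>"
  shows "BN 0"
  unfolding BN_def
proof (intro allI impI)
  fix D' assume D': "divisor_on \<Gamma> D' \<and> effective D' \<and> divisor_degree D' = int 0"
  then have "\<forall>x\<in>Poly_Mapping.keys D'. Poly_Mapping.lookup D' x = 0"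
    using sum_nonneg_eq_0_iff[of "Poly_Mapping.keys D'" "Poly_Mapping.lookup D'"]
    by (simp add: divisor_degree_def effective_def)
  then have "D' = 0" by (intro poly_mapping_eqI) (auto simp: in_keys_iff)
  then show "\<exists>\<phi>\<in>\<Sigma>. effective (D - D' + pl_div \<Gamma> \<phi>)"
    using assms \<Sigma>_R by (auto simp: R_def)
qed

text \<open>The condition holds for 0, as the module is nonempty, and fails from
  \<open>card G\<close> on, so the greatest integer exists and is nonnegative. Negative integers,
  for which the condition is vacuous, lie below it.\<close>

lemma BN_rank_greatest:
  assumes "\<phi> \<in> \<Sigma>"
  obtains r where "BN r" "BN_rank \<Gamma> D \<Sigma> = int r"
proof -
  obtain r where r: "BN r" "\<And>s. BN s \<Longrightarrow> s \<le> r"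
    using ex_has_greatest_nat[of BN 0 "\<lambda>n. n" "card G"] BN_zero[OF assms] BN_bound[OF assms] by fastforce
  have "BN_rank \<Gamma> D \<Sigma> = int r"
    unfolding BN_rank_def
  proof (rule Greatest_equality)
    show "\<forall>D'. divisor_on \<Gamma> D' \<and> effective D' \<and> divisor_degree D' = int r \<longrightarrow> (\<exists>\<phi>\<in>\<Sigma>. effective (D - D' + pl_div \<Gamma> \<phi>))"
      using r(1) unfolding BN_def .
    fix y assume y: "\<forall>D'. divisor_on \<Gamma> D' \<and> effective D' \<and> divisor_degree D' = y \<longrightarrow> (\<exists>\<phi>\<in>\<Sigma>. effective (D - D' + pl_div \<Gamma> \<phi>))"
    show "y \<le> int r"
    proof (cases "y < 0")
      case False
      then have "y = int (nat y)" by simp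
      with y have "BN (nat y)" unfolding BN_def by metis
      then show ?thesis using r(2) False by fastforce
    qed simp
  qed
  then show ?thesis using that r(1) by blast
qed

lemma irredundant_card:
  assumes "H \<subseteq> G" "H \<noteq> {}" "irredundant \<Gamma> H a"
  shows "card H \<le> ind_rank \<Gamma> \<Sigma>"
  unfolding ind_rank_def
proof (rule Greatest_le_nat)
  show "\<exists>F\<subseteq>\<Sigma>. finite F \<and> \<not> tropically_dependent \<Gamma> F \<and> card F = card H"
    using assms finite_sub_G[OF assms(1)] irredundant_independent[of H \<Gamma> a] G(2) by blast
  show "n \<le> card G" if "\<exists>F\<subseteq>\<Sigma>. finite F \<and> \<not> tropically_dependent \<Gamma> F \<and> card F = n" for n
    using that independent_card by blast
qed

text \<open>Here the two ranks meet: an irredundant minimum has at most \<open>ind_rank\<close> = r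
  + 1 terms, which bounds all simplices by \<open>simplex_bound\<close>, while
  \<open>large_irredundant\<close> provides at least r + 1 terms arbitrarily close to \<phi>. The
  value is the same for every neighbourhood U of x.\<close>

lemma polyhedral_dim_eq:
  assumes ind: "int (ind_rank \<Gamma> \<Sigma>) = BN_rank \<Gamma> D \<Sigma> + 1"
    and x: "x \<in> linear_system \<Gamma> D \<Sigma>" and U: "openin (Sym \<Gamma> d) U" "x \<in> U"
  shows "int (polyhedral_dim V \<E> (linear_system \<Gamma> D \<Sigma> \<inter> U)) = BN_rank \<Gamma> D \<Sigma>"
proof -
  obtain \<phi> where \<phi>: "\<phi> \<in> \<Sigma>" "x = D + pl_div \<Gamma> \<phi>" using x by (auto simp: linear_system_def)
  obtain r where r: "BN r" "BN_rank \<Gamma> D \<Sigma> = int r" using BN_rank_greatest[OF \<phi>(1)] .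
  have ind': "ind_rank \<Gamma> \<Sigma> = r + 1" using ind r(2) by simp
  have "\<phi> \<in> R \<Gamma> D" using \<phi>(1) \<Sigma>_R by blast
  obtain \<delta>1 where \<delta>1: "\<delta>1 > 0" "\<And>\<epsilon>. 0 < \<epsilon> \<and> \<epsilon> \<le> \<delta>1 \<Longrightarrow> \<exists>\<eta>>0. \<forall>\<theta>\<in>R \<Gamma> D. (\<forall>x\<in>\<Gamma>. \<bar>\<theta> x - \<phi> x\<bar> < \<eta>) \<longrightarrow>
    window (D + pl_div \<Gamma> \<phi>) (D + pl_div \<Gamma> \<theta>) \<epsilon>"
    using window_stable[OF D_on \<open>\<phi> \<in> R \<Gamma> D\<close>] by blast
  obtain \<delta>2 where \<delta>2: "\<delta>2 > 0" "\<And>\<epsilon>. 0 < \<epsilon> \<and> \<epsilon> \<le> \<delta>2 \<Longrightarrow>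
    (\<forall>E'. Poly_Mapping.keys E' \<subseteq> \<Gamma> \<and> effective E' \<and> window x E' \<epsilon> \<longrightarrow> E' \<in> U)"
    using Sym_neighbourhood[OF U] by blast
  define \<epsilon> where "\<epsilon> = min \<delta>1 \<delta>2"
  have \<epsilon>: "0 < \<epsilon> \<and> \<epsilon> \<le> \<delta>1" "0 < \<epsilon> \<and> \<epsilon> \<le> \<delta>2" using \<delta>1(1) \<delta>2(1) by (auto simp: \<epsilon>_def)
  obtain \<eta> where \<eta>: "\<eta> > 0" "\<forall>\<theta>\<in>R \<Gamma> D. (\<forall>x\<in>\<Gamma>. \<bar>\<theta> x - \<phi> x\<bar> < \<eta>) \<longrightarrow>
    window (D + pl_div \<Gamma> \<phi>) (D + pl_div \<Gamma> \<theta>) \<epsilon>" using \<delta>1(2)[OF \<epsilon>(1)] by blast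
  let ?S = "linear_system \<Gamma> D \<Sigma> \<inter> U"
  have S: "D + pl_div \<Gamma> \<theta> \<in> ?S" if \<theta>: "\<theta> \<in> \<Sigma>" "\<And>x. x \<in> \<Gamma> \<Longrightarrow> \<bar>\<theta> x - \<phi> x\<bar> < \<eta>" for \<theta>
  proof
    show "D + pl_div \<Gamma> \<theta> \<in> linear_system \<Gamma> D \<Sigma>" using \<theta>(1) by (simp add: linear_system_def)
    have "\<theta> \<in> R \<Gamma> D" using \<theta>(1) \<Sigma>_R by blast
    then have "window x (D + pl_div \<Gamma> \<theta>) \<epsilon>" using \<eta>(2) \<theta>(2) unfolding \<phi>(2) by blast
    moreover have "effective (D + pl_div \<Gamma> \<theta>)" using \<open>\<theta> \<in> R \<Gamma> D\<close> by (simp add: R_def)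
    ultimately show "D + pl_div \<Gamma> \<theta> \<in> U" using \<delta>2(2)[OF \<epsilon>(2)] keys_in[OF \<theta>(1)] by blast
  qed
  define N where "N = {n. \<exists>m \<mu> W. (\<forall>e\<in>\<E>. 0 \<notin> set (\<mu> e)) \<and>
            finite W \<and> card W = n + 1 \<and> \<not> affine_dependent W \<and>
            convex hull W \<subseteq> face_coords \<E> \<mu> \<and>
            face_point V \<E> m \<mu> ` (convex hull W) \<subseteq> ?S}"
  have upper: "n \<le> r" if n: "n \<in> N" for n
  proof -
    obtain m \<mu> W where W: "\<forall>e\<in>\<E>. 0 \<notin> set (\<mu> e)" "finite W" "card W = n + 1" "\<not> affine_dependent W"
      "convex hull W \<subseteq> face_coords \<E> \<mu>" "face_point V \<E> m \<mu> ` (convex hull W) \<subseteq> ?S"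
      using n unfolding N_def by blast
    have "card W \<le> r + 1"
    proof (rule simplex_bound[where \<H> = "{H. H \<subseteq> G \<and> H \<noteq> {} \<and> card H \<le> r + 1}" and D = D])
      show "finite {H. H \<subseteq> G \<and> H \<noteq> {} \<and> card H \<le> r + 1}" using G(1) by simp
      show "finite H \<and> H \<noteq> {} \<and> card H \<le> r + 1 \<and> (\<forall>g\<in>H. epl g)"
        if "H \<in> {H. H \<subseteq> G \<and> H \<noteq> {} \<and> card H \<le> r + 1}" for H
        using that finite_sub_G G(2) \<Sigma>_epl by blast
      show "\<exists>H\<in>{H. H \<subseteq> G \<and> H \<noteq> {} \<and> card H \<le> r + 1}. \<exists>a. E' = D + pl_div \<Gamma> (tcomb \<Gamma> H a)" if E': "E' \<in> ?S" for E'
      proof -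
        obtain \<theta> where \<theta>: "\<theta> \<in> \<Sigma>" "E' = D + pl_div \<Gamma> \<theta>" using E' by (auto simp: linear_system_def)
        obtain H a where H: "H \<subseteq> G" "H \<noteq> {}" "irredundant \<Gamma> H a" "\<theta> = tcomb \<Gamma> H a"
          using irredundant_exists[OF \<theta>(1)] .
        have "card H \<le> r + 1" using irredundant_card[OF H(1-3)] ind' by simp
        then show ?thesis using H \<theta>(2) by blast
      qed
      show "\<forall>e\<in>\<E>. 0 \<notin> set (\<mu> e)" by (rule W(1))
      show "W \<noteq> {}" using W(3) by auto
    qed (rule W)+
    then show ?thesis using W(3) by simp
  qed
  have "r \<in> N"
  proof -
    obtain H a where H: "H \<subseteq> G" "H \<noteq> {}" "irredundant \<Gamma> H a" "r + 1 \<le> card H"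
      "\<And>x. x \<in> \<Gamma> \<Longrightarrow> \<bar>tcomb \<Gamma> H a x - \<phi> x\<bar> < \<eta> / 2"
      using large_irredundant[OF \<phi>(1) r(1), of "\<eta> / 2"] \<eta>(1) by (metis half_gt_zero)
    \<comment> \<open>Exactly r + 1 is needed, because a simplex counted by N for the number r has r
      + 1 vertices.\<close>
    have cardH: "r + 1 = card H" using irredundant_card[OF H(1-3)] ind' H(4) by simp
    show ?thesis
      unfolding N_def mem_Collect_eq cardH
    proof (rule local_simplex[OF H(1-3) \<eta>(1), where \<phi> = \<phi>])
      show "\<bar>tcomb \<Gamma> H a x - \<phi> x\<bar> < \<eta> / 2" if "x \<in> \<Gamma>" for x using that by (rule H(5))
      show "D + pl_div \<Gamma> \<theta> \<in> ?S" if "\<theta> \<in> \<Sigma>" "\<And>x. x \<in> \<Gamma> \<Longrightarrow> \<bar>\<theta> x - \<phi> x\<bar> < \<eta>" for \<theta>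
        using that by (rule S)
    qed
  qed
  then have "Sup N = r" using upper by (intro cSup_eq_maximum)
  then show ?thesis unfolding polyhedral_dim_def N_def r(2) by simp
qed

end

theorem theorem1p5:
  fixes \<Gamma> :: "'a::metric_space set" and D :: "'a \<Rightarrow>\<^sub>0 int" and \<Sigma> :: "('a \<Rightarrow> real) set"
    and V :: "'a set" and \<E> :: "'a edge set"
  assumes "metric_graph \<Gamma>"
    and "divisor_on \<Gamma> D"
    and "tropical_linear_series \<Gamma> D \<Sigma>"
    and "simple_graph_model \<Gamma> V \<E>"
  shows "\<forall>x\<in>linear_system \<Gamma> D \<Sigma>.
    int (local_dim \<Gamma> V \<E> (nat (divisor_degree D)) (linear_system \<Gamma> D \<Sigma>) x) = BN_rank \<Gamma> D \<Sigma>"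
proof
  fix x assume x: "x \<in> linear_system \<Gamma> D \<Sigma>"
  obtain G where G: "finite G" "G \<subseteq> \<Sigma>" "\<Sigma> = tropical_span \<Gamma> G"
    using assms(3) unfolding tropical_linear_series_def finitely_generated_def by blast
  \<comment> \<open>The star around a point has a leg, and a leg of positive length has two
    points.\<close>
  have two: "\<exists>x\<in>\<Gamma>. \<exists>y\<in>\<Gamma>. x \<noteq> y"
  proof -
    obtain p n where p: "p \<in> \<Gamma>" "n \<ge> 1" "star_at \<Gamma> p n"
      using assms(1) unfolding metric_graph_def by blast
    then obtain \<epsilon> leg where leg: "\<epsilon> > 0" "\<forall>i<n. \<forall>j<n. \<forall>s\<in>{0..<\<epsilon>}. \<forall>t\<in>{0..<\<epsilon>}.
           dist (leg i s) (leg j t) = (if i = j then \<bar>s - t\<bar> else s + t)"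
        "ball p \<epsilon> \<inter> \<Gamma> = (\<Union>i<n. leg i ` {0..<\<epsilon>})"
      unfolding star_at_def by blast
    have "dist (leg 0 0) (leg 0 (\<epsilon> / 2)) = \<epsilon> / 2" using leg(1,2) p(2) by auto
    then have "leg 0 0 \<noteq> leg 0 (\<epsilon> / 2)" using leg(1) by auto
    moreover have "leg 0 t \<in> \<Gamma>" if "t \<in> {0..<\<epsilon>}" for t
    proof -
      have "leg 0 t \<in> (\<Union>i<n. leg i ` {0..<\<epsilon>})" using that p(2) by (intro UN_I[of 0]) auto
      then show ?thesis unfolding leg(3)[symmetric] by blast
    qed
    ultimately show ?thesis
      using leg(1) by (intro bexI[of _ "leg 0 0"] bexI[of _ "leg 0 (\<epsilon> / 2)"]) auto
  qed
  interpret generated_series \<Gamma> V \<E> D \<Sigma> G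
  proof
    show "compact \<Gamma>" "connected \<Gamma>" using assms(1) by (simp_all add: metric_graph_def)
    show "\<Sigma> \<subseteq> R \<Gamma> D" using assms(3) by (simp add: tropical_linear_series_def)
  qed (fact assms G two)+
  have ind: "int (ind_rank \<Gamma> \<Sigma>) = BN_rank \<Gamma> D \<Sigma> + 1"
    using assms(3) by (simp add: tropical_linear_series_def)
  let ?d = "nat (divisor_degree D)"
  let ?\<U> = "{U. openin (Sym \<Gamma> ?d) U \<and> x \<in> U}"
  have dim: "polyhedral_dim V \<E> (linear_system \<Gamma> D \<Sigma> \<inter> U) = nat (BN_rank \<Gamma> D \<Sigma>)"
    and nonneg: "BN_rank \<Gamma> D \<Sigma> \<ge> 0" if "U \<in> ?\<U>" for U
    using polyhedral_dim_eq[OF ind x, of ?d U] that by auto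
  obtain \<phi> where \<phi>: "\<phi> \<in> \<Sigma>" "x = D + pl_div \<Gamma> \<phi>" using x by (auto simp: linear_system_def)
  then have U: "{E. divisor_on \<Gamma> E \<and> effective E \<and> divisor_degree E = int ?d} \<in> ?\<U>"
    using Sym_space_open[of \<Gamma> ?d] linear_system_in_Sym[OF \<phi>(1)] by simp
  \<comment> \<open>All neighbourhoods give the same dimension and the whole space is one of them,
    so the infimum is that of a singleton.\<close>
  have "(\<lambda>U. polyhedral_dim V \<E> (linear_system \<Gamma> D \<Sigma> \<inter> U)) ` ?\<U> = (\<lambda>_. nat (BN_rank \<Gamma> D \<Sigma>)) ` ?\<U>"
    by (rule image_cong[OF refl dim])
  also have "\<dots> = {nat (BN_rank \<Gamma> D \<Sigma>)}"
    unfolding image_constant_conv by (rule if_not_P) (use U in blast)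
  finally have "local_dim \<Gamma> V \<E> ?d (linear_system \<Gamma> D \<Sigma>) x = nat (BN_rank \<Gamma> D \<Sigma>)"
    unfolding local_dim_def by (simp only: cInf_singleton)
  then show "int (local_dim \<Gamma> V \<E> ?d (linear_system \<Gamma> D \<Sigma>) x) = BN_rank \<Gamma> D \<Sigma>"
    using nonneg[OF U] by simp
qed

end
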